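(* Let $a<-1$ and let $f$, $\Omega$, $\mathcal B_+$, $\mathcal B_-$ be as in the context. The nonwandering set of $f$ on $\overline{\mathbf R^2}$ is $$\{x=\infty\}\cup\{y=\infty\}\cup\Omega=\overline{\mathbf R^2}\setminus(\mathcal B_+\cup\mathcal B_-).$$
   Context: Fix a real number $a<-1$. Let $\overline{\mathbf R^2}=(\mathbf R\cup\{\infty\})\times(\mathbf R\cup\{\infty\})$ (a compact torus, $+\infty$ and $-\infty$ identified to $\infty$ in each factor). The birational map $f(x,y)=\left(y\frac{x+a}{x-1},\,x+a-1\right)$, with inverse $f^{-1}(x,y)=\left(y+1-a,\,x\frac{y-a}{y+1}\right)$, extends continuously to $\overline{\mathbf R^2}\setminus I(f)$, resp. $\overline{\mathbf R^2}\setminus I(f^{-1})$, where $I(f)=\{(1,0),(-a,\infty)\}$ and $I(f^{-1})=\{(0,-1),(\infty,a)\}$. For $n\ge1$, $I(f^n)=\bigcup_{j=0}^{n-1}f^{-j}I(f)$ and $I(f^{-n})=\bigcup_{j=0}^{n-1}f^{j}I(f^{-1})$. The point $(\infty,\infty)$ is fixed by $f$. A point $p$ is wandering if it has a neighborhood $U$ such that $U\cap f^n(U\setminus I(f^n))=\emptyset$ for all $n\in\mathbf Z$, $n\ne0$; the nonwandering set is the set of points that are not wandering. The forward basin $\mathcal B_+$ (resp. backward basin $\mathcal B_-$) of $(\infty,\infty)$ is the set of points having a neighborhood $U$ on which $f^n$ converges uniformly to $(\infty,\infty)$ as $n\to+\infty$ (resp. $n\to-\infty$). Rectangles: $R_0=[1,\infty]\times[-\infty,-1]$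 and $R_1=[-\infty,0]\times[0,\infty]$. Words: $\Sigma\subset\{0,1\}^{\mathbf Z}$ is the set of bi-infinite sequences in which the block $11$ does not occur. For a finite block $w=w_{-n}\dots w_m$ ($n,m\ge0$) occurring in an element of $\Sigma$, $R(w)=\overline{\bigcap_{k=-n}^{m}f^{-k}(\operatorname{int}R_{w_k})}$ (images under iterates of $f^{\pm1}$; no point of $\operatorname{int}R_0\cup\operatorname{int}R_1$ is indeterminate for any iterate). For $w\in\Sigma$, $R(w)=\bigcap_{n,m\ge0}R(w_{-n}\dots w_m)$. Set $\Omega=\bigcup_{w\in\Sigma}R(w)$. *)

theory Defs
  imports "HOL-Analysis.Analysis"
begin

text \<open>The circle \<open>\<real> \<union> {\<infinity>}\<close> is the one-point compactification of the real line; \<open>None\<close> is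
  the point \<open>\<infinity>\<close>.\<close>

abbreviation circle :: "real option topology" where
  "circle \<equiv> Alexandroff_compactification euclideanreal"

type_synonym pt = "real option \<times> real option"

definition torus :: "pt topology" where
  "torus = prod_topology circle circle"

definition shift :: "real \<Rightarrow> real option \<Rightarrow> real option" where
  "shift c u = map_option (\<lambda>x. x + c) u"

text \<open>The continuous extension of \<open>(x + b) / (x + c)\<close> to the circle, for \<open>b \<noteq> c\<close>.\<close>

definition moebius :: "real \<Rightarrow> real \<Rightarrow> real option \<Rightarrow> real option" where
  "moebius b c u =
     (case u of None \<Rightarrow> Some 1
      | Some x \<Rightarrow> if x + c = 0 then None else Some ((x + b) / (x + c)))"

text \<open>Multiplication on the circle. It is the continuous extension of real multiplication except
  at \<open>(0, \<infinity>)\<close> and \<open>(\<infinity>, 0)\<close>, where no such extension exists and the value is a dummy.\<close>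

definition mult :: "real option \<Rightarrow> real option \<Rightarrow> real option" where
  "mult u v =
     (case (u, v) of (Some x, Some y) \<Rightarrow> Some (x * y) | _ \<Rightarrow> None)"

text \<open>The maps are total; their values on the indeterminacy sets are the dummy values
  inherited from \<open>mult\<close>.\<close>

definition fmap :: "real \<Rightarrow> pt \<Rightarrow> pt" where
  "fmap a = (\<lambda>(x, y). (mult y (moebius a (- 1) x), shift (a - 1) x))"

definition finv :: "real \<Rightarrow> pt \<Rightarrow> pt" where
  "finv a = (\<lambda>(x, y). (shift (1 - a) y, mult x (moebius (- a) 1 y)))"

definition indet :: "real \<Rightarrow> pt set" where
  "indet a = {(Some 1, Some 0), (Some (- a), None)}"

definition indet_inv :: "real \<Rightarrow> pt set" where
  "indet_inv a = {(Some 0, Some (- 1)), (None, Some a)}"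

definition fpow :: "real \<Rightarrow> int \<Rightarrow> pt \<Rightarrow> pt" where
  "fpow a n = (if 0 \<le> n then fmap a ^^ nat n else finv a ^^ nat (- n))"

definition indet_pow :: "real \<Rightarrow> int \<Rightarrow> pt set" where
  "indet_pow a n =
     (if 0 \<le> n then (\<Union>j\<in>{0..<n}. fpow a (- j) ` indet a)
      else (\<Union>j\<in>{0..<- n}. fpow a j ` indet_inv a))"

definition wandering :: "real \<Rightarrow> pt \<Rightarrow> bool" where
  "wandering a p \<longleftrightarrow>
     (\<exists>U. openin torus U \<and> p \<in> U \<and>
          (\<forall>n. n \<noteq> 0 \<longrightarrow> U \<inter> fpow a n ` (U - indet_pow a n) = {}))"

definition nonwandering_set :: "real \<Rightarrow> pt set" where
  "nonwandering_set a = {p \<in> topspace torus. \<not> wandering a p}"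

text \<open>\<open>basin a at_top\<close> and \<open>basin a at_bot\<close> are the forward and backward basins of
  \<open>(\<infinity>, \<infinity>)\<close>. On a compact space, uniform convergence of \<open>f\<^sup>n\<close> on \<open>U\<close> to a constant means that
  every neighbourhood \<open>V\<close> of the constant eventually contains all of \<open>f\<^sup>n(U)\<close>. The iterates have
  to be defined on \<open>U\<close>; as \<open>I(f\<^sup>n)\<close> grows with \<open>|n|\<close>, asking this eventually is asking it for
  all iterates in the given time direction.\<close>

definition basin :: "real \<Rightarrow> int filter \<Rightarrow> pt set" where
  "basin a F =
     {p. \<exists>U. openin torus U \<and> p \<in> U \<and>
         (\<forall>V. openin torus V \<and> (None, None) \<in> V \<longrightarrow>
            (\<forall>\<^sub>F n in F. U \<inter> indet_pow a n = {} \<and> fpow a n ` U \<subseteq> V))}"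

definition basin_plus :: "real \<Rightarrow> pt set" where
  "basin_plus a = basin a at_top"

definition basin_minus :: "real \<Rightarrow> pt set" where
  "basin_minus a = basin a at_bot"

text \<open>The closed arcs \<open>[c, \<infinity>]\<close> and \<open>[-\<infinity>, c]\<close> of the circle.\<close>

definition arc_above :: "real \<Rightarrow> real option set" where
  "arc_above c = insert None (Some ` {c..})"

definition arc_below :: "real \<Rightarrow> real option set" where
  "arc_below c = insert None (Some ` {..c})"

text \<open>Only the symbols \<open>0\<close> and \<open>1\<close> are used as arguments.\<close>

definition rect :: "nat \<Rightarrow> pt set" where
  "rect s = (if s = 0 then arc_above 1 \<times> arc_below (- 1) else arc_below 0 \<times> arc_above 0)"

definition golden_words :: "(int \<Rightarrow> nat) set" where
  "golden_words = {w. (\<forall>k. w k \<in> {0, 1}) \<and> (\<forall>k. \<not> (w k = 1 \<and> w (k + 1) = 1))}"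

text \<open>\<open>R(w\<^bsub>-n\<^esub> \<dots> w\<^bsub>m\<^esub>)\<close>, the finite block being cut out of the bi-infinite word \<open>w\<close>.\<close>

definition block_rect :: "real \<Rightarrow> (int \<Rightarrow> nat) \<Rightarrow> nat \<Rightarrow> nat \<Rightarrow> pt set" where
  "block_rect a w n m =
     torus closure_of (\<Inter>k\<in>{- int n..int m}. fpow a (- k) ` (torus interior_of rect (w k)))"

definition word_rect :: "real \<Rightarrow> (int \<Rightarrow> nat) \<Rightarrow> pt set" where
  "word_rect a w = (\<Inter>n. \<Inter>m. block_rect a w n m)"

definition Omega :: "real \<Rightarrow> pt set" where
  "Omega a = (\<Union>w\<in>golden_words. word_rect a w)"

text \<open>The remaining facts certify that \<open>fmap\<close> and \<open>finv\<close> are the continuous extensions of the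
  rational formulas: see \<open>fmap_Some\<close>, \<open>finv_Some\<close>, \<open>continuous_map_fmap\<close> and
  \<open>continuous_map_finv\<close>.\<close>

lemma topspace_torus: "topspace torus = UNIV"
  by (simp add: torus_def UNIV_option_conv[symmetric])

lemma openin_circle_iff:
  "openin circle S \<longleftrightarrow>
     open {x. Some x \<in> S} \<and> (None \<in> S \<longrightarrow> (\<exists>B. \<forall>x. \<bar>x\<bar> > B \<longrightarrow> Some x \<in> S))"
    (is "?L \<longleftrightarrow> ?R")
proof
  assume ?L
  then consider U where "open U" "S = Some ` U"
    | C where "compact C" "S = insert None (Some ` (- C))"
    by (auto simp: openin_Alexandroff_compactification Compl_eq_Diff_UNIV)
  then show ?R
  proof cases
    case 1
    then show ?thesis by (simp add: image_iff)
  next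
    case 2
    then obtain B where "\<forall>x\<in>C. \<bar>x\<bar> \<le> B"
      using compact_imp_bounded bounded_iff by (metis real_norm_def)
    moreover have "{x. Some x \<in> S} = - C" using 2 by auto
    ultimately show ?thesis using 2
      by (intro conjI impI exI[of _ B]) (force simp: compact_imp_closed open_Compl)+
  qed
next
  assume R: ?R
  have eq: "S - {None} = Some ` {x. Some x \<in> S}"
    by (auto simp: image_iff) (metis not_None_eq)
  show ?L
  proof (cases "None \<in> S")
    case False
    then show ?thesis using R eq by (metis Diff_insert_absorb Diff_empty open_openin
          openin_Alexandroff_compactification_image_Some insert_Diff_if Diff_idemp)
  next
    case True
    then obtain B where B: "\<And>x. \<bar>x\<bar> > B \<Longrightarrow> Some x \<in> S" using R by blast
    let ?C = "{x. Some x \<notin> S}"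
    have "?C \<subseteq> cball 0 B" using B by (force simp: dist_norm)
    moreover have "closed ?C" using R by (simp add: closed_def Compl_eq)
    ultimately have "compact ?C" by (meson bounded_cball bounded_subset compact_eq_bounded_closed)
    moreover have "S = insert None (Some ` (UNIV - ?C))"
      using True eq by auto
    ultimately show ?thesis
      using \<open>closed ?C\<close> unfolding openin_Alexandroff_compactification by auto
  qed
qed

lemma continuous_map_circleI:
  assumes "\<And>V. openin circle V \<Longrightarrow> open {x. g (Some x) \<in> V}"
    and "\<And>V. openin circle V \<Longrightarrow> g None \<in> V \<Longrightarrow> \<exists>B. \<forall>x. \<bar>x\<bar> > B \<longrightarrow> g (Some x) \<in> V"
  shows "continuous_map circle circle g"
proof -
  have "topspace circle = UNIV" by (simp add: UNIV_option_conv)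
  then show ?thesis unfolding continuous_map by (auto simp: openin_circle_iff[of "{x. _ x}"] assms)
qed

lemma continuous_map_affine:
  assumes "k \<noteq> 0"
  shows "continuous_map circle circle (map_option (\<lambda>x. k * x + c))"
proof (rule continuous_map_circleI)
  fix V assume V: "openin circle V"
  have "open ((\<lambda>x. k * x + c) -` {x. Some x \<in> V})"
    using V by (intro open_vimage) (auto simp: openin_circle_iff intro!: continuous_intros)
  then show "open {x. map_option (\<lambda>x. k * x + c) (Some x) \<in> V}" by (simp add: vimage_def)
  assume "map_option (\<lambda>x. k * x + c) None \<in> V"
  then obtain B where B: "\<And>x. \<bar>x\<bar> > B \<Longrightarrow> Some x \<in> V" using V by (auto simp: openin_circle_iff)
  have "B < \<bar>k * x + c\<bar>" if "(\<bar>B\<bar> + \<bar>c\<bar>) / \<bar>k\<bar> < \<bar>x\<bar>" for x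
  proof -
    have "\<bar>B\<bar> + \<bar>c\<bar> < \<bar>k * x\<bar>" using that assms by (simp add: field_simps abs_mult)
    then show ?thesis by linarith
  qed
  then show "\<exists>B. \<forall>x. \<bar>x\<bar> > B \<longrightarrow> map_option (\<lambda>x. k * x + c) (Some x) \<in> V" using B by auto
qed

definition cinv :: "real option \<Rightarrow> real option" where
  "cinv u = (case u of None \<Rightarrow> Some 0 | Some x \<Rightarrow> if x = 0 then None else Some (1 / x))"

lemma cinv_cinv: "cinv (cinv u) = u" by (auto simp: cinv_def split: option.splits)

lemma continuous_map_cinv: "continuous_map circle circle cinv"
proof (rule continuous_map_circleI)
  fix V assume V: "openin circle V"
  let ?V = "{x. Some x \<in> V}"
  have oV: "open ?V" using V by (simp add: openin_circle_iff)
  have 1: "open {x. x \<noteq> 0 \<and> 1 / x \<in> ?V}"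
  proof -
    have "open ((\<lambda>x. 1 / x) -` ?V \<inter> (- {0}))"
      by (subst Int_commute, rule continuous_open_preimage) (auto intro!: continuous_intros simp: oV)
    then show ?thesis by (simp add: vimage_def Int_def conj_commute)
  qed
  show "open {x. cinv (Some x) \<in> V}"
  proof (cases "None \<in> V")
    case False
    then have "{x. cinv (Some x) \<in> V} = {x. x \<noteq> 0 \<and> 1 / x \<in> ?V}" by (auto simp: cinv_def)
    with 1 show ?thesis by simp
  next
    case True
    then obtain B where B: "\<And>x. \<bar>x\<bar> > B \<Longrightarrow> Some x \<in> V" using V by (auto simp: openin_circle_iff)
    have "1 / x \<in> ?V" if "x \<noteq> 0" "\<bar>x\<bar> < 1 / (\<bar>B\<bar> + 1)" for x
    proof -
      have "\<bar>B\<bar> + 1 < \<bar>1 / x\<bar>" using that by (simp add: field_simps)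
      then show ?thesis using B by simp
    qed
    then have "{x. cinv (Some x) \<in> V} = {x. x \<noteq> 0 \<and> 1 / x \<in> ?V} \<union> ball 0 (1 / (\<bar>B\<bar> + 1))"
      using True by (auto simp: cinv_def)
    with open_Un[OF 1 open_ball] show ?thesis by simp
  qed
  assume "cinv None \<in> V"
  then have "0 \<in> ?V" by (simp add: cinv_def)
  then obtain e where e: "e > 0" "\<And>x. \<bar>x\<bar> < e \<Longrightarrow> x \<in> ?V"
    using oV unfolding open_dist by (metis diff_zero dist_real_def)
  have "cinv (Some x) \<in> V" if "\<bar>x\<bar> > 1 / e" for x
  proof -
    have "x \<noteq> 0" using that e(1) by (auto simp: field_simps)
    moreover then have "\<bar>1 / x\<bar> < e" using that e(1) by (simp add: field_simps)
    ultimately show ?thesis using e(2) by (auto simp: cinv_def)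
  qed
  then show "\<exists>B. \<forall>x. \<bar>x\<bar> > B \<longrightarrow> cinv (Some x) \<in> V" by blast
qed

lemma continuous_map_shift: "continuous_map circle circle (shift c)"
  using continuous_map_affine[of 1 c] by (simp add: shift_def[abs_def])

lemma continuous_map_moebius:
  assumes "b \<noteq> c"
  shows "continuous_map circle circle (moebius b c)"
proof -
  have "moebius b c = map_option (\<lambda>x. (b - c) * x + 1) \<circ> cinv \<circ> shift c"
  proof
    fix u show "moebius b c u = (map_option (\<lambda>x. (b - c) * x + 1) \<circ> cinv \<circ> shift c) u"
      by (cases u) (auto simp: moebius_def cinv_def shift_def divide_simps)
  qed
  moreover have "continuous_map circle circle (map_option (\<lambda>x. (b - c) * x + 1))"
    using assms by (intro continuous_map_affine) simp
  ultimately show ?thesis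
    using continuous_map_compose[OF continuous_map_compose[OF continuous_map_shift continuous_map_cinv]]
    by (simp add: comp_assoc)
qed

lemma continuous_map_mult:
  "continuous_map (subtopology torus (- {(Some 0, None), (None, Some 0)})) circle
     (\<lambda>(u, v). mult u v)"
proof -
  let ?D = "- {(Some 0, None), (None, Some 0)} :: pt set"
  have tc: "topspace circle = UNIV" by (simp add: UNIV_option_conv)
  have ts: "topspace (subtopology torus ?D) = ?D" by (auto simp: topspace_torus)
  have fin: "\<exists>A B. open A \<and> open B \<and> x \<in> A \<and> y \<in> B \<and> (\<forall>s\<in>A. \<forall>t\<in>B. Some (s * t) \<in> V)"
    if V: "openin circle V" and xy: "Some (x * y) \<in> V" for V and x y :: real
  proof -
    have "open ((\<lambda>(s, t). s * t) -` {x. Some x \<in> V})"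
      using V by (intro open_vimage) (auto simp: openin_circle_iff case_prod_beta intro!: continuous_intros)
    moreover have "(x, y) \<in> (\<lambda>(s, t). s * t) -` {x. Some x \<in> V}" using xy by simp
    ultimately obtain A B where "open A" "open B" "(x, y) \<in> A \<times> B"
        "A \<times> B \<subseteq> (\<lambda>(s, t). s * t) -` {x. Some x \<in> V}" by (rule open_prod_elim)
    then show ?thesis by (intro exI[of _ A] exI[of _ B]) auto
  qed
  have box: "\<exists>A B. openin circle A \<and> openin circle B \<and> u \<in> A \<and> v \<in> B \<and>
       (\<forall>s\<in>A. \<forall>t\<in>B. mult s t \<in> V)"
    if V: "openin circle V" and uv: "(u, v) \<in> ?D" "mult u v \<in> V" for V u v
  proof (cases "\<exists>x y. u = Some x \<and> v = Some y")
    case True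
    then obtain x y where *: "u = Some x" "v = Some y" by blast
    then obtain A B where "open A" "open B" "x \<in> A" "y \<in> B" "\<forall>s\<in>A. \<forall>t\<in>B. Some (s * t) \<in> V"
      using fin[OF V, of x y] uv by (auto simp: mult_def)
    then show ?thesis using * by (intro exI[of _ "Some ` A"] exI[of _ "Some ` B"]) (auto simp: mult_def)
  next
    case False
    have pre: "openin circle {u. cinv u \<in> S}" if "openin circle S" for S
      using openin_continuous_map_preimage[OF continuous_map_cinv that] unfolding tc by simp
    have m: "mult s t = cinv (mult (cinv s) (cinv t))" if "s \<noteq> Some 0" "t \<noteq> Some 0" for s t
      using that by (auto simp: mult_def cinv_def split: option.splits)
    have nz: "u \<noteq> Some 0" "v \<noteq> Some 0" using False uv by auto
    then obtain x y where xy: "cinv u = Some x" "cinv v = Some y"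
      by (cases u; cases v) (auto simp: cinv_def)
    have "Some (x * y) \<in> {u. cinv u \<in> V}" using m[OF nz] uv(2) xy by (auto simp: mult_def)
    from fin[OF pre[OF V] this] obtain A B where AB: "open A" "open B" "x \<in> A" "y \<in> B"
        "\<forall>s\<in>A. \<forall>t\<in>B. Some (s * t) \<in> {u. cinv u \<in> V}"
      by (elim exE conjE)
    let ?A = "{u. cinv u \<in> Some ` A}" and ?B = "{u. cinv u \<in> Some ` B}"
    have "mult s t \<in> V" if "s \<in> ?A" "t \<in> ?B" for s t
    proof -
      have "s \<noteq> Some 0" "t \<noteq> Some 0" using that by (auto simp: cinv_def)
      then show ?thesis using m[of s t] that AB(5) by (auto simp: mult_def)
    qed
    then show ?thesis using pre AB(1-4) xy
      by (intro exI[of _ ?A] exI[of _ ?B]) auto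
  qed
  have "openin (subtopology torus ?D) {p \<in> ?D. (case p of (u, v) \<Rightarrow> mult u v) \<in> V}"
    if V: "openin circle V" for V
  proof (subst openin_subopen, intro ballI)
    fix p assume p: "p \<in> {p \<in> ?D. (case p of (u, v) \<Rightarrow> mult u v) \<in> V}"
    obtain u v where p_eq: "p = (u, v)" by (cases p)
    have uv: "(u, v) \<in> ?D" "mult u v \<in> V" using p unfolding p_eq by auto
    from box[OF V uv] obtain A B where AB: "openin circle A" "openin circle B" "u \<in> A" "v \<in> B"
       "\<forall>s\<in>A. \<forall>t\<in>B. mult s t \<in> V" by (elim exE conjE)
    have "openin torus (A \<times> B)"
      using AB(1,2) by (simp add: torus_def openin_prod_Times_iff)
    then have "openin (subtopology torus ?D) ((A \<times> B) \<inter> ?D)"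
      by (rule openin_subtopology_Int)
    then show "\<exists>T. openin (subtopology torus ?D) T \<and> p \<in> T \<and>
           T \<subseteq> {p \<in> ?D. (case p of (u, v) \<Rightarrow> mult u v) \<in> V}"
      using AB(3-5) uv unfolding p_eq by (intro exI[of _ "(A \<times> B) \<inter> ?D"]) auto
  qed
  then show ?thesis unfolding continuous_map ts using tc by auto
qed

lemma continuous_map_fmap:
  assumes "a < - 1"
  shows "continuous_map (subtopology torus (- indet a)) torus (fmap a)"
proof -
  let ?X = "subtopology torus (- indet a)"
  have c: "continuous_map ?X circle fst" "continuous_map ?X circle snd"
    by (auto simp: torus_def continuous_map_from_subtopology continuous_map_fst continuous_map_snd)
  have mo: "continuous_map ?X circle (moebius a (- 1) \<circ> fst)"
    using assms by (intro continuous_map_compose[OF c(1)] continuous_map_moebius) simp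
  have pr: "continuous_map ?X (subtopology torus (- {(Some 0, None), (None, Some 0)}))
     (\<lambda>p. (snd p, moebius a (- 1) (fst p)))"
    using assms c mo by (auto simp: continuous_map_in_subtopology torus_def comp_def
        continuous_map_pairedI indet_def moebius_def split: option.splits if_splits)
  have "continuous_map ?X circle ((\<lambda>(u, v). mult u v) \<circ> (\<lambda>p. (snd p, moebius a (- 1) (fst p))))"
    by (rule continuous_map_compose[OF pr continuous_map_mult])
  moreover have "continuous_map ?X circle (shift (a - 1) \<circ> fst)"
    by (rule continuous_map_compose[OF c(1) continuous_map_shift])
  ultimately show ?thesis
    unfolding torus_def fmap_def by (simp add: comp_def case_prod_beta' continuous_map_pairedI)
qed

lemma continuous_map_finv:
  assumes "a < - 1"
  shows "continuous_map (subtopology torus (- indet_inv a)) torus (finv a)"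
proof -
  let ?X = "subtopology torus (- indet_inv a)"
  have c: "continuous_map ?X circle fst" "continuous_map ?X circle snd"
    by (auto simp: torus_def continuous_map_from_subtopology continuous_map_fst continuous_map_snd)
  have mo: "continuous_map ?X circle (moebius (- a) 1 \<circ> snd)"
    using assms by (intro continuous_map_compose[OF c(2)] continuous_map_moebius) simp
  have pr: "continuous_map ?X (subtopology torus (- {(Some 0, None), (None, Some 0)}))
     (\<lambda>p. (fst p, moebius (- a) 1 (snd p)))"
    using assms c mo by (auto simp: continuous_map_in_subtopology torus_def comp_def
        continuous_map_pairedI indet_inv_def moebius_def split: option.splits if_splits)
  have "continuous_map ?X circle ((\<lambda>(u, v). mult u v) \<circ> (\<lambda>p. (fst p, moebius (- a) 1 (snd p))))"
    by (rule continuous_map_compose[OF pr continuous_map_mult])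
  moreover have "continuous_map ?X circle (shift (1 - a) \<circ> snd)"
    by (rule continuous_map_compose[OF c(2) continuous_map_shift])
  ultimately show ?thesis
    unfolding torus_def finv_def by (simp add: comp_def case_prod_beta' continuous_map_pairedI)
qed

lemma fmap_Some:
  "x \<noteq> 1 \<Longrightarrow> fmap a (Some x, Some y) = (Some (y * ((x + a) / (x - 1))), Some (x + a - 1))"
  by (simp add: fmap_def moebius_def mult_def shift_def)

lemma finv_Some:
  "y \<noteq> - 1 \<Longrightarrow> finv a (Some x, Some y) = (Some (y + 1 - a), Some (x * ((y - a) / (y + 1))))"
  by (simp add: finv_def moebius_def mult_def shift_def add_eq_0_iff)

end

theory Submission
  imports Defs
begin

text \<open>
  Write \<open>A = - a > 1\<close>. The map \<open>f\<close> is conjugate to its inverse by the involution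
  \<open>(x, y) \<mapsto> (- y, - x)\<close>, so every statement about the future has a mirror image about the past.
  The set of points outside both basins contains the lines at infinity, and a finite point outside the
  basins keeps its orbit in the two rectangles until, possibly, it hits a collapsed side \<open>x = 1\<close> or,
  backwards, \<open>y = - 1\<close> and from then on moves along the lines at infinity; such a point can be pushed
  into the interiors of arbitrarily long blocks, so it lies in \<open>\<Omega>\<close>.

  For pairs of points with the same symbols the quantity \<open>\<bar>\<Delta> ln \<bar>x\<bar>\<bar> - \<bar>\<Delta> ln \<bar>y\<bar>\<bar>\<close>, taken with a
  minus sign on \<open>R\<^sub>1\<close>, strictly increases along orbits and is bounded above at the times where the word
  reads \<open>00\<close>, with a definite relative gain there. As no finite point has an itinerary ending in
  \<open>010101\<dots>\<close>, this shows that \<open>R(w)\<close> has at most one finite point, and if it has one, it has no other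
  point at all. Since every finite admissible word is realised, the finite points of \<open>\<Omega>\<close> are nonwandering.

  For the lines at infinity, follow a vertical ray \<open>{(t, y) | t \<ge> T}\<close>. By the intermediate value theorem
  some of its points pass near \<open>(\<infinity>, \<infinity>)\<close> and come out with a prescribed abscissa \<open>x\<^sub>0 = y + 1 - a\<close>;
  the longer the passage, the larger is the second coordinate, so the next iterate is again near
  \<open>(\<infinity>, y)\<close>. That finite points cannot stay near \<open>(\<infinity>, \<infinity>)\<close> in the pattern \<open>0101\<dots>\<close> comes from the
  functions \<open>D = x - 1 - y\<close> and \<open>r = x / D\<close>: under \<open>f\<^sup>2\<close>, \<open>r\<close> drops by at least \<open>2 / D\<close>
  while \<open>D\<close> grows at most linearly, and the harmonic series diverges.
\<close>


subsection \<open>The torus and the involution\<close>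

text \<open>The signs in \<open>V\<close> are chosen so that \<open>V\<close> changes sign under the
  involution. If \<open>V\<close> were positive on a pair of finite points of one
  \<open_placeholder>\<close>

definition flip :: "pt \<Rightarrow> pt" where
  "flip = (\<lambda>(x, y). (map_option uminus y, map_option uminus x))"

lemma flip_flip [simp]: "flip (flip p) = p"
  by (auto simp: flip_def option.map_comp o_def option.map_ident split: prod.splits)

lemma flip_image_iff: "p \<in> flip ` S \<longleftrightarrow> flip p \<in> S"
  by (metis flip_flip image_iff)

lemma flip_Pair [simp]: "flip (Some x, Some y) = (Some (- y), Some (- x))"
  "flip (None, v) = (map_option uminus v, None)"
  "flip (u, None) = (None, map_option uminus u)"
  by (simp_all add: flip_def)

lemma topspace_circle: "topspace circle = UNIV"
  by (simp add: UNIV_option_conv)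

lemma openin_torus_Times: "openin circle S \<Longrightarrow> openin circle T \<Longrightarrow> openin torus (S \<times> T)"
  by (simp add: torus_def openin_prod_Times_iff)

lemma Hausdorff_torus: "Hausdorff_space torus"
  by (simp add: torus_def Hausdorff_space_prod_topology Hausdorff_space_Alexandroff_compactification
     Hausdorff_space_euclidean locally_compact_space_euclidean)

lemma compact_torus: "compact_space torus"
  by (simp add: torus_def compact_space_prod_topology)

lemma continuous_map_flip: "continuous_map torus torus flip"
proof -
  have "continuous_map circle circle (map_option uminus)"
    using continuous_map_affine[of "- 1" 0] by simp
  then show ?thesis
    unfolding torus_def flip_def case_prod_beta'
    by (intro continuous_map_pairedI continuous_map_compose[OF continuous_map_snd, unfolded o_def]
        continuous_map_compose[OF continuous_map_fst, unfolded o_def])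
qed

lemma openin_flip: "openin torus (flip ` U) \<longleftrightarrow> openin torus U"
proof -
  have *: "openin torus (flip ` U)" if "openin torus U" for U
  proof -
    have "flip ` U = {p \<in> topspace torus. flip p \<in> U}"
      by (auto simp: flip_image_iff topspace_torus)
    then show ?thesis using openin_continuous_map_preimage[OF continuous_map_flip that] by simp
  qed
  have "flip ` flip ` U = U" by (force simp: image_image)
  then show ?thesis using * by metis
qed

definition emb :: "real \<times> real \<Rightarrow> pt" where
  "emb z = (Some (fst z), Some (snd z))"

lemma emb_inj [simp]: "emb z = emb z' \<longleftrightarrow> z = z'"
  by (auto simp: emb_def prod_eq_iff)

lemma pt_cases:
  obtains (finite) z where "p = emb z" | (fst) y where "p = (None, y)" | (snd) x where "p = (x, None)"
proof (cases p)
  case (Pair x y)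
  then show ?thesis using that by (cases x; cases y) (auto simp: emb_def)
qed

lemma openin_emb: "openin torus (emb ` U) \<longleftrightarrow> open U"
proof
  assume "open U"
  show "openin torus (emb ` U)"
  proof (subst openin_subopen, intro ballI)
    fix p assume "p \<in> emb ` U"
    then obtain z where z: "z \<in> U" "p = emb z" by blast
    from \<open>open U\<close> z(1) obtain S T where ST: "open S" "open T" "z \<in> S \<times> T" "S \<times> T \<subseteq> U"
      by (rule open_prod_elim)
    then have "openin torus (Some ` S \<times> Some ` T)"
      by (intro openin_torus_Times) auto
    moreover have "p \<in> Some ` S \<times> Some ` T" using z ST by (auto simp: emb_def)
    moreover have "Some ` S \<times> Some ` T \<subseteq> emb ` U" using ST by (force simp: emb_def)
    ultimately show "\<exists>T. openin torus T \<and> p \<in> T \<and> T \<subseteq> emb ` U" by blast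
  qed
next
  assume *: "openin torus (emb ` U)"
  show "open U"
  proof (subst open_subopen, intro ballI)
    fix z assume "z \<in> U"
    then have "(Some (fst z), Some (snd z)) \<in> emb ` U" by (auto simp: emb_def)
    then obtain S T where ST: "openin circle S" "openin circle T" "Some (fst z) \<in> S" "Some (snd z) \<in> T"
       "S \<times> T \<subseteq> emb ` U"
      using * unfolding torus_def openin_prod_topology_alt by metis
    then have "open ({x. Some x \<in> S} \<times> {x. Some x \<in> T})"
      by (intro open_Times) (auto simp: openin_circle_iff)
    moreover have "z \<in> {x. Some x \<in> S} \<times> {x. Some x \<in> T}" using ST by (auto simp: mem_Times_iff)
    moreover have "{x. Some x \<in> S} \<times> {x. Some x \<in> T} \<subseteq> U" using ST(5) by (force simp: emb_def)
    ultimately show "\<exists>T. open T \<and> z \<in> T \<and> T \<subseteq> U" by blast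
  qed
qed

lemma open_emb_vimage: "openin torus U \<Longrightarrow> open {z. emb z \<in> U}"
proof -
  assume U: "openin torus U"
  have "openin torus (emb ` UNIV)" by (simp add: openin_emb)
  with U have "openin torus (U \<inter> emb ` UNIV)" by (rule openin_Int)
  moreover have "U \<inter> emb ` UNIV = emb ` {z. emb z \<in> U}" by auto
  ultimately show ?thesis by (simp add: openin_emb)
qed

text \<open>\<open>f\<close> and \<open>fi\<close> undo each other only away from exceptional
  points, so cancelling iterates has to be justified along the given orbit.\<close>

lemma funpow_comm_inverse:
  assumes "\<And>i. i < n \<Longrightarrow> g (f ((f ^^ i) p)) = (f ^^ i) p" "j \<le> n"
  shows "(g ^^ j) ((f ^^ n) p) = (f ^^ (n - j)) p"
  using assms(2)
proof (induction j)
  case (Suc j)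
  then have "(g ^^ j) ((f ^^ n) p) = (f ^^ Suc (n - Suc j)) p" by (simp add: Suc_diff_Suc)
  then have "(g ^^ Suc j) ((f ^^ n) p) = g (f ((f ^^ (n - Suc j)) p))" by simp
  also have "\<dots> = (f ^^ (n - Suc j)) p" using Suc.prems by (intro assms(1)) simp
  finally show ?case .
qed simp

lemma funpow_Suc_comm: "(f ^^ n) (f x) = f ((f ^^ n) x)"
  by (metis funpow_swap1)

section \<open>The map in real coordinates and its reversal\<close>

locale golden =
  fixes A :: real
  assumes A: "1 < A"
begin

abbreviation "f \<equiv> fmap (- A)"
abbreviation "fi \<equiv> finv (- A)"
abbreviation "f_pow \<equiv> fpow (- A)"
abbreviation "I \<equiv> indet_pow (- A)"
abbreviation "Ind \<equiv> indet (- A)"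
abbreviation "Ind_inv \<equiv> indet_inv (- A)"

text \<open>On the line \<open>fst z = 1\<close> division by zero yields the meaningless value
  \<open>(0, - A)\<close>; \<open>F\<close> represents \<open>f\<close> only off this line.\<close>

definition F :: "real \<times> real \<Rightarrow> real \<times> real" where
  "F z = (snd z * ((fst z - A) / (fst z - 1)), fst z - (A + 1))"

lemma f_emb: "fst z \<noteq> 1 \<Longrightarrow> f (emb z) = emb (F z)"
  by (simp add: emb_def F_def fmap_Some)

text \<open>The line \<open>x = 1\<close> collapses to one point at infinity. At the indeterminacy
  point \<open>y = 0\<close> this is only the dummy value of \<open>mult\<close>.\<close>

lemma f_emb1: "f (emb (1, y)) = (None, Some (- A))"
  by (simp add: emb_def fmap_def moebius_def mult_def shift_def)

lemma f_inf: "f (None, y) = (y, None)" "f (x, None) = (None, shift (- A - 1) x)"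
  by (cases y, simp_all add: fmap_def moebius_def mult_def shift_def split: option.split)

lemma fi_inf: "fi (x, None) = (None, x)" "fi (None, y) = (shift (A + 1) y, None)"
  by (cases x, simp_all add: finv_def moebius_def mult_def shift_def add.commute split: option.split)

lemma moebius_uminus: "moebius (- A) (- 1) (map_option uminus y) = moebius A 1 y"
proof (cases y)
  case (Some t)
  have "(- t + - A) / (- t + - 1) = (t + A) / (t + 1)"
    using minus_divide_left[of "t+A"] by (smt (verit) minus_divide_divide)
  moreover have "(- t + - 1 = 0) = (t + 1 = 0)" by linarith
  ultimately show ?thesis using Some by (simp add: moebius_def)
qed (simp add: moebius_def)

lemma f_flip: "f (flip p) = flip (fi p)"
proof (cases p)
  case (Pair x y)
  have "mult (map_option uminus x) m = map_option uminus (mult x m)" for m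
    by (auto simp: mult_def split: option.splits)
  moreover have "shift (- A - 1) (map_option uminus y) = map_option uminus (shift (1 + A) y)"
    by (cases y) (auto simp: shift_def)
  ultimately show ?thesis unfolding Pair
    by (simp add: fmap_def finv_def flip_def moebius_uminus)
qed

lemma fi_flip: "fi (flip p) = flip (f p)"
  by (metis f_flip flip_flip)

lemma funpow_f_flip: "(f ^^ n) (flip p) = flip ((fi ^^ n) p)"
  by (induction n) (auto simp: f_flip)

lemma funpow_fi_flip: "(fi ^^ n) (flip p) = flip ((f ^^ n) p)"
  by (induction n) (auto simp: fi_flip)

lemma Ind_flip: "flip ` Ind = Ind_inv" "flip ` Ind_inv = Ind"
  by (auto simp: indet_def indet_inv_def)

lemma f_pow_of_nat [simp]: "f_pow (int n) = f ^^ n"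
  by (simp add: fpow_def)

lemma f_pow_minus_of_nat [simp]: "f_pow (- int n) = fi ^^ n"
  by (cases "n = 0") (auto simp: fpow_def)

lemma f_pow_flip: "f_pow n (flip p) = flip (f_pow (- n) p)"
  by (auto simp: fpow_def funpow_f_flip funpow_fi_flip)

lemma I_of_nat: "I (int n) = (\<Union>j<n. (fi ^^ j) ` Ind)"
proof -
  have "{0..<int n} = int ` {..<n}" by (simp add: image_int_atLeastLessThan lessThan_atLeast0)
  then show ?thesis by (simp add: indet_pow_def)
qed

lemma I_minus_of_nat: "I (- int n) = (\<Union>j<n. (f ^^ j) ` Ind_inv)"
proof (cases "n = 0")
  case False
  have "{0..<int n} = int ` {..<n}" by (simp add: image_int_atLeastLessThan lessThan_atLeast0)
  then show ?thesis using False by (simp add: indet_pow_def)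
qed (simp add: indet_pow_def)

lemma I_flip: "flip ` I n = I (- n)"
proof -
  have *: "flip ` I (int n) = I (- int n)" for n
    unfolding I_of_nat I_minus_of_nat image_UN image_image
    by (simp add: funpow_f_flip[symmetric] flip: Ind_flip(1)) (simp add: image_image)
  show ?thesis
  proof (cases n rule: int_cases2)
    case (nonneg k) then show ?thesis using * by simp
  next
    case (nonpos k)
    then have "flip ` I n = flip ` flip ` I (int k)" using * by simp
    then show ?thesis using nonpos by (simp add: image_image)
  qed
qed

text \<open>Among finite points, the map \<open>fi\<close> collapses exactly the lines
  \<open>y = - 1\<close> and \<open>y = - A\<close>, and it sends them to the two points of
  \<open>Ind\<close>. Hence the hypothesis excludes precisely the finite points that cannot be
  recovered.\<close>

lemma f_fi: "fi p \<notin> Ind \<Longrightarrow> f (fi p) = p"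
proof (cases p rule: pt_cases)
  case (finite z)
  assume *: "fi p \<notin> Ind"
  obtain x y where z: "z = (x, y)" by (cases z)
  have y: "y \<noteq> -1" "y \<noteq> - A" using * A unfolding finite z
    by (auto simp: emb_def finv_def indet_def mult_def moebius_def shift_def split: if_splits option.splits)
  then have "fi p = emb (y + 1 + A, x * ((y + A) / (y + 1)))"
    unfolding finite z using finv_Some[of y "- A" x] by (simp add: emb_def)
  moreover have "y + A \<noteq> 0" "y + 1 \<noteq> 0" using y by auto
  ultimately show ?thesis unfolding finite z
    by (simp add: f_emb F_def)
next
  case (fst y) then show ?thesis
    by (cases y) (auto simp: fi_inf f_inf shift_def)
next
  case (snd x) then show ?thesis by (cases x) (auto simp: fi_inf f_inf shift_def)
qed

lemma fi_f: "f p \<notin> Ind_inv \<Longrightarrow> fi (f p) = p"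
proof -
  assume "f p \<notin> Ind_inv"
  then have "fi (flip p) \<notin> Ind" by (metis fi_flip Ind_flip(1) flip_flip imageI)
  then have "flip (f (fi (flip p))) = p" by (simp add: f_fi)
  then show ?thesis by (simp add: fi_flip f_flip)
qed

end

subsection \<open>Basins of attraction and wandering points\<close>

lemma inj_flip: "inj flip"
  by (metis inj_on_def flip_flip)

lemma flip_Int: "flip ` S \<inter> flip ` T = flip ` (S \<inter> T)"
  by (simp add: image_Int[OF inj_flip])

lemma wandering_flip_aux:
  assumes "wandering a p" and fl: "\<And>n p. fpow a n (flip p) = flip (fpow a (- n) p)"
    "\<And>n. flip ` indet_pow a n = indet_pow a (- n)"
  shows "wandering a (flip p)"
proof -
  obtain U where U: "openin torus U" "p \<in> U" "\<And>n. n \<noteq> 0 \<Longrightarrow> U \<inter> fpow a n ` (U - indet_pow a n) = {}"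
    using assms(1) unfolding wandering_def by blast
  have "flip ` U \<inter> fpow a n ` (flip ` U - indet_pow a n) = {}" if "n \<noteq> 0" for n
  proof -
    have "flip ` U - indet_pow a n = flip ` (U - indet_pow a (- n))"
      using fl(2)[of "- n"] by (simp add: image_set_diff[OF inj_flip])
    then have "fpow a n ` (flip ` U - indet_pow a n) = flip ` fpow a (- n) ` (U - indet_pow a (- n))"
      by (simp add: image_image fl(1))
    then show ?thesis using U(3)[of "- n"] that by (simp add: flip_Int)
  qed
  then show ?thesis unfolding wandering_def using U(1,2)
    by (intro exI[of _ "flip ` U"]) (auto simp: openin_flip)
qed

lemma eventually_at_top_int_iff: "(\<forall>\<^sub>F n::int in at_top. P n) \<longleftrightarrow> (\<forall>\<^sub>F k in sequentially. P (int k))"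
proof
  assume "\<forall>\<^sub>F n::int in at_top. P n"
  then obtain N where "\<And>n. n \<ge> N \<Longrightarrow> P n" by (auto simp: eventually_at_top_linorder)
  then show "\<forall>\<^sub>F k in sequentially. P (int k)"
    by (intro eventually_sequentiallyI[of "nat N"]) auto
next
  assume "\<forall>\<^sub>F k in sequentially. P (int k)"
  then obtain N where N: "\<And>n. n \<ge> N \<Longrightarrow> P (int n)" by (auto simp: eventually_sequentially)
  have "P n" if "n \<ge> int N" for n using N[of "nat n"] that by simp
  then show "\<forall>\<^sub>F n::int in at_top. P n" by (auto simp: eventually_at_top_linorder)
qed

lemma eventually_at_bot_int_iff: "(\<forall>\<^sub>F n::int in at_bot. P n) \<longleftrightarrow> (\<forall>\<^sub>F k in sequentially. P (- int k))"
  using eventually_at_top_int_iff[of "\<lambda>n. P (- n)"]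
  by (simp add: at_top_mirror eventually_filtermap)

lemma infinity_nhds:
  assumes "openin torus V" "(None, None) \<in> V"
  obtains M where "\<And>z. \<bar>fst z\<bar> > M \<Longrightarrow> \<bar>snd z\<bar> > M \<Longrightarrow> emb z \<in> V"
    "\<And>x. \<bar>x\<bar> > M \<Longrightarrow> (Some x, None) \<in> V"
proof -
  obtain S T where ST: "openin circle S" "openin circle T" "None \<in> S" "None \<in> T" "S \<times> T \<subseteq> V"
    using assms unfolding torus_def openin_prod_topology_alt by metis
  obtain B C where "\<And>x. \<bar>x\<bar> > B \<Longrightarrow> Some x \<in> S" "\<And>x. \<bar>x\<bar> > C \<Longrightarrow> Some x \<in> T"
    using ST by (auto simp: openin_circle_iff)
  then show ?thesis using ST by (intro that[of "max B C"]) (auto simp: emb_def)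
qed

lemma emb_mem [simp]: "emb z \<in> emb ` S \<longleftrightarrow> z \<in> S"
  by (auto simp: image_iff)

lemma emb_Pair: "(Some x, Some y) = emb (x, y)"
  by (simp add: emb_def)

lemma emb_neq [simp]: "emb z \<noteq> (None, y)" "emb z \<noteq> (x, None)" "(None, y) \<noteq> emb z" "(x, None) \<noteq> emb z"
  by (auto simp: emb_def)

lemma funpow_funpow: "(g ^^ m) ((g ^^ n) x) = (g ^^ (m + n)) x"
  by (simp add: funpow_add)

lemma openin_torus_UNIV: "openin torus UNIV"
  using openin_topspace[of torus] by (simp add: topspace_torus)

context golden begin

lemma wandering_flip: "wandering (- A) (flip p) \<longleftrightarrow> wandering (- A) p"
  using wandering_flip_aux[OF _ f_pow_flip I_flip, of p] wandering_flip_aux[OF _ f_pow_flip I_flip, of "flip p"]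
  by auto

text \<open>A trap for backward orbits of indeterminacy points: it is mapped into itself by
  \<open>fi\<close>, contains \<open>Ind\<close> and misses \<open>Ind_inv\<close>. So it contains
  every \<open>I (int n)\<close>, while the open third quadrant and the interiors of the rectangles
  lie outside.\<close>

definition Q1 :: "pt set" where
  "Q1 = emb ` {z. 0 \<le> fst z \<and> 0 \<le> snd z} \<union> {(Some x, None) |x. 0 < x} \<union> {(None, Some y) |y. 0 < y}"

lemma fi_emb: "snd z \<noteq> - 1 \<Longrightarrow> fi (emb z) = emb (snd z + 1 + A, fst z * ((snd z + A) / (snd z + 1)))"
  by (simp add: emb_def finv_Some)

lemma fi_Q1: "p \<in> Q1 \<Longrightarrow> fi p \<in> Q1"
  using A by (auto simp: Q1_def fi_emb fi_inf shift_def)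

lemma Ind_Q1: "Ind \<subseteq> Q1"
  using A by (auto simp: Q1_def indet_def emb_Pair)

lemma emb_Q1: "emb z \<in> Q1 \<longleftrightarrow> 0 \<le> fst z \<and> 0 \<le> snd z"
  by (auto simp: Q1_def)

lemma Ind_inv_Q1: "Ind_inv \<inter> Q1 = {}"
  using A by (auto simp: Q1_def indet_inv_def emb_def)

lemma fi_iter_Ind: "p \<in> Ind \<Longrightarrow> (fi ^^ n) p \<in> Q1"
  by (induction n) (use Ind_Q1 fi_Q1 in auto)

lemma fi_iter_Ind_not_inv: "p \<in> Ind \<Longrightarrow> (fi ^^ n) p \<notin> Ind_inv"
  using fi_iter_Ind Ind_inv_Q1 by blast

lemma f_iter_Ind_inv: "p \<in> Ind_inv \<Longrightarrow> (f ^^ n) p \<notin> Ind"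
  using fi_iter_Ind_not_inv[of "flip p" n] Ind_flip
  by (metis flip_flip funpow_fi_flip imageI)

lemma f_fi_Q1: "p \<in> Q1 \<Longrightarrow> f (fi p) = p"
  using A by (intro f_fi) (auto simp: Q1_def fi_emb fi_inf shift_def indet_def emb_Pair)

lemma I_Q1: "I (int n) \<subseteq> Q1"
  using fi_iter_Ind by (auto simp: I_of_nat)

lemma I_finite: "emb z \<in> I (int n) \<Longrightarrow> 0 \<le> fst z \<and> 0 \<le> snd z"
  using I_Q1 emb_Q1 by blast

lemma I_mono: "n \<le> m \<Longrightarrow> I (int n) \<subseteq> I (int m)"
  by (fastforce simp: I_of_nat)

lemma I_f: "p \<in> I (int (Suc n)) \<Longrightarrow> p \<notin> Ind \<Longrightarrow> f p \<in> I (int n)"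
proof -
  assume p: "p \<in> I (int (Suc n))" "p \<notin> Ind"
  then obtain j e where j: "j < Suc n" "e \<in> Ind" "p = (fi ^^ j) e" unfolding I_of_nat by auto
  then obtain i where i: "j = Suc i" using p(2) by (cases j) auto
  then have "f p = (fi ^^ i) e" using j f_fi_Q1[OF fi_iter_Ind] by simp
  then show ?thesis using i j by (auto simp: I_of_nat)
qed

lemma I_fi: "p \<in> I (int n) \<Longrightarrow> fi p \<in> I (int (Suc n))"
proof -
  assume "p \<in> I (int n)"
  then obtain j e where j: "j < n" "e \<in> Ind" "p = (fi ^^ j) e" unfolding I_of_nat by auto
  then have "fi p = (fi ^^ Suc j) e" "Suc j < Suc n" by simp_all
  then show ?thesis using j(2) unfolding I_of_nat by blast
qed

text \<open>If the orbit met \<open>Ind\<close> at time \<open>i\<close>, it could not have met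
  \<open>Ind_inv\<close> before, because orbits starting in \<open>Ind_inv\<close> never reach
  \<open>Ind\<close>. So \<open>fi\<close> retraces it and puts \<open>p\<close> into
  \<open>I (int n)\<close>.\<close>

lemma iter_not_Ind:
  assumes "p \<notin> I (int n)" "i < n"
  shows "(f ^^ i) p \<notin> Ind"
proof
  assume *: "(f ^^ i) p \<in> Ind"
  have "(f ^^ j) p \<notin> Ind_inv" if "j \<le> i" for j
    using f_iter_Ind_inv[of "(f ^^ j) p" "i - j"] * that by (auto simp: funpow_funpow)
  then have "fi (f ((f ^^ j) p)) = (f ^^ j) p" if "j < i" for j
    using that by (intro fi_f) (metis Suc_leI funpow.simps(2) o_apply)
  then have "(fi ^^ i) ((f ^^ i) p) = p" using funpow_comm_inverse[of i fi f p i] by simp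
  then show False using * assms by (auto simp: I_of_nat image_iff) (metis lessThan_iff)
qed

lemma closedin_finite_torus: "finite S \<Longrightarrow> closedin torus S"
  by (simp add: closedin_Hausdorff_finite[OF Hausdorff_torus] topspace_torus)

lemma openin_minus_finite: "openin torus U \<Longrightarrow> finite S \<Longrightarrow> openin torus (U - S)"
  by (simp add: openin_diff closedin_finite_torus)

lemma finite_Ind [simp]: "finite Ind" "finite Ind_inv"
  by (auto simp: indet_def indet_inv_def)

lemma openin_f:
  assumes "openin torus V"
  shows "openin torus {p. p \<notin> Ind \<and> f p \<in> V}"
proof -
  have *: "openin torus (- Ind)"
    using openin_minus_finite[of "topspace torus" Ind] by (simp add: topspace_torus openin_torus_UNIV Compl_eq_Diff_UNIV)
  have "openin (subtopology torus (- Ind)) {p \<in> topspace (subtopology torus (- Ind)). f p \<in> V}"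
    using A assms by (intro openin_continuous_map_preimage[OF continuous_map_fmap]) auto
  then have "openin torus {p \<in> topspace (subtopology torus (- Ind)). f p \<in> V}"
    using * by (simp add: openin_open_subtopology)
  then show ?thesis by (simp add: topspace_torus)
qed

lemma openin_f_iter:
  assumes "openin torus V"
  shows "openin torus {p. (\<forall>i<n. (f ^^ i) p \<notin> Ind) \<and> (f ^^ n) p \<in> V}"
proof (induction n)
  case (Suc n)
  have "{p. (\<forall>i<Suc n. (f ^^ i) p \<notin> Ind) \<and> (f ^^ Suc n) p \<in> V} =
    {p. p \<notin> Ind \<and> f p \<in> {p. (\<forall>i<n. (f ^^ i) p \<notin> Ind) \<and> (f ^^ n) p \<in> V}}"
    by (auto simp: funpow_Suc_comm All_less_Suc2 )
  then show ?case using openin_f[OF Suc] by simp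
qed (use assms in simp)

lemma f_iter_nhds:
  assumes "openin torus V" "\<And>i. i < n \<Longrightarrow> (f ^^ i) p \<notin> Ind" "(f ^^ n) p \<in> V"
  obtains U where "openin torus U" "p \<in> U" "(f ^^ n) ` U \<subseteq> V" "\<And>z. z \<in> U \<Longrightarrow> \<forall>i<n. (f ^^ i) z \<notin> Ind"
  using assms openin_f_iter[of V n] by (intro that[of "{p. (\<forall>i<n. (f ^^ i) p \<notin> Ind) \<and> (f ^^ n) p \<in> V}"]) auto

text \<open>A return in backward time is a forward return of the image point, provided that
  \<open>f\<close> retraces the backward orbit. This could fail only if that orbit met
  \<open>Ind\<close>, and then its end point would lie in \<open>I (int m)\<close>, which
  \<open>U\<close> avoids.\<close>

lemma wandering_posI:
  assumes U: "openin torus U" "p \<in> U" and I: "\<And>n. U \<inter> I (int n) = {}"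
    and pos: "\<And>n z. 0 < n \<Longrightarrow> z \<in> U \<Longrightarrow> (f ^^ n) z \<notin> U"
  shows "wandering (- A) p"
  unfolding wandering_def
proof (intro exI[of _ U] conjI U allI impI)
  fix n :: int assume n: "n \<noteq> 0"
  show "U \<inter> f_pow n ` (U - I n) = {}"
  proof (cases n rule: int_cases2)
    case (nonneg m)
    then show ?thesis using pos[of m] n by auto
  next
    case (nonpos m)
    have m: "0 < m" using n nonpos by simp
    have "(fi ^^ m) z \<notin> U" if z: "z \<in> U" for z
    proof
      assume u: "(fi ^^ m) z \<in> U"
      have "(fi ^^ Suc i) z \<notin> Ind" if i: "i < m" for i
      proof
        assume "(fi ^^ Suc i) z \<in> Ind"
        moreover have "(fi ^^ m) z = (fi ^^ (m - Suc i)) ((fi ^^ Suc i) z)"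
          using i by (simp add: funpow_funpow del: funpow.simps)
        ultimately have "(fi ^^ m) z \<in> I (int m)" using i unfolding I_of_nat
          by (metis (no_types, lifting) UN_iff diff_less imageI lessThan_iff m zero_less_Suc)
        then show False using I u by blast
      qed
      then have "f (fi ((fi ^^ i) z)) = (fi ^^ i) z" if "i < m" for i
        using f_fi[of "(fi ^^ i) z"] that by simp
      then have "(f ^^ m) ((fi ^^ m) z) = z" using funpow_comm_inverse[of m f fi z m] by simp
      then show False using pos[OF m u] z by simp
    qed
    then show ?thesis using nonpos by auto
  qed
qed

section \<open>The basins, their symmetry and their behaviour under pullback\<close>

lemma basin_plus_iff:
  "p \<in> basin_plus (- A) \<longleftrightarrow> (\<exists>U. openin torus U \<and> p \<in> U \<and> (\<forall>n. U \<inter> I (int n) = {}) \<and>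
     (\<forall>V. openin torus V \<and> (None, None) \<in> V \<longrightarrow> (\<forall>\<^sub>F n in sequentially. (f ^^ n) ` U \<subseteq> V)))"
   (is "?L = (\<exists>U. ?R U)")
proof
  assume ?L
  then obtain U where U: "openin torus U" "p \<in> U"
    "\<And>V. openin torus V \<Longrightarrow> (None, None) \<in> V \<Longrightarrow>
       (\<forall>\<^sub>F n in sequentially. U \<inter> I (int n) = {} \<and> (f ^^ n) ` U \<subseteq> V)"
    unfolding basin_plus_def basin_def eventually_at_top_int_iff by auto
  have "\<forall>\<^sub>F n in sequentially. U \<inter> I (int n) = {}"
    using U(3)[of UNIV] by (auto simp: eventually_conj_iff openin_topspace[of torus, unfolded topspace_torus])
  then obtain N where N: "\<And>n. n \<ge> N \<Longrightarrow> U \<inter> I (int n) = {}" by (auto simp: eventually_sequentially)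
  have "U \<inter> I (int n) = {}" for n using N[of "max n N"] I_mono[of n "max n N"] by auto
  then have "?R U" using U by (auto simp: eventually_conj_iff)
  then show "\<exists>U. ?R U" ..
next
  assume "\<exists>U. ?R U"
  then obtain U where "?R U" ..
  then show ?L unfolding basin_plus_def basin_def eventually_at_top_int_iff
    by (intro CollectI exI[of _ U]) auto
qed

lemma basin_minus_iff: "p \<in> basin_minus (- A) \<longleftrightarrow> flip p \<in> basin_plus (- A)"
proof -
  have *: "flip p \<in> basin (- A) F2"
    if p: "p \<in> basin (- A) F1" and F: "\<And>P. eventually P F1 \<Longrightarrow> eventually (\<lambda>n. P (- n)) F2" for p F1 F2
  proof -
    obtain U where U: "openin torus U" "p \<in> U"
      "\<And>V. openin torus V \<Longrightarrow> (None, None) \<in> V \<Longrightarrow> (\<forall>\<^sub>F n in F1. U \<inter> I n = {} \<and> f_pow n ` U \<subseteq> V)"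
      using p unfolding basin_def by blast
    have "\<forall>\<^sub>F n in F2. flip ` U \<inter> I n = {} \<and> f_pow n ` flip ` U \<subseteq> V"
      if V: "openin torus V" "(None, None) \<in> V" for V
    proof -
      have "\<forall>\<^sub>F n in F1. U \<inter> I n = {} \<and> f_pow n ` U \<subseteq> flip ` V"
        using V by (intro U) (auto simp: openin_flip flip_image_iff)
      then have "\<forall>\<^sub>F n in F2. U \<inter> I (- n) = {} \<and> f_pow (- n) ` U \<subseteq> flip ` V" by (rule F)
      then show ?thesis
      proof eventually_elim
        case (elim n)
        then have "flip ` U \<inter> flip ` I (- n) = {}" by (simp add: flip_Int)
        moreover have "f_pow n ` flip ` U \<subseteq> V"
          using elim by (auto simp: f_pow_flip flip_image_iff)
        ultimately show ?case by (simp add: I_flip)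
      qed
    qed
    then show ?thesis using U(1,2) unfolding basin_def
      by (intro CollectI exI[of _ "flip ` U"]) (auto simp: openin_flip)
  qed
  have e1: "eventually P at_top \<Longrightarrow> eventually (\<lambda>n. P (- n)) (at_bot :: int filter)" for P
    by (simp add: eventually_at_top_int_iff eventually_at_bot_int_iff)
  have e2: "eventually P at_bot \<Longrightarrow> eventually (\<lambda>n. P (- n)) (at_top :: int filter)" for P
    by (simp add: eventually_at_top_int_iff eventually_at_bot_int_iff)
  show ?thesis
    using *[of p at_bot at_top, OF _ e2] *[of "flip p" at_top at_bot, OF _ e1]
    unfolding basin_minus_def basin_plus_def by auto
qed

text \<open>The backward orbit of the indeterminacy point \<open>(A, \<infinity>)\<close> contains
  the points \<open>(A + k (A + 1), \<infinity>)\<close>. It accumulates at the fixed point, so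
  every neighbourhood meets some \<open>I (int n)\<close>.\<close>

lemma infinity_not_basin: "(None, None) \<notin> basin_plus (- A)" "(None, None) \<notin> basin_minus (- A)"
proof -
  have fi: "(fi ^^ (2 * k)) (Some A, None) = (Some (A + real k * (A + 1)), None)" for k
    by (induction k) (simp_all add: fi_inf shift_def algebra_simps)
  show 1: "(None, None) \<notin> basin_plus (- A)"
  proof
    assume "(None, None) \<in> basin_plus (- A)"
    then obtain U where U: "openin torus U" "(None, None) \<in> U" "\<And>n. U \<inter> I (int n) = {}"
      unfolding basin_plus_iff by blast
    from infinity_nhds[OF U(1,2)] obtain M where M: "\<And>x. \<bar>x\<bar> > M \<Longrightarrow> (Some x, None) \<in> U" by metis
    obtain k :: nat where k: "M < real k" using reals_Archimedean2 by blast
    have "real k * 1 \<le> real k * (A + 1)" using A by (intro mult_left_mono) auto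
    then have "M < \<bar>A + real k * (A + 1)\<bar>" using A k by simp
    then have "(Some (A + real k * (A + 1)), None) \<in> U" by (rule M)
    moreover have "(Some A, None) \<in> Ind" by (simp add: indet_def)
    then have "(Some (A + real k * (A + 1)), None) \<in> I (int (Suc (2 * k)))"
      unfolding I_of_nat fi[symmetric] by blast
    ultimately show False using U(3) by blast
  qed
  then show "(None, None) \<notin> basin_minus (- A)"
    by (simp add: basin_minus_iff flip_def)
qed

text \<open>Late returns are impossible since all of \<open>U\<close> has moved near the fixed
  point. For each of the finitely many earlier times, \<open>p\<close> is not periodic, because its
  orbit converges to a point other than \<open>p\<close>; so continuity gives a smaller
  neighbourhood without return.\<close>

lemma basin_plus_wandering:
  assumes p: "p \<in> basin_plus (- A)"
  shows "wandering (- A) p"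
proof -
  obtain U where U: "openin torus U" "p \<in> U" "\<And>n. U \<inter> I (int n) = {}"
    "\<And>V. openin torus V \<Longrightarrow> (None, None) \<in> V \<Longrightarrow> (\<forall>\<^sub>F n in sequentially. (f ^^ n) ` U \<subseteq> V)"
    using p unfolding basin_plus_iff by blast
  have "p \<noteq> (None, None)" using p infinity_not_basin by blast
  then obtain V W where VW: "openin torus V" "openin torus W" "(None, None) \<in> V" "p \<in> W" "V \<inter> W = {}"
    using Hausdorff_torus unfolding Hausdorff_space_def disjnt_def topspace_torus by (metis UNIV_I)
  obtain N where N: "\<And>n. n \<ge> N \<Longrightarrow> (f ^^ n) ` U \<subseteq> V"
    using U(4)[OF VW(1,3)] by (auto simp: eventually_sequentially)
  have "\<exists>X. openin torus X \<and> p \<in> X \<and> (\<forall>z\<in>X. (f ^^ n) z \<notin> X)" if n: "0 < n" for n :: nat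
  proof -
    have "(f ^^ n) p \<noteq> p"
    proof
      assume *: "(f ^^ n) p = p"
      have "((f ^^ n) ^^ k) p = p" for k by (induction k) (auto simp: *)
      then have "(f ^^ (n * N)) p = p" by (simp add: funpow_mult)
      moreover have "(f ^^ (n * N)) ` U \<subseteq> V" using n by (intro N) auto
      ultimately show False using U(2) VW by force
    qed
    then obtain P R where PR: "openin torus P" "openin torus R" "(f ^^ n) p \<in> R" "p \<in> P" "R \<inter> P = {}"
      using Hausdorff_torus unfolding Hausdorff_space_def disjnt_def topspace_torus by (metis UNIV_I)
    have "(f ^^ i) p \<notin> Ind" if "i < n" for i using iter_not_Ind[of p n i] that U by blast
    then obtain Y where "openin torus Y" "p \<in> Y" "(f ^^ n) ` Y \<subseteq> R"
      using f_iter_nhds[OF PR(2)] PR(3) by metis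
    then show ?thesis using PR by (intro exI[of _ "Y \<inter> P"]) auto
  qed
  then obtain X where X: "\<And>n. 0 < n \<Longrightarrow> openin torus (X n) \<and> p \<in> X n \<and> (\<forall>z\<in>X n. (f ^^ n) z \<notin> X n)"
    by metis
  \<comment> \<open>The case distinction keeps the index set of the intersection nonempty.\<close>
  define Y where "Y = (if N \<le> 1 then UNIV else \<Inter>n\<in>{1..<N}. X n)"
  have Y: "openin torus Y" "p \<in> Y" using X openin_topspace[of torus]
    by (auto simp: Y_def topspace_torus intro!: openin_Inter)
  show ?thesis
  proof (rule wandering_posI[of "U \<inter> W \<inter> Y"])
    fix n :: nat and z assume n: "0 < n" and z: "z \<in> U \<inter> W \<inter> Y"
    show "(f ^^ n) z \<notin> U \<inter> W \<inter> Y"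
    proof (cases "n \<ge> N")
      case True then show ?thesis using N[of n] z VW by blast
    next
      case False
      then have "Y \<subseteq> X n" using n by (auto simp: Y_def)
      then show ?thesis using X[OF n] z by blast
    qed
  qed (use U VW Y in auto)
qed

lemma basin_wandering: "p \<in> basin_plus (- A) \<union> basin_minus (- A) \<Longrightarrow> wandering (- A) p"
  unfolding Un_iff basin_minus_iff using basin_plus_wandering wandering_flip by metis

lemma basin_plus_pullback:
  assumes "p \<notin> Ind" "f p \<in> basin_plus (- A)"
  shows "p \<in> basin_plus (- A)"
proof -
  obtain U where U: "openin torus U" "f p \<in> U" "\<And>n. U \<inter> I (int n) = {}"
    "\<And>V. openin torus V \<Longrightarrow> (None, None) \<in> V \<Longrightarrow> (\<forall>\<^sub>F n in sequentially. (f ^^ n) ` U \<subseteq> V)"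
    using assms unfolding basin_plus_iff by blast
  let ?U = "{p. p \<notin> Ind \<and> f p \<in> U}"
  have "?U \<inter> I (int n) = {}" for n
  proof (cases n)
    case (Suc m) then show ?thesis using I_f[of _ m] U(3)[of m] by blast
  qed (use I_of_nat[of 0] in simp)
  moreover have "\<forall>\<^sub>F n in sequentially. (f ^^ n) ` ?U \<subseteq> V" if V: "openin torus V" "(None, None) \<in> V" for V
  proof -
    have "\<forall>\<^sub>F n in sequentially. (f ^^ Suc n) ` ?U \<subseteq> V"
      using U(4)[OF V] by eventually_elim (auto simp: funpow_Suc_right simp del: funpow.simps)
    then show ?thesis by (rule eventually_sequentially_Suc[THEN iffD1])
  qed
  ultimately show ?thesis unfolding basin_plus_iff using assms U openin_f[OF U(1)] by (intro exI[of _ ?U]) auto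
qed

text \<open>The backward orbit of \<open>f p\<close> passes through \<open>p\<close> one step later,
  as long as \<open>fi\<close> undoes \<open>f\<close>. Cutting \<open>Ind_inv\<close> out of the
  neighbourhood ensures this for all nearby points.\<close>

lemma basin_minus_pullback:
  assumes "p \<notin> Ind" "f p \<notin> Ind_inv" "f p \<in> basin_minus (- A)"
  shows "p \<in> basin_minus (- A)"
proof -
  have "flip (f p) \<in> basin_plus (- A)" using assms(3) by (simp add: basin_minus_iff)
  then obtain U where U: "openin torus U" "flip (f p) \<in> U" "\<And>n. U \<inter> I (int n) = {}"
    "\<And>V. openin torus V \<Longrightarrow> (None, None) \<in> V \<Longrightarrow> (\<forall>\<^sub>F n in sequentially. (f ^^ n) ` U \<subseteq> V)"
    unfolding basin_plus_iff by blast
  let ?W = "{p. p \<notin> Ind \<and> f p \<in> flip ` U - Ind_inv}"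
  have W: "openin torus ?W" by (intro openin_f openin_minus_finite) (simp_all add: openin_flip U)
  have "flip ` ?W \<inter> I (int n) = {}" for n
  proof -
    have "flip q \<notin> I (int n)" if q: "q \<in> ?W" for q
    proof
      assume "flip q \<in> I (int n)"
      then have "flip (f q) \<in> I (int (Suc n))" unfolding fi_flip[symmetric] by (rule I_fi)
      moreover have "flip (f q) \<in> U" using q by (simp add: flip_image_iff)
      ultimately show False using U(3)[of "Suc n"] by blast
    qed
    then show ?thesis by blast
  qed
  moreover have "\<forall>\<^sub>F n in sequentially. (f ^^ n) ` flip ` ?W \<subseteq> V" if V: "openin torus V" "(None, None) \<in> V" for V
  proof -
    have "\<forall>\<^sub>F n in sequentially. (f ^^ Suc n) ` U \<subseteq> V"
      using U(4)[OF V] by (rule eventually_sequentially_Suc[of "\<lambda>n. (f ^^ n) ` U \<subseteq> V", THEN iffD2])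
    then show ?thesis
    proof eventually_elim
      case (elim n)
      have "(f ^^ n) (flip q) \<in> V" if q: "q \<in> ?W" for q
      proof -
        have "flip q = f (flip (f q))" using q by (simp add: f_flip fi_f)
        then have "(f ^^ n) (flip q) = (f ^^ Suc n) (flip (f q))" by (simp add: funpow_Suc_comm)
        moreover have "flip (f q) \<in> U" using q by auto
        ultimately show ?thesis using elim by blast
      qed
      then show ?case by blast
    qed
  qed
  ultimately show ?thesis unfolding basin_minus_iff basin_plus_iff
    using assms U W by (intro exI[of _ "flip ` ?W"]) (simp_all add: openin_flip flip_image_iff)
qed

text \<open>For \<open>x < 0\<close> the factor \<open>(x - A) / (x - 1)\<close> is at least 1. So
  one step gives \<open>x' <= y\<close> and \<open>y' <= x - 1\<close>: both coordinates drop by at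
  least 1 in two steps, uniformly on the quadrant.\<close>

lemma third_quadrant_basin:
  assumes "fst z < 0" "snd z < 0"
  shows "emb z \<in> basin_plus (- A)"
proof -
  define Q where "Q = {z :: real \<times> real. fst z < 0 \<and> snd z < 0}"
  have iter: "\<exists>w. (f ^^ n) (emb z) = emb w \<and> w \<in> Q \<and> - fst w \<ge> (real n - 1) / 2 \<and> - snd w \<ge> real n / 2"
    if z: "z \<in> Q" for z n
  proof (induction n)
    case 0 then show ?case using z by (intro exI[of _ z]) (auto simp: Q_def)
  next
    case (Suc n)
    then obtain w where w: "(f ^^ n) (emb z) = emb w" "w \<in> Q" "- fst w \<ge> (real n - 1) / 2" "- snd w \<ge> real n / 2"
      by blast
    have "1 \<le> (fst w - A) / (fst w - 1)" using w(2) A by (auto simp: Q_def divide_simps)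
    then have "- snd w * 1 \<le> - snd w * ((fst w - A) / (fst w - 1))" using w(2)
      by (intro mult_left_mono) (auto simp: Q_def)
    then have "fst (F w) \<le> snd w" by (simp add: F_def)
    moreover have "snd (F w) \<le> fst w - 1" using A by (simp add: F_def)
    ultimately show ?case using w by (intro exI[of _ "F w"]) (auto simp: f_emb Q_def)
  qed
  have "open Q" unfolding Q_def by (intro open_Collect_conj open_Collect_less continuous_intros)
  show ?thesis unfolding basin_plus_iff
  proof (intro exI[of _ "emb ` Q"] conjI allI impI)
    show "emb ` Q \<inter> I (int n) = {}" for n using I_finite by (force simp: Q_def)
    fix V assume "openin torus V \<and> (None, None) \<in> V"
    then obtain M where M: "\<And>z. \<bar>fst z\<bar> > M \<Longrightarrow> \<bar>snd z\<bar> > M \<Longrightarrow> emb z \<in> V"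
      using infinity_nhds by metis
    obtain N :: nat where N: "2 * M + 1 < real N" using reals_Archimedean2 by blast
    show "\<forall>\<^sub>F n in sequentially. (f ^^ n) ` emb ` Q \<subseteq> V"
    proof (rule eventually_sequentiallyI[of N], unfold image_image, intro image_subsetI)
      fix n z assume n: "N \<le> n" and z: "z \<in> Q"
      obtain w where w: "(f ^^ n) (emb z) = emb w" "- fst w \<ge> (real n - 1) / 2" "- snd w \<ge> real n / 2"
        using iter[OF z] by blast
      have "real N \<le> real n" using n by simp
      then show "(f ^^ n) (emb z) \<in> V" unfolding w(1) using w(2,3) N by (intro M) auto
    qed
  qed (use assms \<open>open Q\<close> in \<open>auto simp: openin_emb Q_def\<close>)
qed

section \<open>Finite points outside both basins\<close>

definition K :: "(real \<times> real) set" where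
  "K = {z. emb z \<notin> basin_plus (- A) \<and> emb z \<notin> basin_minus (- A)}"

definition sw :: "real \<times> real \<Rightarrow> real \<times> real" where
  "sw z = (- snd z, - fst z)"

lemma sw_simps [simp]: "fst (sw z) = - snd z" "snd (sw z) = - fst z" "sw (sw z) = z"
  by (auto simp: sw_def)

lemma flip_emb: "flip (emb z) = emb (sw z)"
  by (simp add: emb_def)

lemma K_sw: "sw z \<in> K \<longleftrightarrow> z \<in> K"
  unfolding K_def basin_minus_iff flip_emb by auto

lemma not_Ind_emb: "emb z \<notin> Ind \<longleftrightarrow> z \<noteq> (1, 0)" "emb z \<notin> Ind_inv \<longleftrightarrow> z \<noteq> (0, - 1)"
  by (auto simp: indet_def indet_inv_def emb_def prod_eq_iff)

lemma basin_plus_F: "fst z \<noteq> 1 \<Longrightarrow> emb (F z) \<in> basin_plus (- A) \<Longrightarrow> emb z \<in> basin_plus (- A)"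
  by (rule basin_plus_pullback) (auto simp: f_emb not_Ind_emb)

text \<open>Each excluded piece of the forward side reaches the open third quadrant after at most
  three steps. The involution then gives the excluded pieces of the backward side.\<close>

lemma K_imp:
  assumes "z \<in> K"
  shows "fst z \<ge> 1 \<and> snd z \<le> - 1 \<and> fst z \<noteq> A \<and> snd z \<noteq> - A \<or> fst z < 0 \<and> snd z > 0"
proof -
  note bF = basin_plus_F[OF _ third_quadrant_basin]
  have 0: "emb z \<in> basin_plus (- A)" if "fst z = 0" "snd z < 0" for z
    using that A by (intro bF) (auto simp: F_def divide_simps zero_less_mult_iff mult_less_0_iff)
  have 1: "emb z \<in> basin_plus (- A)" if "fst z < 0" "snd z = 0" for z
    by (rule basin_plus_F[OF _ 0]) (use that A in \<open>auto simp: F_def\<close>)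
  have 2: "emb z \<in> basin_plus (- A)" if "0 < fst z" "fst z < 1" "snd z < 0" for z
  proof -
    have "0 < (fst z - A) / (fst z - 1)" using that A by (auto simp: zero_less_divide_iff)
    then have "snd z * ((fst z - A) / (fst z - 1)) < 0" using that by (intro mult_neg_pos)
    then show ?thesis using that A by (intro bF) (auto simp: F_def)
  qed
  \<comment> \<open>The line \<open>x = A\<close> collapses to \<open>(0, - 1)\<close>. Although
    this is an indeterminacy point of the inverse, it lies in the forward basin by the first
    case.\<close>
  have 3: "emb z \<in> basin_plus (- A)" if "fst z = A" for z
    by (rule basin_plus_F[OF _ 0]) (use that A in \<open>auto simp: F_def\<close>)
  have 4: "emb z \<in> basin_plus (- A)" if "fst z = 0" "snd z = 0" for z
    by (rule basin_plus_F[OF _ 0]) (use that A in \<open>auto simp: F_def\<close>)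
  have *: "\<not> (fst w \<le> 0 \<and> snd w \<le> 0) \<and> \<not> (0 < fst w \<and> fst w < 1 \<and> snd w < 0) \<and> fst w \<noteq> A" if "w \<in> K" for w
  proof -
    have "emb w \<notin> basin_plus (- A)" using that by (simp add: K_def)
    then show ?thesis
      using 0[of w] 1[of w] 2[of w] 3[of w] 4[of w] third_quadrant_basin[of w] by argo
  qed
  have "\<not> (- snd z \<le> 0 \<and> - fst z \<le> 0)" "\<not> (0 < - snd z \<and> - snd z < 1 \<and> - fst z < 0)" "- snd z \<noteq> A"
    using *[OF K_sw[THEN iffD2, OF assms]] unfolding sw_simps by blast+
  then show ?thesis using *[OF assms] by argo
qed

text \<open>Pulling the backward basin back through \<open>f\<close> requires \<open>F z\<close> to
  avoid \<open>(0, - 1)\<close>. That point is the image of the line \<open>x = A\<close>, which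
  \<open>K\<close> does not meet.\<close>

lemma K_F:
  assumes z: "z \<in> K" "fst z \<noteq> 1"
  shows "F z \<in> K"
proof -
  have "fst z \<noteq> A" using K_imp[OF z(1)] A by auto
  then have "F z \<noteq> (0, -1)" using A z(2) by (auto simp: F_def)
  then have "emb (F z) \<notin> basin_minus (- A)"
    using z basin_minus_pullback[of "emb z"] by (cases "z = (1, 0)") (auto simp: K_def not_Ind_emb f_emb)
  then show ?thesis
    using z basin_plus_F[of z] unfolding K_def by auto
qed

end

subsection \<open>Escape from infinity and a Lyapunov function\<close>

text \<open>Concavity of \<open>ln\<close>: its increment over an interval of fixed length decreases
  as the interval moves to the right. After exponentiating, the claim is
  \<open>0 <= (t - s) * (s' - s)\<close>.\<close>

lemma ln_diff_antimono:
  fixes s t s' t' :: real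
  assumes "0 < s" "s \<le> t" "s \<le> s'" "t' - s' = t - s"
  shows "ln t' - ln s' \<le> ln t - ln s"
    and "s < t \<Longrightarrow> s < s' \<Longrightarrow> ln t' - ln s' < ln t - ln s"
proof -
  have t': "t' = t + s' - s" using assms by simp
  have eq: "t * s' - t' * s = (t - s) * (s' - s)" unfolding t' by (simp add: algebra_simps)
  have "0 \<le> (t - s) * (s' - s)" using assms by simp
  then have "t' * s \<le> t * s'" using eq by linarith
  then have "ln (t' * s) \<le> ln (t * s')" using assms by (subst ln_le_cancel_iff) auto
  then show "ln t' - ln s' \<le> ln t - ln s" using assms by (simp add: ln_mult)
  assume "s < t" "s < s'"
  then have "0 < (t - s) * (s' - s)" by simp
  then have "t' * s < t * s'" using eq by linarith
  then have "ln (t' * s) < ln (t * s')" using assms by (subst ln_less_cancel_iff) auto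
  then show "ln t' - ln s' < ln t - ln s" using assms by (simp add: ln_mult)
qed

text \<open>The bookkeeping for \<open>V_L\<close>: \<open>a0\<close> is the difference of the
  \<open>ln x\<close>, and \<open>e\<close>, \<open>p\<close>, \<open>q\<close>, \<open>b\<close>
  stand for the logarithms of \<open>\<bar>y\<bar>\<close>, \<open>x - A\<close>,
  \<open>x - 1\<close> and \<open>x - (A + 1)\<close>. The next lemma does the same for
  \<open>V_N\<close>, where the chain of inequalities runs the other way.\<close>

lemma abs_diff_le_aux:
  fixes a0 e1 e2 p1 p2 q1 q2 b1 b2 :: real
  assumes "0 \<le> a0" "p1 - p2 \<le> b1 - b2"
  shows "a0 \<le> q1 - q2 \<Longrightarrow> q1 - q2 \<le> p1 - p2 \<Longrightarrow>
      \<bar>a0\<bar> - \<bar>e1 - e2\<bar> \<le> \<bar>b1 - b2\<bar> - \<bar>e1 + p1 - q1 - (e2 + p2 - q2)\<bar>"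
    and "a0 < q1 - q2 \<Longrightarrow> q1 - q2 \<le> p1 - p2 \<Longrightarrow>
      \<bar>a0\<bar> - \<bar>e1 - e2\<bar> < \<bar>b1 - b2\<bar> - \<bar>e1 + p1 - q1 - (e2 + p2 - q2)\<bar>"
  using assms by linarith+

lemma abs_diff_le_aux2:
  fixes c0 e1 e2 p1 p2 q1 q2 b1 b2 :: real
  assumes "p1 - p2 \<le> q1 - q2" "b1 - b2 \<le> p1 - p2" "0 \<le> b1 - b2"
  shows "q1 - q2 \<le> c0 \<Longrightarrow> \<bar>e1 - e2\<bar> - \<bar>c0\<bar> \<le> \<bar>e1 + p1 - q1 - (e2 + p2 - q2)\<bar> - \<bar>b1 - b2\<bar>"
    and "q1 - q2 < c0 \<Longrightarrow> \<bar>e1 - e2\<bar> - \<bar>c0\<bar> < \<bar>e1 + p1 - q1 - (e2 + p2 - q2)\<bar> - \<bar>b1 - b2\<bar>"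
  using assms by linarith+

context golden begin

text \<open>In the coordinates \<open>(x, v) = (x, - y)\<close> this is one application of
  \<open>F\<close> twice. Put \<open>g = (x - A) / (x - 1)\<close> and
  \<open>h = (v' - 1) / (v' - A)\<close>. Then \<open>x' = h (x - (A + 1))\<close> and
  \<open>v' - 1 = h (v' - A)\<close> add up to \<open>D' = h g D\<close>; in \<open>x' / D'\<close>
  the factor \<open>h\<close> cancels.\<close>

lemma escape_step:
  fixes x v :: real
  defines "v' \<equiv> A + 1 + v * ((x - A) / (x - 1))"
  defines "x' \<equiv> (x - (A + 1)) * ((v' - 1) / (v' - A))"
  assumes x: "x > A + 1" and v: "v > 0"
  shows "v' > A + 1" "x' > 0"
    "x' + v' - 1 = (v' - 1) / (v' - A) * ((x - A) / (x - 1)) * (x + v - 1)"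
    "x' / (x' + v' - 1) \<le> x / (x + v - 1) - 2 / (x + v - 1)"
proof -
  define g where "g = (x - A) / (x - 1)"
  have g: "0 < g" "g * (x - 1) = x - A" using x A by (auto simp: g_def)
  have v'g: "v' = A + 1 + v * g" by (simp add: v'_def g_def)
  show v': "v' > A + 1" using g v by (simp add: v'g)
  have pos: "0 < v' - A" "0 < v' - 1" using v' A by auto
  show x': "x' > 0" using x pos by (simp add: x'_def)
  define D where "D = x + v - 1"
  have D: "D > 0" using x v A by (simp add: D_def)
  define h where "h = (v' - 1) / (v' - A)"
  have h: "h * (v' - A) = v' - 1" "0 < h" using pos by (auto simp: h_def)
  have "x' + v' - 1 = h * (x - (A + 1)) + h * (v' - A)" by (simp add: x'_def h_def[symmetric] h(1))
  also have "\<dots> = h * (x - A + v * g)" by (simp add: v'g algebra_simps)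
  also have "x - A + v * g = g * D" using g(2) by (simp add: D_def algebra_simps)
  finally have D': "x' + v' - 1 = h * g * D" by simp
  then show "x' + v' - 1 = (v' - 1) / (v' - A) * ((x - A) / (x - 1)) * (x + v - 1)"
    by (simp add: h_def g_def D_def)
  have "x' / (x' + v' - 1) = (x - (A + 1)) / (g * D)"
    unfolding D' using h by (simp add: x'_def h_def[symmetric])
  also have "\<dots> = (x - (A + 1)) * (x - 1) / ((x - A) * D)"
    using x A by (simp add: g_def)
  also have "\<dots> \<le> (x - 2) / D"
  proof -
    \<comment> \<open>The two sides differ by the constant \<open>A - 1\<close>.\<close>
    have "(x - (A + 1)) * (x - 1) \<le> (x - 2) * (x - A)" using A by (simp add: algebra_simps)
    then show ?thesis using D x by (simp add: divide_simps mult.commute mult.left_commute)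
  qed
  finally show "x' / (x' + v' - 1) \<le> x / (x + v - 1) - 2 / (x + v - 1)"
    by (simp add: D_def diff_divide_distrib)
qed

text \<open>The growth of \<open>D\<close> is controlled only while \<open>r\<close> stays away from
  1. After the first step \<open>v > A + 1\<close>, which gives \<open>r <= 1 - 1 / C\<close>, and
  \<open>r\<close> only decreases afterwards. The bound \<open>J\<close> depends on \<open>C\<close>
  alone.\<close>

lemma escape_seq:
  assumes C: "C > 0"
  shows "\<exists>J. \<forall>x v :: nat \<Rightarrow> real. v 0 > 0 \<longrightarrow> x 0 + v 0 - 1 \<le> C \<longrightarrow>
    (\<forall>i<J. v (Suc i) = A + 1 + v i * ((x i - A) / (x i - 1)) \<and>
         x (Suc i) = (x i - (A + 1)) * ((v (Suc i) - 1) / (v (Suc i) - A))) \<longrightarrow> (\<exists>i<J. x i \<le> A + 1)"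
proof -
  \<comment> \<open>\<open>al\<close> bounds \<open>D\<close> after the first step, and
    \<open>L\<close> bounds its increase in each later step.\<close>
  define L where "L = A * (A - 1) * C"
  define al where "al = A * C"
  have pos: "L > 0" "al > 0" using A C by (auto simp: L_def al_def)
  \<comment> \<open>This \<open>j\<close> makes \<open>ln ((al + j L) / al)\<close> reach
    \<open>L / 2\<close>, where the upper bound for \<open>r\<close> becomes negative.\<close>
  obtain j :: nat where j: "al * exp (L / 2) / L < real j" using reals_Archimedean2 by blast
  have "al * exp (L / 2) \<le> al + real j * L" using j pos by (simp add: field_simps)
  then have "exp (L / 2) \<le> (al + real j * L) / al" using pos by (simp add: field_simps)
  then have jj: "L / 2 \<le> ln ((al + real j * L) / al)" using pos by (subst ln_ge_iff) (auto intro!: divide_pos_pos add_pos_nonneg)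
  show ?thesis
  proof (rule exI[of _ "Suc j"], intro allI impI, rule ccontr)
    fix x v :: "nat \<Rightarrow> real"
    assume v0: "v 0 > 0" and D0: "x 0 + v 0 - 1 \<le> C" and nE: "\<not> (\<exists>i<Suc j. x i \<le> A + 1)"
     and rec: "\<forall>i<Suc j. v (Suc i) = A + 1 + v i * ((x i - A) / (x i - 1)) \<and>
         x (Suc i) = (x i - (A + 1)) * ((v (Suc i) - 1) / (v (Suc i) - A))"
    have x: "x i > A + 1" if "i < Suc j" for i using nE that by force
    define D where "D i = x i + v i - 1" for i
    define r where "r i = x i / D i" for i
    have v: "0 < v i" if "i < Suc j" for i
      using that
    proof (induction i)
      case (Suc i)
      then have "v (Suc i) > A + 1" using escape_step(1)[OF x[of i], of "v i"] rec by simp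
      then show ?case using A by simp
    qed (use v0 in simp)
    have st: "v (Suc i) > A + 1" "x (Suc i) > 0"
       "D (Suc i) = (v (Suc i) - 1) / (v (Suc i) - A) * ((x i - A) / (x i - 1)) * D i"
       "r (Suc i) \<le> r i - 2 / D i" if i: "i < Suc j" for i
      using escape_step[OF x[OF i] v[OF i]] rec i by (simp_all add: D_def r_def)
    have Dpos: "0 < D i" if "i < Suc j" for i using x[OF that] v[OF that] A by (simp add: D_def)
    have D_le: "D (Suc i) \<le> (v (Suc i) - 1) / (v (Suc i) - A) * D i" if i: "i < Suc j" for i
    proof -
      have "(x i - A) / (x i - 1) \<le> 1" using x[OF i] A by simp
      moreover have "0 \<le> (v (Suc i) - 1) / (v (Suc i) - A)" using st(1)[OF i] A by simp
      ultimately have "(v (Suc i) - 1) / (v (Suc i) - A) * ((x i - A) / (x i - 1)) \<le> (v (Suc i) - 1) / (v (Suc i) - A) * 1"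
        by (rule mult_left_mono)
      then show ?thesis unfolding st(3)[OF i] using Dpos[OF i] by (intro mult_right_mono) auto
    qed
    have vA: "v (Suc i) - 1 \<le> A * (v (Suc i) - A)" if i: "i < Suc j" for i
    proof -
      have "0 \<le> (A - 1) * (v (Suc i) - (A + 1))" using st(1)[OF i] A by simp
      then show ?thesis by (simp add: algebra_simps)
    qed
    have D1: "D (Suc 0) \<le> al"
    proof -
      have "(v (Suc 0) - 1) / (v (Suc 0) - A) \<le> A" using vA[of 0] st(1)[of 0] A by (simp add: divide_simps)
      then have "(v (Suc 0) - 1) / (v (Suc 0) - A) * D 0 \<le> A * D 0" using Dpos[of 0] by (intro mult_right_mono) auto
      also have "\<dots> \<le> al" using D0 A by (simp add: al_def D_def)
      finally show ?thesis using D_le[of 0] by simp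
    qed
    have D1pos: "0 < D (Suc 0)" using st(1,2)[of 0] A by (simp add: D_def)
    have "1 - r (Suc 0) = (v (Suc 0) - 1) / D (Suc 0)" using D1pos by (simp add: r_def D_def field_simps)
    also have "\<dots> \<ge> A / D (Suc 0)" using st(1)[of 0] D1pos by (intro divide_right_mono) auto
    finally have r1: "1 - r (Suc 0) \<ge> A / D (Suc 0)" .
    also have "A / D (Suc 0) \<ge> A / al" using D1 D1pos A by (intro divide_left_mono) auto
    finally have r1: "1 - r (Suc 0) \<ge> 1 / C" using A by (simp add: al_def)
    \<comment> \<open>The bound for \<open>r\<close> is advanced first, since the bound for the next
      \<open>D\<close> relies on it. The inequality \<open>ln (1 + u) <= u\<close> turns the sum of
      the terms \<open>2 / D\<close> into a logarithm.\<close>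
    have main: "i \<le> j \<Longrightarrow> D (Suc i) \<le> al + real i * L \<and> r (Suc i) \<le> 1 - 1 / C - 2 / L * ln ((al + real i * L) / al)" for i
    proof (induction i)
      case 0 then show ?case using D1 r1 pos by simp
    next
      case (Suc i)
      then have i: "Suc i < Suc j" and IH: "D (Suc i) \<le> al + real i * L"
        "r (Suc i) \<le> 1 - 1 / C - 2 / L * ln ((al + real i * L) / al)" by auto
      have p: "0 < al + real i * L" using pos by (intro add_pos_nonneg) auto
      have Dp: "0 < D (Suc i)" using Dpos[OF i] .
      have Dp2: "0 < D (Suc (Suc i))" using st(1,2)[OF i] A by (simp add: D_def)
      have "ln ((al + real (Suc i) * L) / al) - ln ((al + real i * L) / al) = ln (1 + L / (al + real i * L))"
      proof -
        have "1 + L / (al + real i * L) = (al + real (Suc i) * L) / (al + real i * L)" using p by (simp add: field_simps)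
        moreover have "0 < al + real (Suc i) * L" using p pos by (simp add: algebra_simps)
        ultimately show ?thesis using p pos by (simp add: ln_div)
      qed
      also have "\<dots> \<le> L / (al + real i * L)" using p pos by (intro ln_add_one_self_le_self) auto
      also have "\<dots> \<le> L / D (Suc i)" using IH(1) Dp pos p by (intro divide_left_mono) auto
      finally have "2 / L * (ln ((al + real (Suc i) * L) / al) - ln ((al + real i * L) / al)) \<le> 2 / L * (L / D (Suc i))"
        using pos by (intro mult_left_mono) auto
      also have "\<dots> = 2 / D (Suc i)" using pos by simp
      finally have "2 / L * ln ((al + real (Suc i) * L) / al) \<le> 2 / L * ln ((al + real i * L) / al) + 2 / D (Suc i)"
        by (simp only: right_diff_distrib)
      then have r: "r (Suc (Suc i)) \<le> 1 - 1 / C - 2 / L * ln ((al + real (Suc i) * L) / al)"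
        using st(4)[OF i] IH(2) by linarith
      have "0 \<le> ln ((al + real (Suc i) * L) / al)" using pos p by (intro ln_ge_zero) (simp add: field_simps)
      then have "0 \<le> 2 / L * ln ((al + real (Suc i) * L) / al)" using pos by simp
      then have "r (Suc (Suc i)) \<le> 1 - 1 / C" using r by linarith
      then have "D (Suc (Suc i)) * r (Suc (Suc i)) \<le> D (Suc (Suc i)) * (1 - 1 / C)" using Dp2 by (intro mult_left_mono) auto
      moreover have "D (Suc (Suc i)) * r (Suc (Suc i)) = x (Suc (Suc i))" using Dp2 by (simp add: r_def)
      ultimately have "x (Suc (Suc i)) \<le> D (Suc (Suc i)) - D (Suc (Suc i)) / C" by (simp add: right_diff_distrib)
      then have "D (Suc (Suc i)) / C \<le> v (Suc (Suc i)) - 1" using D_def[of "Suc (Suc i)"] by linarith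
      \<comment> \<open>As \<open>v - 1\<close> is at least the fraction \<open>1 / C\<close> of
        \<open>D\<close>, the relative growth of \<open>D\<close>, at most
        \<open>(A - 1) / (v - A)\<close>, costs only a bounded amount.\<close>
      then have vD: "D (Suc (Suc i)) \<le> C * A * (v (Suc (Suc i)) - A)" using vA[OF i] C
        by (simp add: divide_simps mult_ac) (smt (verit) mult_left_mono mult.commute mult.left_commute)
      have "D (Suc (Suc i)) \<le> D (Suc i) + L"
      proof (cases "D (Suc (Suc i)) \<le> D (Suc i)")
        case True then show ?thesis using pos by simp
      next
        case False
        let ?w = "v (Suc (Suc i)) - A"
        have w: "0 < ?w" using st(1)[OF i] by simp
        have "D (Suc (Suc i)) \<le> (1 + (A - 1) / ?w) * D (Suc i)"
          using D_le[OF i] w by (simp add: field_simps)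
        also have "\<dots> = D (Suc i) + (A - 1) * (D (Suc i) / ?w)" by (simp add: algebra_simps)
        also have "D (Suc i) / ?w \<le> C * A" using vD False w by (simp add: divide_simps)
        then have "D (Suc i) + (A - 1) * (D (Suc i) / ?w) \<le> D (Suc i) + (A - 1) * (C * A)"
          using A by (intro add_left_mono mult_left_mono) auto
        finally show ?thesis by (simp add: L_def mult_ac)
      qed
      then show ?case using r IH(1) by (simp add: algebra_simps)
    qed
    have "2 / L * (L / 2) \<le> 2 / L * ln ((al + real j * L) / al)" using jj pos by (intro mult_left_mono) auto
    moreover have "2 / L * (L / 2) = 1" "0 < 1 / C" using C pos by simp_all
    moreover have "r (Suc j) \<le> 1 - 1 / C - 2 / L * ln ((al + real j * L) / al)" using main[of j] by simp
    ultimately have "r (Suc j) < 0" by linarith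
    moreover have "0 \<le> r (Suc j)" using st(1,2)[of j] A by (simp add: r_def D_def)
    ultimately show False by simp
  qed
qed

lemma F_F:
  assumes "fst z > A + 1" "snd z < 0"
  defines "v' \<equiv> A + 1 - snd z * ((fst z - A) / (fst z - 1))"
  shows "fst (F z) < 0" "snd (F z) > 0" "F (F z) = ((fst z - (A + 1)) * ((v' - 1) / (v' - A)), - v')"
proof -
  have g: "0 < (fst z - A) / (fst z - 1)" using assms A by simp
  then have "snd z * ((fst z - A) / (fst z - 1)) < 0" using assms(2) by (intro mult_neg_pos)
  then show "fst (F z) < 0" by (simp add: F_def)
  show "snd (F z) > 0" using assms by (simp add: F_def)
  have 1: "F (F z) = (snd (F z) * ((fst (F z) - A) / (fst (F z) - 1)), fst (F z) - (A + 1))"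
    by (rule F_def)
  have "fst (F z) - A = - (v' - 1)" "fst (F z) - 1 = - (v' - A)" "fst (F z) - (A + 1) = - v'"
    by (simp_all add: v'_def F_def)
  then show "F (F z) = ((fst z - (A + 1)) * ((v' - 1) / (v' - A)), - v')"
    unfolding 1 by (simp only: minus_divide_divide) (simp add: F_def)
qed

text \<open>One \<open>J\<close> serves all starting points with the same bound on
  \<open>x - y - 1\<close>. This uniformity is used for families of orbits and, through
  \<open>sw\<close>, for reversed orbits.\<close>

lemma escape_F: "\<exists>J. \<forall>z. snd z < 0 \<and> fst z - snd z - 1 \<le> C \<longrightarrow> (\<exists>i<J. fst ((F ^^ (2 * i)) z) \<le> A + 1)"
proof -
  obtain J where J: "\<And>x v :: nat \<Rightarrow> real. v 0 > 0 \<Longrightarrow> x 0 + v 0 - 1 \<le> max C 1 \<Longrightarrow>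
    (\<forall>i<J. v (Suc i) = A + 1 + v i * ((x i - A) / (x i - 1)) \<and>
         x (Suc i) = (x i - (A + 1)) * ((v (Suc i) - 1) / (v (Suc i) - A))) \<Longrightarrow> \<exists>i<J. x i \<le> A + 1"
    using escape_seq[of "max C 1"] by (metis less_max_iff_disj zero_less_one)
  show ?thesis
  proof (rule exI[of _ J], intro allI impI, rule ccontr)
    fix z assume z: "snd z < 0 \<and> fst z - snd z - 1 \<le> C" and nE: "\<not> (\<exists>i<J. fst ((F ^^ (2 * i)) z) \<le> A + 1)"
    define x where "x i = fst ((F ^^ (2 * i)) z)" for i
    define v where "v i = - snd ((F ^^ (2 * i)) z)" for i
    have x: "x i > A + 1" if "i < J" for i using nE that by (force simp: x_def)
    have rec: "v (Suc i) = A + 1 + v i * ((x i - A) / (x i - 1)) \<and>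
         x (Suc i) = (x i - (A + 1)) * ((v (Suc i) - 1) / (v (Suc i) - A))" if "i < J" "v i > 0" for i
      using F_F[of "(F ^^ (2 * i)) z"] x[OF that(1)] that(2) by (simp add: x_def v_def)
    have v: "i \<le> J \<Longrightarrow> v i > 0" for i
    proof (induction i)
      case (Suc i)
      then have "A + 1 < A + 1 + v i * ((x i - A) / (x i - 1))" using escape_step(1)[of "x i" "v i"] x[of i] by simp
      then show ?case using rec[of i] Suc A by (simp only: Suc_le_eq)
    qed (use z in \<open>simp add: v_def\<close>)
    have "\<forall>i<J. v (Suc i) = A + 1 + v i * ((x i - A) / (x i - 1)) \<and>
         x (Suc i) = (x i - (A + 1)) * ((v (Suc i) - 1) / (v (Suc i) - A))"
      using v rec by (metis less_imp_le)
    moreover have "0 < v 0" "x 0 + v 0 - 1 \<le> max C 1" using z by (auto simp: x_def v_def)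
    ultimately have "\<exists>i<J. x i \<le> A + 1" using J by blast
    then show False using nE by (simp add: x_def)
  qed
qed

section \<open>A Lyapunov function for pairs of points\<close>

definition Q :: "real \<times> real \<Rightarrow> real \<times> real \<Rightarrow> real" where
  "Q z w = \<bar>ln \<bar>fst z\<bar> - ln \<bar>fst w\<bar>\<bar> - \<bar>ln \<bar>snd z\<bar> - ln \<bar>snd w\<bar>\<bar>"

definition V :: "real \<times> real \<Rightarrow> real \<times> real \<Rightarrow> real" where
  "V z w = (if 0 < fst z then Q z w else - Q z w)"

text \<open>The domains of the transitions \<open>00\<close>, \<open>01\<close> and \<open>10\<close>.\<close>

definition S :: "(real \<times> real) set" where "S = {z. 1 < fst z \<and> fst z < A \<and> snd z < 0}"
definition L :: "(real \<times> real) set" where "L = {z. A + 1 < fst z \<and> snd z < 0}"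
definition N :: "(real \<times> real) set" where "N = {z. fst z < 0 \<and> 0 < snd z}"

lemma Q_commute: "Q z w = Q w z"
  by (simp add: Q_def abs_minus_commute)

lemma ln_abs_fst_F:
  assumes "fst z \<noteq> A" "fst z \<noteq> 1" "snd z \<noteq> 0"
  shows "ln \<bar>fst (F z)\<bar> = ln \<bar>snd z\<bar> + ln \<bar>fst z - A\<bar> - ln \<bar>fst z - 1\<bar>"
  using assms by (simp add: F_def abs_mult ln_mult ln_div)

text \<open>The source of the relative gain \<open>1 / (A - 1)\<close>: for
  \<open>1 < x <= A\<close> the derivative \<open>1 / (x - 1)\<close> exceeds \<open>1 / x\<close>
  by \<open>1 / (x (x - 1))\<close>, which is at least \<open>1 / (x (A - 1))\<close>.\<close>

lemma ln_S:
  assumes "1 < s" "s \<le> t" "t \<le> A"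
  shows "ln (t - 1) - ln (s - 1) \<ge> (ln t - ln s) + (ln t - ln s) / (A - 1)"
proof -
  have "ln (s - 1) - (1 + 1 / (A - 1)) * ln s \<le> ln (t - 1) - (1 + 1 / (A - 1)) * ln t"
  proof (rule DERIV_nonneg_imp_nondecreasing[OF assms(2)])
    fix x assume x: "s \<le> x" "x \<le> t"
    have "((\<lambda>x. ln (x - 1) - (1 + 1 / (A - 1)) * ln x) has_real_derivative (1 / (x - 1) - (1 + 1 / (A - 1)) * (1 / x))) (at x)"
      using x assms by (auto intro!: derivative_eq_intros)
    moreover have "1 / (x - 1) - (1 + 1 / (A - 1)) * (1 / x) \<ge> 0"
    proof -
      have "1 / (x - 1) - 1 / x = 1 / (x * (x - 1))" using x assms by (simp add: field_simps)
      moreover have "1 / (x * (x - 1)) \<ge> 1 / (x * (A - 1))" using x assms A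
        by (intro divide_left_mono mult_left_mono) auto
      moreover have "(1 + 1 / (A - 1)) * (1 / x) = 1 / x + 1 / (x * (A - 1))" using A x assms by (simp add: field_simps)
      ultimately show ?thesis by linarith
    qed
    ultimately show "\<exists>y. ((\<lambda>x. ln (x - 1) - (1 + 1 / (A - 1)) * ln x) has_real_derivative y) (at x) \<and> 0 \<le> y"
      by blast
  qed
  then show ?thesis by (simp add: algebra_simps add_divide_distrib diff_divide_distrib)
qed

text \<open>On \<open>S\<close> the factors \<open>A - x\<close> and \<open>x - 1\<close> vary in
  opposite directions, so their contributions to the new \<open>ln \<bar>x\<bar>\<close> add up. The
  first pays for the new ordinate, of modulus \<open>A + 1 - x\<close>; the second returns the old
  difference of \<open>ln x\<close> with the surplus from \<open>ln_S\<close>.\<close>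

lemma V_S:
  assumes zw: "z \<in> S" "w \<in> S"
  shows "V z w + \<bar>ln (fst z) - ln (fst w)\<bar> / (A - 1) \<le> V (F z) (F w)"
proof -
  have *: "Q z w + \<bar>ln (fst z) - ln (fst w)\<bar> / (A - 1) \<le> Q (F z) (F w)"
    if zw: "z \<in> S" "w \<in> S" and le: "fst w \<le> fst z" for z w
  proof -
    define x y where "x = fst z" and "y = fst w"
    have xy: "1 < y" "y \<le> x" "x < A" using that by (auto simp: S_def x_def y_def)
    note 1 = ln_S[of y x]
    have 2: "ln (A - y + 1) - ln (A - x + 1) \<le> ln (A - y) - ln (A - x)"
      using xy by (intro ln_diff_antimono) auto
    have 3: "0 \<le> ln x - ln y" "0 \<le> ln (A - y + 1) - ln (A - x + 1)" using xy by simp_all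
    have z: "ln \<bar>fst (F z)\<bar> = ln \<bar>snd z\<bar> + ln (A - x) - ln (x - 1)" "ln \<bar>snd (F z)\<bar> = ln (A - x + 1)"
       "ln \<bar>fst z\<bar> = ln x"
      using zw xy ln_abs_fst_F[of z] by (auto simp: S_def x_def F_def abs_if)
    have w: "ln \<bar>fst (F w)\<bar> = ln \<bar>snd w\<bar> + ln (A - y) - ln (y - 1)" "ln \<bar>snd (F w)\<bar> = ln (A - y + 1)"
       "ln \<bar>fst w\<bar> = ln y"
      using zw xy ln_abs_fst_F[of w] by (auto simp: S_def y_def F_def abs_if)
    have "0 \<le> (ln x - ln y) / (A - 1)" using 3 A by simp
    then show ?thesis unfolding Q_def z w using 1 2 3 xy by (simp add: x_def[symmetric] y_def[symmetric])
  qed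
  have "Q z w + \<bar>ln (fst z) - ln (fst w)\<bar> / (A - 1) \<le> Q (F z) (F w)"
    using *[OF zw] *[OF zw(2,1)] by (metis Q_commute abs_minus_commute linear)
  moreover have "0 < fst (F z)" using zw A by (auto simp: F_def S_def mult_neg_neg divide_neg_pos)
  ultimately show ?thesis using zw by (auto simp: V_def S_def)
qed

text \<open>\<open>F\<close> maps \<open>L\<close> into \<open>N\<close>, where \<open>V\<close> is
  minus \<open>Q\<close>. By concavity the differences of \<open>ln x\<close>,
  \<open>ln (x - 1)\<close>, \<open>ln (x - A)\<close> and \<open>ln (x - (A + 1))\<close> increase
  in this order, so the new vertical distance outweighs the other terms.\<close>

lemma V_L:
  assumes zw: "z \<in> L" "w \<in> L"
  shows "V z w \<le> V (F z) (F w)" "fst z \<noteq> fst w \<Longrightarrow> V z w < V (F z) (F w)"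
proof -
  have *: "Q z w \<le> - Q (F z) (F w) \<and> (fst w < fst z \<longrightarrow> Q z w < - Q (F z) (F w))"
    if zw: "z \<in> L" "w \<in> L" and le: "fst w \<le> fst z" for z w
  proof -
    define x y where "x = fst z" and "y = fst w"
    have xy: "A + 1 < y" "y \<le> x" using that by (auto simp: L_def x_def y_def)
    have 1: "ln x - ln y \<le> ln (x - 1) - ln (y - 1)"
            "y < x \<Longrightarrow> ln x - ln y < ln (x - 1) - ln (y - 1)"
      using xy A ln_diff_antimono[of "y - 1" "x - 1" y x] by simp_all
    have 2: "ln (x - 1) - ln (y - 1) \<le> ln (x - A) - ln (y - A)"
      using xy A by (intro ln_diff_antimono) auto
    have 3: "ln (x - A) - ln (y - A) \<le> ln (x - (A + 1)) - ln (y - (A + 1))"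
      using xy A by (intro ln_diff_antimono) auto
    have 4: "0 \<le> ln x - ln y" using xy A by simp
    have z: "ln \<bar>fst (F z)\<bar> = ln \<bar>snd z\<bar> + ln (x - A) - ln (x - 1)" "ln \<bar>snd (F z)\<bar> = ln (x - (A + 1))"
       "ln \<bar>fst z\<bar> = ln x"
      using zw xy A ln_abs_fst_F[of z] by (auto simp: L_def x_def F_def abs_if)
    have w: "ln \<bar>fst (F w)\<bar> = ln \<bar>snd w\<bar> + ln (y - A) - ln (y - 1)" "ln \<bar>snd (F w)\<bar> = ln (y - (A + 1))"
       "ln \<bar>fst w\<bar> = ln y"
      using zw xy A ln_abs_fst_F[of w] by (auto simp: L_def y_def F_def abs_if)
    have "fst w < fst z \<longleftrightarrow> y < x" by (simp add: x_def y_def)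
    then show ?thesis unfolding Q_def z w minus_diff_eq
      using abs_diff_le_aux[OF 4 3 _ 2] 1 by blast
  qed
  have "V z w = Q z w" "V (F z) (F w) = - Q (F z) (F w)"
    using zw F_F(1)[of z] A by (auto simp: V_def L_def)
  then show "V z w \<le> V (F z) (F w)" "fst z \<noteq> fst w \<Longrightarrow> V z w < V (F z) (F w)"
    using *[OF zw] *[OF zw(2,1)] by (metis Q_commute linear, metis Q_commute linorder_less_linear less_imp_le)
qed

text \<open>With \<open>x\<close> for the modulus of the abscissa, the differences of
  \<open>ln x\<close>, \<open>ln (x + 1)\<close>, \<open>ln (x + A)\<close> and
  \<open>ln (x + (A + 1))\<close> decrease in this order. This is the chain of \<open>V_L\<close>
  read in the opposite direction.\<close>

lemma V_N:
  assumes zw: "z \<in> N" "w \<in> N"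
  shows "V z w \<le> V (F z) (F w)" "fst z \<noteq> fst w \<Longrightarrow> V z w < V (F z) (F w)"
proof -
  have *: "- Q z w \<le> Q (F z) (F w) \<and> (fst z < fst w \<longrightarrow> - Q z w < Q (F z) (F w))"
    if zw: "z \<in> N" "w \<in> N" and le: "fst z \<le> fst w" for z w
  proof -
    define x y where "x = - fst z" and "y = - fst w"
    have xy: "0 < y" "y \<le> x" using that by (auto simp: N_def x_def y_def)
    have 1: "ln (x + 1) - ln (y + 1) \<le> ln x - ln y"
            "y < x \<Longrightarrow> ln (x + 1) - ln (y + 1) < ln x - ln y"
      using xy A ln_diff_antimono[of y x "y + 1" "x + 1"] by simp_all
    have 3: "ln (x + (A + 1)) - ln (y + (A + 1)) \<le> ln (x + A) - ln (y + A)"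
      using xy A by (intro ln_diff_antimono) auto
    have 2: "ln (x + A) - ln (y + A) \<le> ln (x + 1) - ln (y + 1)"
      using xy A by (intro ln_diff_antimono) auto
    have 4: "0 \<le> ln (x + (A + 1)) - ln (y + (A + 1))" using xy A by simp
    have z: "ln \<bar>fst (F z)\<bar> = ln \<bar>snd z\<bar> + ln (x + A) - ln (x + 1)" "ln \<bar>snd (F z)\<bar> = ln (x + (A + 1))"
       "ln \<bar>fst z\<bar> = ln x"
      using zw xy A ln_abs_fst_F[of z] by (auto simp: N_def x_def F_def abs_if algebra_simps)
    have w: "ln \<bar>fst (F w)\<bar> = ln \<bar>snd w\<bar> + ln (y + A) - ln (y + 1)" "ln \<bar>snd (F w)\<bar> = ln (y + (A + 1))"
       "ln \<bar>fst w\<bar> = ln y"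
      using zw xy A ln_abs_fst_F[of w] by (auto simp: N_def y_def F_def abs_if algebra_simps)
    have "fst z < fst w \<longleftrightarrow> y < x" by (simp add: x_def y_def)
    then show ?thesis unfolding Q_def z w minus_diff_eq
      using abs_diff_le_aux2[OF 2 3 4] 1 by blast
  qed
  have "0 < (fst z - A) / (fst z - 1)" using zw A by (auto simp: N_def divide_neg_neg)
  then have "0 < fst (F z)" using zw unfolding F_def N_def fst_conv by (intro mult_pos_pos) auto
  then have "V z w = - Q z w" "V (F z) (F w) = Q (F z) (F w)"
    using zw by (auto simp: V_def N_def)
  then show "V z w \<le> V (F z) (F w)" "fst z \<noteq> fst w \<Longrightarrow> V z w < V (F z) (F w)"
    using *[OF zw] *[OF zw(2,1)] by (metis Q_commute linear, metis Q_commute linorder_less_linear less_imp_le)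
qed

lemma V_step:
  assumes "z \<in> S \<and> w \<in> S \<or> z \<in> L \<and> w \<in> L \<or> z \<in> N \<and> w \<in> N"
  shows "V z w \<le> V (F z) (F w)" "fst z \<noteq> fst w \<Longrightarrow> V z w < V (F z) (F w)"
proof -
  have 1: "0 \<le> \<bar>ln (fst z) - ln (fst w)\<bar> / (A - 1)" using A by simp
  have 2: "0 < \<bar>ln (fst z) - ln (fst w)\<bar> / (A - 1)" if "fst z \<noteq> fst w" "z \<in> S" "w \<in> S"
    using A that by (simp add: S_def)
  show "V z w \<le> V (F z) (F w)" using assms V_S[of z w] V_L[of z w] V_N[of z w] 1 by argo
  show "fst z \<noteq> fst w \<Longrightarrow> V z w < V (F z) (F w)" using assms V_S[of z w] V_L[of z w] V_N[of z w] 2 by argo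
qed

end

subsection \<open>Symbolic dynamics\<close>

text \<open>The end \<infinity> is not an interior point, since its neighbourhoods contain large
  negative numbers.\<close>

lemma interior_arc_above: "circle interior_of arc_above c = Some ` {c<..}"
proof (rule antisym)
  show "Some ` {c<..} \<subseteq> circle interior_of arc_above c"
    by (rule interior_of_maximal) (auto simp: arc_above_def)
  show "circle interior_of arc_above c \<subseteq> Some ` {c<..}"
  proof
    fix u assume "u \<in> circle interior_of arc_above c"
    then obtain T where T: "openin circle T" "u \<in> T" "T \<subseteq> arc_above c" by (auto simp: interior_of_def)
    then have o: "open {x. Some x \<in> T}" and B: "None \<in> T \<longrightarrow> (\<exists>B. \<forall>x. \<bar>x\<bar> > B \<longrightarrow> Some x \<in> T)"
      by (auto simp: openin_circle_iff)
    have "None \<notin> T"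
    proof
      assume "None \<in> T"
      then obtain B where "\<And>x. \<bar>x\<bar> > B \<Longrightarrow> Some x \<in> T" using B by blast
      moreover have "\<bar>- \<bar>B\<bar> - \<bar>c\<bar> - 1\<bar> > B" by linarith
      ultimately have "Some (- \<bar>B\<bar> - \<bar>c\<bar> - 1) \<in> arc_above c" using T(3) by blast
      then show False by (auto simp: arc_above_def)
    qed
    then obtain x where x: "u = Some x" "c \<le> x" using T by (auto simp: arc_above_def)
    have "x \<noteq> c"
    proof
      assume "x = c"
      then obtain e where "e > 0" "\<And>y. \<bar>y - c\<bar> < e \<Longrightarrow> Some y \<in> T"
        using o T(2) x unfolding open_dist dist_real_def by auto
      then have "Some (c - e / 2) \<in> T" by simp
      then show False using \<open>e > 0\<close> T(3) by (auto simp: arc_above_def)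
    qed
    then show "u \<in> Some ` {c<..}" using x by auto
  qed
qed

lemma homeomorphic_map_uminus: "homeomorphic_map circle circle (map_option uminus)"
proof -
  have "continuous_map circle circle (map_option uminus)"
    using continuous_map_affine[of "- 1" 0] by simp
  then have "homeomorphic_maps circle circle (map_option uminus) (map_option uminus)"
    by (auto simp: homeomorphic_maps_def option.map_comp o_def option.map_ident)
  then show ?thesis by (rule homeomorphic_maps_map[THEN iffD1, THEN conjunct1])
qed

lemma arc_below_uminus: "arc_below c = map_option uminus ` arc_above (- c)"
  by (auto simp: arc_below_def arc_above_def image_iff) (metis minus_minus neg_le_iff_le atLeast_iff option.map(2))

lemma interior_arc_below: "circle interior_of arc_below c = Some ` {..<c}"
proof -
  have "circle interior_of arc_below c = map_option uminus ` (circle interior_of arc_above (- c))"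
    unfolding arc_below_uminus
    by (rule homeomorphic_map_interior_of[OF homeomorphic_map_uminus]) (unfold topspace_circle, simp)
  also have "\<dots> = Some ` {..<c}"
    by (auto simp: interior_arc_above image_image image_iff) (metis greaterThan_iff minus_minus neg_less_iff_less)
  finally show ?thesis .
qed

lemma closedin_arc_above: "closedin circle (arc_above c)"
proof -
  have "u \<in> UNIV - arc_above c \<longleftrightarrow> u \<in> Some ` {..<c}" for u by (cases u) (auto simp: arc_above_def image_iff)
  then have "UNIV - arc_above c = Some ` {..<c}" by blast
  then show ?thesis unfolding closedin_def topspace_circle by simp
qed

lemma closedin_arc_below: "closedin circle (arc_below c)"
proof -
  have "u \<in> UNIV - arc_below c \<longleftrightarrow> u \<in> Some ` {c<..}" for u by (cases u) (auto simp: arc_below_def image_iff)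
  then have "UNIV - arc_below c = Some ` {c<..}" by blast
  then show ?thesis unfolding closedin_def topspace_circle by simp
qed

lemma closedin_rect: "closedin torus (rect s)"
  by (simp add: rect_def torus_def closedin_prod_Times_iff closedin_arc_above closedin_arc_below)

definition G :: "nat \<Rightarrow> (real \<times> real) set" where
  "G s = (if s = 0 then {z. 1 < fst z \<and> snd z < - 1} else {z. fst z < 0 \<and> 0 < snd z})"

lemma open_G: "open (G s)"
  by (auto simp: G_def intro!: open_Collect_conj open_Collect_less continuous_intros)

lemma interior_rect: "torus interior_of rect s = emb ` G s"
proof -
  have *: "Some ` X \<times> Some ` Y = emb ` (X \<times> Y)" for X Y
    by (auto simp: emb_def image_iff)
  show ?thesis
    by (auto simp: rect_def torus_def interior_of_Times interior_arc_above interior_arc_below * G_def intro!: image_eqI)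
qed

lemma emb_rect: "emb z \<in> rect s \<longleftrightarrow>
   (if s = 0 then 1 \<le> fst z \<and> snd z \<le> - 1 else fst z \<le> 0 \<and> 0 \<le> snd z)"
  by (auto simp: rect_def emb_def arc_above_def arc_below_def)

lemma G_rect: "emb ` G s \<subseteq> rect s"
  using interior_of_subset interior_rect by metis

section \<open>Shifts and reversals of words\<close>

definition shw :: "int \<Rightarrow> (int \<Rightarrow> nat) \<Rightarrow> int \<Rightarrow> nat" where
  "shw k c = (\<lambda>j. c (j + k))"

definition revw :: "(int \<Rightarrow> nat) \<Rightarrow> int \<Rightarrow> nat" where
  "revw c = (\<lambda>j. c (- j))"

lemma shw_simps [simp]: "shw k c j = c (j + k)" "revw c j = c (- j)" "shw k (shw l c) = shw (l + k) c"
  "shw 0 c = c" "revw (revw c) = c"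
  by (auto simp: shw_def revw_def algebra_simps)

lemma golden_shw: "c \<in> golden_words \<Longrightarrow> shw k c \<in> golden_words"
  by (auto simp: golden_words_def) (metis add.commute add.left_commute)

lemma golden_revw: "c \<in> golden_words \<Longrightarrow> revw c \<in> golden_words"
proof -
  assume c: "c \<in> golden_words"
  have "\<not> (c (- k) = 1 \<and> c (- (k + 1)) = 1)" for k
  proof -
    have "\<not> (c (- k - 1) = 1 \<and> c (- k - 1 + 1) = 1)" using c unfolding golden_words_def by blast
    then show ?thesis by auto
  qed
  then show ?thesis using c by (auto simp: golden_words_def)
qed

lemma golden_cases: "c \<in> golden_words \<Longrightarrow> c k = 0 \<or> c k = 1 \<and> c (k + 1) = 0 \<and> c (k - 1) = 0"
proof -
  assume c: "c \<in> golden_words"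
  have "c j = 0 \<or> c j = 1" for j using c by (auto simp: golden_words_def)
  moreover have "\<not> (c j = 1 \<and> c (j + 1) = 1)" for j using c unfolding golden_words_def by blast
  from this[of k] this[of "k - 1"] have "\<not> (c k = 1 \<and> c (k + 1) = 1)" "\<not> (c (k - 1) = 1 \<and> c k = 1)" by auto
  ultimately show ?thesis by metis
qed

lemma closure_ofE:
  assumes "p \<in> X closure_of T" "openin X U" "p \<in> U"
  obtains q where "q \<in> T" "q \<in> U"
  using assms by (auto simp: in_closure_of)

context golden begin

definition SB :: "(int \<Rightarrow> nat) \<Rightarrow> nat \<Rightarrow> nat \<Rightarrow> pt set" where
  "SB c n m = {p. \<forall>k\<in>{- int n..int m}. f_pow k p \<in> emb ` G (c k)}"

abbreviation wrect :: "(int \<Rightarrow> nat) \<Rightarrow> pt set" where "wrect \<equiv> word_rect (- A)"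

text \<open>The contrapositive of \<open>fi_Q1\<close>: a backward orbit that ends at a finite point
  outside \<open>Q1\<close> was finite and outside \<open>Q1\<close> all along. It never met
  \<open>Ind\<close> and can be retraced.\<close>

lemma fi_not_Q1:
  assumes "fi p \<in> range emb - Q1"
  shows "p \<in> range emb - Q1" "f (fi p) = p"
proof -
  have "p \<notin> Q1" using assms fi_Q1 by blast
  moreover have "p \<in> range emb" using assms by (cases p rule: pt_cases) (auto simp: fi_inf)
  ultimately show "p \<in> range emb - Q1" by blast
  show "f (fi p) = p" using assms Ind_Q1 by (intro f_fi) auto
qed

lemma f_iter_fi_iter: "(fi ^^ k) p \<in> range emb - Q1 \<Longrightarrow> p \<in> range emb - Q1 \<and> (f ^^ k) ((fi ^^ k) p) = p"
proof (induction k)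
  case (Suc k)
  have *: "(fi ^^ k) p \<in> range emb - Q1" "f (fi ((fi ^^ k) p)) = (fi ^^ k) p"
    using fi_not_Q1[of "(fi ^^ k) p"] Suc.prems by auto
  have "(f ^^ Suc k) ((fi ^^ Suc k) p) = (f ^^ k) (f (fi ((fi ^^ k) p)))" by (simp add: funpow_Suc_comm)
  then show ?case using Suc.IH[OF *(1)] *(2) by simp
qed simp

lemma flip_G: "flip ` emb ` G s = emb ` G s"
proof -
  have "sw z \<in> G s \<longleftrightarrow> z \<in> G s" for z by (auto simp: G_def)
  then have "sw ` G s = G s" by (metis (no_types, opaque_lifting) image_iff sw_simps(3) subsetI subset_antisym)
  moreover have "flip ` emb ` G s = emb ` sw ` G s" by (simp add: image_image flip_emb)
  ultimately show ?thesis by simp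
qed

lemma flip_G_iff: "flip p \<in> emb ` G s \<longleftrightarrow> p \<in> emb ` G s"
  by (metis flip_G flip_image_iff)

lemma G_not_Q1: "emb ` G s \<subseteq> range emb - Q1"
  by (auto simp: emb_Q1) (auto simp: G_def split: if_splits)

lemma f_iter_fi_iter_G: "(fi ^^ k) p \<in> emb ` G s \<Longrightarrow> (f ^^ k) ((fi ^^ k) p) = p"
  using f_iter_fi_iter G_not_Q1 by blast

lemma fi_iter_f_iter_G: "(f ^^ k) p \<in> emb ` G s \<Longrightarrow> (fi ^^ k) ((f ^^ k) p) = p"
  using f_iter_fi_iter_G[of k "flip p" s] injD[OF inj_flip] by (simp add: funpow_fi_flip funpow_f_flip flip_G_iff)

lemma image_fi_iter_iff:
  assumes "p \<in> emb ` G s"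
  shows "p \<in> (fi ^^ k) ` emb ` G t \<longleftrightarrow> (f ^^ k) p \<in> emb ` G t"
proof
  assume "p \<in> (fi ^^ k) ` emb ` G t"
  then obtain u where "u \<in> emb ` G t" "p = (fi ^^ k) u" by blast
  then show "(f ^^ k) p \<in> emb ` G t" using f_iter_fi_iter_G[of k u s] assms by simp
next
  assume *: "(f ^^ k) p \<in> emb ` G t"
  then have "(fi ^^ k) ((f ^^ k) p) = p" by (rule fi_iter_f_iter_G)
  then show "p \<in> (fi ^^ k) ` emb ` G t" using * by (metis imageI)
qed

lemma image_f_pow_iff:
  assumes "p \<in> emb ` G s"
  shows "p \<in> f_pow (- k) ` emb ` G t \<longleftrightarrow> f_pow k p \<in> emb ` G t"
proof (cases k rule: int_cases2)
  case (nonneg j)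
  then show ?thesis using image_fi_iter_iff[OF assms] by simp
next
  case (nonpos j)
  have "p \<in> (f ^^ j) ` emb ` G t \<longleftrightarrow> flip p \<in> flip ` (f ^^ j) ` emb ` G t"
    by (metis flip_flip flip_image_iff)
  also have "flip ` (f ^^ j) ` emb ` G t = (fi ^^ j) ` emb ` G t"
    by (subst (2) flip_G[symmetric]) (simp add: image_image funpow_fi_flip)
  also have "flip p \<in> (fi ^^ j) ` emb ` G t \<longleftrightarrow> (f ^^ j) (flip p) \<in> emb ` G t"
    using assms flip_G_iff by (intro image_fi_iter_iff[of _ s]) blast
  also have "\<dots> \<longleftrightarrow> (fi ^^ j) p \<in> emb ` G t" by (simp add: funpow_f_flip flip_G_iff)
  finally show ?thesis using nonpos by simp
qed

text \<open>Images under the total map \<open>f_pow (- k)\<close> are exchanged for preimages under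
  \<open>f_pow k\<close>. This is legitimate at points in the interior of a rectangle, and time 0
  belongs to every block.\<close>

lemma block_rect_eq: "block_rect (- A) c n m = torus closure_of SB c n m"
proof -
  have "(\<Inter>k\<in>{- int n..int m}. f_pow (- k) ` (torus interior_of rect (c k))) = SB c n m" (is "?X = _")
  proof (intro set_eqI iffI)
    fix p assume p: "p \<in> ?X"
    then have "p \<in> f_pow (- 0) ` (torus interior_of rect (c 0))" by (rule INT_D) simp
    then have 0: "p \<in> emb ` G (c 0)" by (simp add: interior_rect fpow_def)
    show "p \<in> SB c n m" using p unfolding SB_def by (auto simp: image_f_pow_iff[OF 0, symmetric] interior_rect simp del: image_image)
  next
    fix p assume p: "p \<in> SB c n m"
    then have "f_pow 0 p \<in> emb ` G (c 0)" unfolding SB_def by fastforce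
    then have 0: "p \<in> emb ` G (c 0)" by (simp add: fpow_def)
    show "p \<in> ?X" using p unfolding SB_def by (auto simp: image_f_pow_iff[OF 0] interior_rect simp del: image_image)
  qed
  then show ?thesis by (simp add: block_rect_def)
qed

lemma wrect_iff: "p \<in> wrect c \<longleftrightarrow> (\<forall>n m. p \<in> torus closure_of SB c n m)"
  by (auto simp: word_rect_def block_rect_eq)

lemma SB_antimono: "n \<le> n' \<Longrightarrow> m \<le> m' \<Longrightarrow> SB c n' m' \<subseteq> SB c n m"
  by (auto simp: SB_def)

lemma SB_f:
  assumes "p \<in> SB c n (Suc m)"
  shows "f p \<in> SB (shw 1 c) (Suc n) m"
proof -
  have k: "f_pow k p \<in> emb ` G (c k)" if "k \<in> {- int n..int m + 1}" for k using assms that by (auto simp: SB_def)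
  have "f_pow 1 p \<in> emb ` G (c 1)" by (rule k) simp
  then have "f p \<in> emb ` G (c 1)" using f_pow_of_nat[of 1] by simp
  then have fif: "fi (f p) = p" using fi_iter_f_iter_G[of 1] by simp
  have "f_pow j (f p) = f_pow (j + 1) p" for j
  proof (cases j rule: int_cases)
    case (nonneg i)
    have "f_pow (int i + 1) = f ^^ Suc i" using f_pow_of_nat[of "Suc i"] by (simp add: add.commute)
    then show ?thesis using nonneg by (simp add: funpow_Suc_comm)
  next
    case (neg i)
    have "- int (Suc i) + 1 = - int i" by simp
    then show ?thesis unfolding neg by (simp only: f_pow_minus_of_nat funpow_Suc_right o_apply fif)
  qed
  then show ?thesis using k unfolding SB_def by (auto simp del: image_image)
qed

lemma SB_flip: "p \<in> SB c n m \<Longrightarrow> flip p \<in> SB (revw c) m n"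
  by (auto simp: SB_def f_pow_flip flip_G_iff)

lemma wrect_f:
  assumes "p \<in> wrect c" "p \<notin> Ind"
  shows "f p \<in> wrect (shw 1 c)"
  unfolding wrect_iff in_closure_of topspace_torus
proof (intro allI conjI impI UNIV_I)
  fix n m V assume V: "f p \<in> V \<and> openin torus V"
  then have "openin torus {p. p \<notin> Ind \<and> f p \<in> V}" "p \<in> {p. p \<notin> Ind \<and> f p \<in> V}"
    using assms by (simp_all add: openin_f)
  moreover have "p \<in> torus closure_of SB c n (Suc m)" using assms by (simp add: wrect_iff)
  ultimately obtain q where q: "q \<in> SB c n (Suc m)" "f q \<in> V" by (blast elim: closure_ofE)
  have "f q \<in> SB (shw 1 c) n m"
    using SB_f[OF q(1)] SB_antimono[of n "Suc n" m m "shw 1 c"] by (meson le_SucI order_refl subsetD)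
  then show "\<exists>y. y \<in> SB (shw 1 c) n m \<and> y \<in> V"
    using q(2) by blast
qed

lemma wrect_flip:
  assumes "p \<in> wrect c"
  shows "flip p \<in> wrect (revw c)"
  unfolding wrect_iff in_closure_of topspace_torus
proof (intro allI conjI impI UNIV_I)
  fix n m V assume V: "flip p \<in> V \<and> openin torus V"
  then have "openin torus (flip ` V)" "p \<in> flip ` V" by (simp_all add: openin_flip flip_image_iff)
  moreover have "p \<in> torus closure_of SB c m n" using assms by (simp add: wrect_iff)
  ultimately obtain q where "q \<in> SB c m n" "q \<in> flip ` V" by (blast elim: closure_ofE)
  then show "\<exists>y. y \<in> SB (revw c) n m \<and> y \<in> V"
    using SB_flip[of q c m n] unfolding flip_image_iff by blast
qed

lemma wrect_closed:
  assumes "p \<in> wrect c" "SB c 0 1 \<subseteq> T" "closedin torus T"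
  shows "p \<in> T"
  using assms closure_of_minimal wrect_iff by (metis subsetD)

lemma SB_01:
  assumes "p \<in> SB c 0 1"
  obtains z where "p = emb z" "z \<in> G (c 0)" "F z \<in> G (c 1)"
proof -
  have k: "f_pow k p \<in> emb ` G (c k)" if "k \<in> {0..1}" for k using assms that by (auto simp: SB_def)
  from k[of 0] obtain z where z: "p = emb z" "z \<in> G (c 0)" by (auto simp: fpow_def)
  then have "fst z \<noteq> 1" by (auto simp: G_def split: if_splits)
  then have "emb (F z) \<in> emb ` G (c 1)" using k[of 1] z f_pow_of_nat[of 1] by (simp add: f_emb)
  then show ?thesis using z that by simp
qed

lemma wrect_rect:
  assumes "p \<in> wrect c"
  shows "p \<in> rect (c 0)"
proof (rule wrect_closed[OF assms _ closedin_rect])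
  show "SB c 0 1 \<subseteq> rect (c 0)" using G_rect by (blast elim: SB_01)
qed

lemma closedin_fst_vimage: "closedin circle T \<Longrightarrow> closedin torus {p. fst p \<in> T}"
  using closedin_continuous_map_preimage[OF continuous_map_fst[of circle circle], of T]
  unfolding torus_def[symmetric] topspace_torus by simp

text \<open>Reading 00 requires a positive abscissa after one step, which for \<open>y < 0\<close>
  forces \<open>x < A\<close>. The bounded interval survives the closure and rules out the abscissa
  \<infinity>.\<close>

lemma wrect_00:
  assumes "p \<in> wrect c" "c 0 = 0" "c 1 = 0"
  obtains x where "fst p = Some x" "1 \<le> x" "x \<le> A"
proof -
  have cl: "closedin circle (Some ` {1..A})" by (simp add: compact_imp_closed)
  have "p \<in> {p. fst p \<in> Some ` {1..A}}"
  proof (rule wrect_closed[OF assms(1) _ closedin_fst_vimage[OF cl]])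
    show "SB c 0 1 \<subseteq> {p. fst p \<in> Some ` {1..A}}"
    proof
      fix q assume "q \<in> SB c 0 1"
      then obtain z where z: "q = emb z" "z \<in> G (c 0)" "F z \<in> G (c 1)" by (rule SB_01)
      have "fst z < A"
      proof (rule ccontr)
        assume "\<not> fst z < A"
        then have "snd z * ((fst z - A) / (fst z - 1)) \<le> 0"
          using z(2) assms(2) A by (intro mult_nonpos_nonneg divide_nonneg_pos) (auto simp: G_def)
        then show False using z(3) assms(3) by (simp add: F_def G_def)
      qed
      then show "q \<in> {p. fst p \<in> Some ` {1..A}}" using z assms by (auto simp: G_def emb_def)
    qed
  qed
  then show ?thesis using that by auto
qed

lemma wrect_01:
  assumes "p \<in> wrect c" "c 0 = 0" "c 1 = 1"
  shows "fst p \<in> arc_above (A + 1)"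
proof -
  have "SB c 0 1 \<subseteq> {p. fst p \<in> arc_above (A + 1)}"
  proof
    fix q assume "q \<in> SB c 0 1"
    then obtain z where z: "q = emb z" "z \<in> G (c 0)" "F z \<in> G (c 1)" by (rule SB_01)
    then show "q \<in> {p. fst p \<in> arc_above (A + 1)}" using assms by (auto simp: G_def emb_def F_def arc_above_def)
  qed
  then show ?thesis using wrect_closed[OF assms(1) _ closedin_fst_vimage[OF closedin_arc_above]] by simp
qed

lemma wrect_emb_f:
  assumes "emb z \<in> wrect c" "fst z \<noteq> 1"
  shows "emb (F z) \<in> wrect (shw 1 c)"
proof -
  have "emb z \<notin> Ind" using assms(2) unfolding not_Ind_emb by auto
  from wrect_f[OF assms(1) this] show ?thesis by (simp add: f_emb[OF assms(2)])
qed

lemma wrect_emb_rect: "emb z \<in> wrect c \<Longrightarrow> c 0 = 0 \<Longrightarrow> 1 \<le> fst z \<and> snd z \<le> - 1"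
  "emb z \<in> wrect c \<Longrightarrow> c 0 = 1 \<Longrightarrow> fst z \<le> 0 \<and> 0 \<le> snd z"
  by (drule wrect_rect, simp add: emb_rect)+

text \<open>Points of R(w) may lie on the sides of a rectangle, but here the next symbol 0 excludes
  \<open>y = 0\<close>, which would give the abscissa 0. Reversal excludes
  \<open>x = 0\<close>.\<close>

lemma wrect_emb_N:
  assumes c: "c \<in> golden_words" and z: "emb z \<in> wrect c" "c 0 = 1"
  shows "z \<in> N"
proof -
  have *: "0 < snd z" if c: "c \<in> golden_words" and z: "emb z \<in> wrect c" "c 0 = 1" for c z
  proof -
    have z': "fst z \<le> 0" "0 \<le> snd z" using wrect_emb_rect(2)[OF z] by auto
    then have "emb (F z) \<in> wrect (shw 1 c)" using z by (intro wrect_emb_f) auto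
    moreover have "shw 1 c 0 = 0" using golden_cases[OF c, of 0] z by simp
    ultimately have "1 \<le> fst (F z)" using wrect_emb_rect(1) by blast
    then have "snd z \<noteq> 0" by (auto simp: F_def)
    then show ?thesis using z' by simp
  qed
  have "emb (sw z) \<in> wrect (revw c)" using wrect_flip[OF z(1)] by (simp add: flip_emb)
  from *[OF golden_revw[OF c] this] z *[OF c z] show ?thesis by (simp add: N_def)
qed

lemma wrect_emb_L:
  assumes c: "c \<in> golden_words" and z: "emb z \<in> wrect c" "c 0 = 0" "c 1 = 1"
  shows "z \<in> L"
proof -
  have z': "snd z \<le> - 1" "1 \<le> fst z" using wrect_emb_rect(1)[OF z(1,2)] by auto
  have x: "A + 1 \<le> fst z" using wrect_01[OF z] by (auto simp: emb_def arc_above_def)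
  then have "emb (F z) \<in> wrect (shw 1 c)" using A z by (intro wrect_emb_f) auto
  then have "F z \<in> N" using z by (intro wrect_emb_N[OF golden_shw[OF c]]) auto
  then show ?thesis using x z' by (simp add: N_def F_def L_def)
qed

lemma wrect_emb_S:
  assumes z: "emb z \<in> wrect c" "c 0 = 0" "c 1 = 0" "fst z \<noteq> 1"
  shows "z \<in> S"
proof -
  have z': "snd z \<le> - 1" using wrect_emb_rect(1)[OF z(1,2)] by auto
  have x: "1 \<le> fst z" "fst z \<le> A" using wrect_00[OF z(1-3)] by (auto simp: emb_def)
  have "emb (F z) \<in> wrect (shw 1 c)" using z by (intro wrect_emb_f) auto
  then have "1 \<le> fst (F z)" using wrect_emb_rect(1)[of "F z" "shw 1 c"] z by auto
  then have "fst z \<noteq> A" by (auto simp: F_def)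
  then show ?thesis using x z' z by (simp add: S_def)
qed

text \<open>The orbit alternates between \<open>(\<infinity>, y)\<close> and
  \<open>(y, \<infinity>)\<close>, and \<open>y\<close> drops by \<open>A + 1\<close> every second
  step. With \<open>y < 0\<close> the former lies only in the rectangle 0 and the latter only in the
  rectangle 1.\<close>

lemma wrect_inf_forward:
  assumes "(None, Some y) \<in> wrect c" "y < 0" "c \<in> golden_words" "0 \<le> k"
  shows "\<not> (c k = 0 \<and> c (k + 1) = 0)"
proof -
  have *: "c 0 = 0 \<and> c 1 = 1 \<and> (None, Some (y - (A + 1))) \<in> wrect (shw 2 c)"
    if p: "(None, Some y) \<in> wrect c" "y < 0" "c \<in> golden_words" for y c
  proof -
    have c: "c 0 = 0 \<or> c 0 = 1" "c 1 = 0 \<or> c 1 = 1" using that(3) by (auto simp: golden_words_def)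
    have 0: "c 0 = 0" using wrect_rect[OF p(1)] p(2) c by (auto simp: rect_def arc_above_def)
    have "(None, Some y) \<notin> Ind" by (simp add: indet_def)
    from wrect_f[OF p(1) this] have 1: "(Some y, None) \<in> wrect (shw 1 c)" by (simp add: f_inf)
    then have c1: "c 1 = 1" using wrect_rect[OF 1] p(2) c by (auto simp: rect_def arc_above_def split: if_splits)
    have "(Some y, None) \<notin> Ind" using A p by (simp add: indet_def)
    from wrect_f[OF 1 this] show ?thesis using 0 c1 by (simp add: f_inf shift_def algebra_simps)
  qed
  have "(None, Some (y - real i * (A + 1))) \<in> wrect (shw (2 * int i) c)" for i
  proof (induction i)
    case (Suc i)
    have "0 \<le> real i * (A + 1)" using A by simp
    then have "y - real i * (A + 1) < 0" using assms(2) by linarith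
    from *[OF Suc this golden_shw[OF assms(3)]] show ?case by (simp add: shw_def algebra_simps)
  qed (use assms in simp)
  moreover have "y - real i * (A + 1) < 0" for i
  proof -
    have "0 \<le> real i * (A + 1)" using A by simp
    then show ?thesis using assms(2) by linarith
  qed
  ultimately have c: "c (2 * int i) = 0 \<and> c (2 * int i + 1) = 1" for i
    using *[OF _ _ golden_shw[OF assms(3)], of "y - real i * (A + 1)" "2 * int i"] by (simp add: add.commute)
  have "k = 2 * int (nat (k div 2)) \<or> k = 2 * int (nat (k div 2)) + 1" using assms(4) by simp presburger
  then show ?thesis using c[of "nat (k div 2)"] by auto
qed

text \<open>An alternating future keeps the orbit in \<open>L\<close> and \<open>N\<close>, which
  avoid the line \<open>x = 1\<close>. So it would stay finite with abscissas above
  \<open>A + 1\<close> at every second time, against \<open>escape_F\<close>.\<close>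

lemma wrect_emb_00:
  assumes c: "c \<in> golden_words" and z: "emb z \<in> wrect c"
  obtains k :: nat where "c (int k) = 0" "c (int k + 1) = 0"
proof -
  have "\<exists>k::nat. c (int k) = 0 \<and> c (int k + 1) = 0"
  proof (rule ccontr)
    assume no: "\<nexists>k::nat. c (int k) = 0 \<and> c (int k + 1) = 0"
    have *: False if c: "c \<in> golden_words" and z: "emb z \<in> wrect c" and c0: "c 0 = 0"
       and no: "\<And>k. 0 \<le> k \<Longrightarrow> \<not> (c k = 0 \<and> c (k + 1) = 0)" for c z
    proof -
      have cj: "c (2 * int i) = 0 \<and> c (2 * int i + 1) = 1" for i
      proof (induction i)
        case 0 then show ?case using c0 no[of 0] golden_cases[OF c, of 1] by auto
      next
        case (Suc i)
        have "c (2 * int i + 2) = 0" using golden_cases[OF c, of "2 * int i + 1"] Suc by (simp add: add.assoc)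
        moreover have "c (2 * int i + 2 + 1) \<noteq> 0" using no[of "2 * int i + 2"] calculation by auto
        moreover have "c (2 * int i + 2 + 1) = 0 \<or> c (2 * int i + 2 + 1) = 1" using golden_cases[OF c] by blast
        ultimately show ?case by (simp add: algebra_simps)
      qed
      have L: "(F ^^ (2 * i)) z \<in> L" and W: "emb ((F ^^ (2 * i)) z) \<in> wrect (shw (2 * int i) c)" for i
      proof -
        have "emb ((F ^^ (2 * i)) z) \<in> wrect (shw (2 * int i) c) \<and> (F ^^ (2 * i)) z \<in> L"
        proof (induction i)
          case 0 then show ?case using z wrect_emb_L[OF c z] cj[of 0] by simp
        next
          case (Suc i)
          let ?z = "(F ^^ (2 * i)) z"
          have "fst ?z \<noteq> 1" using Suc A by (auto simp: L_def)
          then have 1: "emb (F ?z) \<in> wrect (shw 1 (shw (2 * int i) c))" using Suc wrect_emb_f by blast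
          then have "F ?z \<in> N" using cj[of i] by (intro wrect_emb_N[OF golden_shw[OF c]]) (auto simp: add.commute)
          then have "fst (F ?z) \<noteq> 1" by (auto simp: N_def)
          then have 2: "emb (F (F ?z)) \<in> wrect (shw (2 * int (Suc i)) c)"
            using wrect_emb_f[OF 1] by (simp add: shw_def algebra_simps)
          moreover have "F (F ?z) \<in> L" using cj[of "Suc i"]
            by (intro wrect_emb_L[OF golden_shw[OF c] 2]) (auto simp: algebra_simps)
          ultimately show ?case by (simp del: shw_simps)
        qed
        then show "(F ^^ (2 * i)) z \<in> L" "emb ((F ^^ (2 * i)) z) \<in> wrect (shw (2 * int i) c)" by auto
      qed
      obtain J where J: "\<And>z'. snd z' < 0 \<and> fst z' - snd z' - 1 \<le> fst z - snd z - 1 \<Longrightarrow>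
          \<exists>i<J. fst ((F ^^ (2 * i)) z') \<le> A + 1"
        using escape_F by blast
      have "snd z < 0" using L[of 0] by (simp add: L_def)
      then obtain i where "fst ((F ^^ (2 * i)) z) \<le> A + 1" using J[of z] by auto
      then show False using L[of i] by (simp add: L_def)
    qed
    have no': "\<not> (c k = 0 \<and> c (k + 1) = 0)" if "0 \<le> k" for k
      using no that by (metis nonneg_int_cases)
    show False
    proof (cases "c 0 = 0")
      case True then show ?thesis using *[OF c z] no' by blast
    next
      case False
      then have c01: "c 0 = 1" "c 1 = 0" using golden_cases[OF c, of 0] by auto
      have "z \<in> N" using wrect_emb_N[OF c z] c01 by blast
      then have "emb (F z) \<in> wrect (shw 1 c)" using z by (intro wrect_emb_f) (auto simp: N_def)
      moreover have "\<not> (shw 1 c k = 0 \<and> shw 1 c (k + 1) = 0)" if "0 \<le> k" for k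
        using no'[of "k + 1"] that by simp
      ultimately show ?thesis using *[OF golden_shw[OF c], of "F z" 1] c01 by auto
    qed
  qed
  then show ?thesis using that by blast
qed

text \<open>After one step \<open>z\<close> is at infinity and forces an alternating word, while
  \<open>w\<close> is still finite and forces a 00 in it.\<close>

lemma wrect_no_exit:
  assumes c: "c \<in> golden_words" and z: "emb z \<in> wrect c" "fst z = 1" and w: "emb w \<in> wrect c" "fst w \<noteq> 1"
  shows False
proof -
  have "c 0 \<noteq> 1" using wrect_emb_rect(2)[OF z(1)] z(2) by auto
  then have c0: "c 0 = 0" using golden_cases[OF c, of 0] by auto
  then have "snd z \<le> - 1" using wrect_emb_rect(1)[OF z(1)] by auto
  then have "emb z \<notin> Ind" unfolding not_Ind_emb by auto
  then have "f (emb z) \<in> wrect (shw 1 c)" using z by (intro wrect_f)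
  moreover have "f (emb z) = (None, Some (- A))" using f_emb1[of "snd z"] z(2) by (metis prod.collapse)
  ultimately have inf: "(None, Some (- A)) \<in> wrect (shw 1 c)" by simp
  have "emb (F w) \<in> wrect (shw 1 c)" using w by (rule wrect_emb_f)
  then obtain k :: nat where "shw 1 c (int k) = 0" "shw 1 c (int k + 1) = 0"
    using wrect_emb_00[OF golden_shw[OF c]] by metis
  then show False using wrect_inf_forward[OF inf _ golden_shw[OF c], of "int k"] A by auto
qed

lemma V_le_Q: "0 < fst z \<Longrightarrow> 0 < fst w \<Longrightarrow> V z w \<le> \<bar>ln (fst z) - ln (fst w)\<bar>"
  by (simp add: V_def Q_def)

lemma wrect_pair_step:
  assumes c: "c \<in> golden_words" and z: "emb z \<in> wrect c" "fst z \<noteq> 1" and w: "emb w \<in> wrect c" "fst w \<noteq> 1"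
  shows "V z w \<le> V (F z) (F w)" "fst z \<noteq> fst w \<Longrightarrow> V z w < V (F z) (F w)"
    "emb (F z) \<in> wrect (shw 1 c)" "emb (F w) \<in> wrect (shw 1 c)"
proof -
  have "z \<in> S \<and> w \<in> S \<or> z \<in> L \<and> w \<in> L \<or> z \<in> N \<and> w \<in> N"
  proof (cases "c 0 = 0")
    case True
    then show ?thesis using wrect_emb_S[of _ c] wrect_emb_L[OF c] z w golden_cases[OF c, of 1] by metis
  next
    case False
    then show ?thesis using wrect_emb_N[OF c] z w golden_cases[OF c, of 0] by metis
  qed
  from V_step[OF this] show "V z w \<le> V (F z) (F w)" "fst z \<noteq> fst w \<Longrightarrow> V z w < V (F z) (F w)" by auto
  show "emb (F z) \<in> wrect (shw 1 c)" "emb (F w) \<in> wrect (shw 1 c)" using z w wrect_emb_f by auto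
qed

text \<open>If \<open>V\<close> is positive, the abscissas differ, so by
  \<open>wrect_no_exit\<close> neither orbit meets \<open>x = 1\<close> and both continue forever.
  The word reads 00 infinitely often, and each time \<open>V\<close> gains a fixed amount while
  being at most \<open>ln A\<close>.\<close>

lemma wrect_V_nonpos:
  assumes c: "c \<in> golden_words" and z: "emb z \<in> wrect c" and w: "emb w \<in> wrect c"
  shows "V z w \<le> 0"
proof (rule ccontr)
  assume "\<not> V z w \<le> 0"
  then have V0: "0 < V z w" by simp
  define zk wk where "zk k = (F ^^ k) z" and "wk k = (F ^^ k) w" for k
  have ne1: "fst z \<noteq> 1 \<and> fst w \<noteq> 1" if "c \<in> golden_words" "emb z \<in> wrect c" "emb w \<in> wrect c" "0 < V z w" for c z w
  proof -
    have "\<not> (fst z = 1 \<and> fst w = 1)" using that(4) by (auto simp: V_def Q_def)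
    then show ?thesis using wrect_no_exit[OF that(1,2) _ that(3)] wrect_no_exit[OF that(1,3) _ that(2)] by blast
  qed
  have main: "emb (zk k) \<in> wrect (shw (int k) c) \<and> emb (wk k) \<in> wrect (shw (int k) c) \<and> V z w \<le> V (zk k) (wk k)" for k
  proof (induction k)
    case (Suc k)
    have n1: "fst (zk k) \<noteq> 1 \<and> fst (wk k) \<noteq> 1"
      using Suc V0 by (intro ne1[OF golden_shw[OF c, of "int k"], of "zk k" "wk k"]) linarith+
    show ?case using wrect_pair_step[OF golden_shw[OF c], of "zk k" "int k" "wk k"] Suc n1
      by (auto simp: zk_def wk_def shw_def ac_simps)
  qed (use z w in \<open>auto simp: zk_def wk_def\<close>)
  have step: "V (zk k) (wk k) \<le> V (zk (Suc k)) (wk (Suc k))" and n1: "fst (zk k) \<noteq> 1 \<and> fst (wk k) \<noteq> 1" for k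
  proof -
    show n1: "fst (zk k) \<noteq> 1 \<and> fst (wk k) \<noteq> 1"
      using main[of k] V0 by (intro ne1[OF golden_shw[OF c], of _ "int k"]) auto
    show "V (zk k) (wk k) \<le> V (zk (Suc k)) (wk (Suc k))"
      using wrect_pair_step(1)[OF golden_shw[OF c], of "zk k" "int k" "wk k"] main[of k] n1
      by (auto simp: zk_def wk_def)
  qed
  have mono: "j \<le> k \<Longrightarrow> V (zk j) (wk j) \<le> V (zk k) (wk k)" for j k
    by (rule lift_Suc_mono_le[of "\<lambda>k. V (zk k) (wk k)"]) (use step in auto)
  have next00: "\<exists>k\<ge>j. zk k \<in> S \<and> wk k \<in> S" for j
  proof -
    obtain i :: nat where "shw (int j) c (int i) = 0" "shw (int j) c (int i + 1) = 0"
      using wrect_emb_00[OF golden_shw[OF c]] main[of j] by metis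
    then have "shw (int (i + j)) c 0 = 0" "shw (int (i + j)) c 1 = 0" by (simp_all add: algebra_simps)
    then show ?thesis using wrect_emb_S[of _ "shw (int (i + j)) c"] main[of "i + j"] n1[of "i + j"]
      by (intro exI[of _ "i + j"]) auto
  qed
  have bound: "V (zk k) (wk k) \<le> \<bar>ln (fst (zk k)) - ln (fst (wk k))\<bar> \<and> \<bar>ln (fst (zk k)) - ln (fst (wk k))\<bar> \<le> ln A"
    if "zk k \<in> S \<and> wk k \<in> S" for k
  proof -
    have "0 \<le> ln (fst (zk k))" "ln (fst (zk k)) \<le> ln A" "0 \<le> ln (fst (wk k))" "ln (fst (wk k)) \<le> ln A"
      using that by (auto simp: S_def)
    then have "\<bar>ln (fst (zk k)) - ln (fst (wk k))\<bar> \<le> ln A" by linarith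
    then show ?thesis using V_le_Q[of "zk k" "wk k"] that by (auto simp: S_def)
  qed
  \<comment> \<open>At a visit to \<open>S\<close> the gain is at least
    \<open>\<bar>\<Delta> ln x\<bar> / (A - 1)\<close>, and \<open>\<bar>\<Delta> ln x\<bar>\<close>
    is at least the current \<open>V\<close>, hence at least the initial one.\<close>
  define e where "e = V z w / (A - 1)"
  have e: "0 < e" using V0 A by (simp add: e_def)
  have grow: "\<exists>k. real n * e \<le> V (zk k) (wk k)" for n :: nat
  proof (induction n)
    case 0 then show ?case using main[of 0] V0 by (intro exI[of _ 0]) auto
  next
    case (Suc n)
    then obtain j where j: "real n * e \<le> V (zk j) (wk j)" by blast
    obtain k where k: "j \<le> k" "zk k \<in> S \<and> wk k \<in> S" using next00 by blast
    have "V z w \<le> \<bar>ln (fst (zk k)) - ln (fst (wk k))\<bar>" using main[of k] bound[OF k(2)] by linarith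
    then have "e \<le> \<bar>ln (fst (zk k)) - ln (fst (wk k))\<bar> / (A - 1)" using A unfolding e_def by (intro divide_right_mono) auto
    also have "\<dots> \<le> V (zk (Suc k)) (wk (Suc k)) - V (zk k) (wk k)"
      using V_S[of "zk k" "wk k"] k by (simp add: zk_def wk_def)
    finally show ?case using j mono[OF k(1)] by (intro exI[of _ "Suc k"]) (simp add: algebra_simps)
  qed
  obtain n :: nat where n: "ln A / e < real n" using reals_Archimedean2 by blast
  obtain j where j: "real n * e \<le> V (zk j) (wk j)" using grow by blast
  obtain k where k: "j \<le> k" "zk k \<in> S \<and> wk k \<in> S" using next00 by blast
  have "real n * e \<le> ln A" using j mono[OF k(1)] bound[OF k(2)] by linarith
  then show False using n e by (simp add: field_simps)
qed

text \<open>Reversal turns \<open>V <= 0\<close> into \<open>V = 0\<close>. Different abscissas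
  would make \<open>V\<close> positive one step later; equal ones leave only the vertical term,
  which must vanish.\<close>

lemma wrect_emb_unique:
  assumes c: "c \<in> golden_words" and z: "emb z \<in> wrect c" and w: "emb w \<in> wrect c"
  shows "z = w"
proof (rule ccontr)
  assume ne: "z \<noteq> w"
  have "emb (sw z) \<in> wrect (revw c)" "emb (sw w) \<in> wrect (revw c)"
    using wrect_flip[OF z] wrect_flip[OF w] by (simp_all add: flip_emb)
  then have *: "V (sw z) (sw w) \<le> 0" by (rule wrect_V_nonpos[OF golden_revw[OF c]])
  have sgn: "0 < fst z \<longleftrightarrow> snd z < 0"
  proof (cases "c 0 = 0")
    case True
    then show ?thesis using wrect_emb_rect(1)[OF z] by simp
  next
    case False
    then have "c 0 = 1" using golden_cases[OF c, of 0] by auto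
    then show ?thesis using wrect_emb_N[OF c z] by (simp add: N_def)
  qed
  have "V (sw z) (sw w) = - V z w" using sgn by (auto simp: V_def Q_def)
  then have V0: "V z w = 0" using * wrect_V_nonpos[OF c z w] by simp
  show False
  proof (cases "fst z = fst w")
    case True
    then have "ln \<bar>snd z\<bar> = ln \<bar>snd w\<bar>" using V0 by (auto simp: V_def Q_def split: if_splits)
    moreover have "snd z \<noteq> 0 \<and> snd w \<noteq> 0 \<and> (0 < snd z \<longleftrightarrow> 0 < snd w)"
    proof (cases "c 0 = 0")
      case True
      then show ?thesis using wrect_emb_rect(1)[OF z] wrect_emb_rect(1)[OF w] by auto
    next
      case False
      then have "c 0 = 1" using golden_cases[OF c, of 0] by auto
      then show ?thesis using wrect_emb_N[OF c z] wrect_emb_N[OF c w] by (simp add: N_def)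
    qed
    ultimately have "snd z = snd w" by (auto simp: abs_if split: if_splits)
    then show False using True ne by (simp add: prod_eq_iff)
  next
    case False
    show False
    proof (cases "fst z = 1 \<or> fst w = 1")
      case True
      then show False using False wrect_no_exit[OF c z _ w] wrect_no_exit[OF c w _ z] by metis
    next
      case n1: False
      then have "0 < V (F z) (F w)" "emb (F z) \<in> wrect (shw 1 c)" "emb (F w) \<in> wrect (shw 1 c)"
        using wrect_pair_step[OF c z _ w] V0 False by auto
      then show False using wrect_V_nonpos[OF golden_shw[OF c]] by fastforce
    qed
  qed
qed

text \<open>Follow the infinite point to the first 00. There its abscissa is bounded, so it has the
  form \<open>(x, \<infinity>)\<close> with \<open>x >= 1\<close>. Its reversed orbit then
  alternates, which contradicts the 00 that the finite point forces in the past of the word.\<close>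

lemma wrect_emb_not_inf:
  assumes c: "c \<in> golden_words" and z: "emb z \<in> wrect c" and p: "p \<in> wrect c"
  shows "p \<in> range emb"
proof (rule ccontr)
  assume inf: "p \<notin> range emb"
  obtain k0 :: nat where k0: "c (int k0) = 0" "c (int k0 + 1) = 0" using wrect_emb_00[OF c z] by blast
  define k where "k = (LEAST k::nat. c (int k) = 0 \<and> c (int k + 1) = 0)"
  have k: "c (int k) = 0 \<and> c (int k + 1) = 0" unfolding k_def by (rule LeastI[of _ k0]) (use k0 in simp)
  have kmin: "\<not> (c (int j) = 0 \<and> c (int j + 1) = 0)" if "j < k" for j
    using that not_less_Least unfolding k_def by blast
  have "emb (sw z) \<in> wrect (revw c)" using wrect_flip[OF z] by (simp add: flip_emb)
  then obtain l :: nat where l: "revw c (int l) = 0" "revw c (int l + 1) = 0"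
    using wrect_emb_00[OF golden_revw[OF c]] by blast
  have X: "j \<le> k \<Longrightarrow> (f ^^ j) p \<notin> range emb \<and> (f ^^ j) p \<in> wrect (shw (int j) c)" for j
  proof (induction j)
    case (Suc j)
    let ?q = "(f ^^ j) p"
    have q: "?q \<notin> range emb" "?q \<in> wrect (shw (int j) c)" using Suc.IH Suc.prems Suc_leD by blast+
    \<comment> \<open>Before the first 00 every 0 is followed by 1, which requires an abscissa of at
      least \<open>A + 1\<close>.\<close>
    have "?q \<noteq> (Some A, None)"
    proof
      assume eq: "?q = (Some A, None)"
      have "c (int j) \<noteq> 1" using wrect_rect[OF q(2)] A unfolding eq by (auto simp: rect_def arc_below_def)
      then have c0: "c (int j) = 0" using golden_cases[OF c] by blast
      then have "c (int j + 1) = 1" using kmin[of j] Suc golden_cases[OF c, of "int j + 1"] by auto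
      then have "fst ?q \<in> arc_above (A + 1)" using c0 by (intro wrect_01[OF q(2)]) (auto simp: add.commute)
      then show False unfolding eq by (auto simp: arc_above_def)
    qed
    moreover have "?q \<noteq> (Some 1, Some 0)" using q(1) by (auto simp: emb_Pair)
    ultimately have "?q \<notin> Ind" by (simp add: indet_def)
    from wrect_f[OF q(2) this] have "f ?q \<in> wrect (shw (int (Suc j)) c)" by (simp add: add.commute)
    moreover have "f ?q \<notin> range emb" using q(1) by (cases ?q rule: pt_cases) (auto simp: f_inf)
    ultimately show ?case by (simp add: shw_def)
  qed (use p inf in simp)
  let ?q = "(f ^^ k) p"
  have q: "?q \<notin> range emb" "?q \<in> wrect (shw (int k) c)" using X by auto
  obtain x where x: "fst ?q = Some x" "1 \<le> x" "x \<le> A"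
    using wrect_00[OF q(2)] k by (auto simp: add.commute)
  then have "?q = (Some x, None)" using q(1) by (cases ?q rule: pt_cases) auto
  then have "(None, Some (- x)) \<in> wrect (revw (shw (int k) c))" using wrect_flip[OF q(2)] by simp
  from wrect_inf_forward[OF this _ golden_revw[OF golden_shw[OF c]], of "int k + int l"] x(2) l
  show False by (auto simp: algebra_simps)
qed

end

subsection \<open>Realising finite words\<close>

lemma continuous_on_fst_real: "continuous_on T (fst :: real \<times> real \<Rightarrow> real)"
  by (intro continuous_on_fst continuous_on_id)

text \<open>Take for \<open>v\<close> the first time at which \<open>h\<close> equals
  \<open>d\<close>, and for \<open>u\<close> the last time before \<open>v\<close> at which
  \<open>h\<close> equals \<open>c\<close>.\<close>

lemma subinterval_IVT:
  fixes h :: "real \<Rightarrow> real"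
  assumes h: "continuous_on {0..1} h" and le: "h 0 \<le> c" "d \<le> h 1" "c \<le> d"
  obtains u v where "0 \<le> u" "u \<le> v" "v \<le> 1" "h u = c" "h v = d" "\<And>t. u \<le> t \<Longrightarrow> t \<le> v \<Longrightarrow> c \<le> h t \<and> h t \<le> d"
proof -
  define T where "T = {t \<in> {0..1}. h t = d}"
  have "closed T" unfolding T_def by (intro continuous_closed_preimage_constant h) auto
  then have "compact T" by (metis (no_types, lifting) T_def bounded_closed_interval bounded_subset compact_eq_bounded_closed mem_Collect_eq subsetI)
  moreover have "T \<noteq> {}" using IVT'[of h 0 d 1] h le by (auto simp: T_def)
  ultimately obtain v where v: "v \<in> T" "\<And>t. t \<in> T \<Longrightarrow> v \<le> t" using compact_attains_inf by metis
  have v01: "0 \<le> v" "v \<le> 1" "h v = d" using v(1) by (auto simp: T_def)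
  have hd: "h t \<le> d" if "0 \<le> t" "t \<le> v" for t
  proof (rule ccontr)
    assume *: "\<not> h t \<le> d"
    have "continuous_on {0..t} h" using h that v01 by (auto intro: continuous_on_subset)
    then have "\<exists>s\<ge>0. s \<le> t \<and> h s = d" using le * that by (intro IVT') auto
    then obtain s where "0 \<le> s" "s \<le> t" "h s = d" by blast
    moreover have "s \<noteq> t" using * \<open>h s = d\<close> by auto
    ultimately show False using v(2)[of s] that v01 by (auto simp: T_def)
  qed
  define R where "R = {t \<in> {0..v}. h t = c}"
  have hv: "continuous_on {0..v} h" using h v01 by (auto intro: continuous_on_subset)
  have "closed R" unfolding R_def by (intro continuous_closed_preimage_constant hv) auto
  then have "compact R" by (metis (no_types, lifting) R_def bounded_closed_interval bounded_subset compact_eq_bounded_closed mem_Collect_eq subsetI)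
  moreover have "R \<noteq> {}" using IVT'[of h 0 c v] hv le v01 by (auto simp: R_def)
  ultimately obtain u where u: "u \<in> R" "\<And>t. t \<in> R \<Longrightarrow> t \<le> u" using compact_attains_sup by metis
  have u0: "0 \<le> u" "u \<le> v" "h u = c" using u(1) by (auto simp: R_def)
  have hc: "c \<le> h t" if "u \<le> t" "t \<le> v" for t
  proof (rule ccontr)
    assume *: "\<not> c \<le> h t"
    have "continuous_on {t..v} h" using h that u0 v01 by (auto intro: continuous_on_subset)
    then have "\<exists>s\<ge>t. s \<le> v \<and> h s = c" using le * that v01 by (intro IVT') auto
    then obtain s where "t \<le> s" "s \<le> v" "h s = c" by blast
    moreover have "s \<noteq> t" using * \<open>h s = c\<close> by auto
    ultimately show False using u(2)[of s] that u0 by (auto simp: R_def)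
  qed
  show ?thesis using that[of u v] u0 v01 hd hc by auto
qed

lemma subpath_IVT:
  fixes g :: "real \<Rightarrow> 'a::real_normed_vector" and h :: "'a \<Rightarrow> real"
  assumes g: "path g" "continuous_on (path_image g) h" and le: "h (g 0) \<le> c" "d \<le> h (g 1)" "c \<le> d"
  obtains k where "path k" "path_image k \<subseteq> path_image g" "h (k 0) = c" "h (k 1) = d"
     "\<And>p. p \<in> path_image k \<Longrightarrow> c \<le> h p \<and> h p \<le> d"
proof -
  have "continuous_on {0..1} (\<lambda>t. h (g t))"
    using g unfolding path_def path_image_def by (intro continuous_on_compose2[of _ h _ g]) auto
  then obtain u v where uv: "0 \<le> u" "u \<le> v" "v \<le> 1" "h (g u) = c" "h (g v) = d"
      "\<And>t. u \<le> t \<Longrightarrow> t \<le> v \<Longrightarrow> c \<le> h (g t) \<and> h (g t) \<le> d"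
    using le by (rule subinterval_IVT) auto
  have "path_image (subpath u v g) = g ` {u..v}" using uv by (simp add: path_image_subpath)
  moreover have "subpath u v g 0 = g u" "subpath u v g 1 = g v" by (simp_all add: subpath_def)
  ultimately show ?thesis using uv g
    by (intro that[of "subpath u v g"]) (auto simp: path_image_def)
qed

context golden begin

lemma continuous_on_F: "(\<And>z. z \<in> T \<Longrightarrow> fst z \<noteq> 1) \<Longrightarrow> continuous_on T F"
  unfolding F_def by (intro continuous_intros) auto

lemma F_Suc: "(F ^^ Suc i) z = (F ^^ i) (F z)"
  by (simp add: funpow_Suc_comm)

text \<open>The image of a path crossing a rectangle contains paths that cross every admissible successor.\<close>

lemma itinerary_on_path:
  assumes "\<And>i. d i = 0 \<or> d i = 1" "\<And>i. \<not> (d i = 1 \<and> d (Suc i) = 1)"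
  shows "\<exists>c M. (if d 0 = 0 then 1 else 0) < c \<and> c < M \<and>
    (\<forall>g. path g \<longrightarrow> path_image g \<subseteq> G (d 0) \<longrightarrow> (if d 0 = 0 then fst else snd) (g 0) \<le> c \<longrightarrow>
       M \<le> (if d 0 = 0 then fst else snd) (g 1) \<longrightarrow>
       (\<exists>z\<in>path_image g. \<forall>i\<le>n. (F ^^ i) z \<in> G (d i)))"
  using assms
proof (induction n arbitrary: d)
  case 0
  have "\<exists>z\<in>path_image g. \<forall>i\<le>0. (F ^^ i) z \<in> G (d i)" if "path_image g \<subseteq> G (d 0)" for g :: "real \<Rightarrow> _"
    using that by (intro bexI[of _ "g 0"]) (auto simp: path_image_def)
  then show ?case by (intro exI[of _ 2] exI[of _ 3]) auto
next
  case (Suc n)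
  let ?d = "\<lambda>i. d (Suc i)"
  obtain c' M' where cM: "(if d 1 = 0 then 1 else 0) < c'" "c' < M'"
    and IH: "\<And>g. path g \<Longrightarrow> path_image g \<subseteq> G (d 1) \<Longrightarrow> (if d 1 = 0 then fst else snd) (g 0) \<le> c' \<Longrightarrow>
       M' \<le> (if d 1 = 0 then fst else snd) (g 1) \<Longrightarrow>
       (\<exists>z\<in>path_image g. \<forall>i\<le>n. (F ^^ i) z \<in> G (d (Suc i)))"
    using Suc.IH[of ?d] Suc.prems by auto
  have fin: "\<exists>z\<in>path_image g. \<forall>i\<le>Suc n. (F ^^ i) z \<in> G (d i)"
    if k: "path k" "path_image k \<subseteq> F ` path_image g" "path_image k \<subseteq> G (d 1)"
       "(if d 1 = 0 then fst else snd) (k 0) \<le> c'" "M' \<le> (if d 1 = 0 then fst else snd) (k 1)"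
     and g: "path_image g \<subseteq> G (d 0)" for k g
  proof -
    obtain z where z: "z \<in> path_image k" "\<forall>i\<le>n. (F ^^ i) z \<in> G (d (Suc i))" using IH k by blast
    then obtain w where w: "w \<in> path_image g" "z = F w" using k(2) by blast
    have "(F ^^ i) w \<in> G (d i)" if "i \<le> Suc n" for i
      using that z(2) w g by (cases i) (auto simp: F_Suc simp del: funpow.simps(2))
    then show ?thesis using w by blast
  qed
  have d: "d 0 = 0 \<and> d 1 = 0 \<or> d 0 = 0 \<and> d 1 = 1 \<or> d 0 = 1 \<and> d 1 = 0"
    using Suc.prems(1)[of 0] Suc.prems(1)[of 1] Suc.prems(2)[of 0] by auto
  have F1: "fst (F z) = snd z * ((fst z - A) / (fst z - 1))" "snd (F z) = fst z - (A + 1)" for z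
    by (simp_all add: F_def)
  from d show ?case
  proof (elim disjE)
    assume d: "d 0 = 0 \<and> d 1 = 0"
    have M': "1 < c'" "0 < M'" using cM d by auto
    \<comment> \<open>This is the solution of \<open>(A - c) / (c - 1) = M'\<close>. As
      \<open>y <= - 1\<close>, the points with abscissa \<open>c\<close> are sent to abscissas of at
      least \<open>M'\<close>, while those with abscissa \<open>A\<close> are sent to 0; the image
      therefore crosses backwards.\<close>
    define c where "c = 1 + (A - 1) / (M' + 1)"
    have c1: "(c - 1) * (M' + 1) = A - 1" using M' by (simp add: c_def)
    then have c2: "A - c = M' * (c - 1)" by (simp add: algebra_simps)
    have c: "1 < c" "c < A"
    proof -
      show 1: "1 < c" using A M' by (simp add: c_def)
      then have "0 < M' * (c - 1)" using M' by simp
      then show "c < A" using c2 by linarith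
    qed
    show ?case
    proof (rule exI[of _ c], rule exI[of _ A], intro conjI allI impI)
      fix g assume g: "path g" "path_image g \<subseteq> G (d 0)" "(if d 0 = 0 then fst else snd) (g 0) \<le> c"
        "A \<le> (if d 0 = 0 then fst else snd) (g 1)"
      obtain k where k: "path k" "path_image k \<subseteq> path_image g" "fst (k 0) = c" "fst (k 1) = A"
         "\<And>p. p \<in> path_image k \<Longrightarrow> c \<le> fst p \<and> fst p \<le> A"
        by (rule subpath_IVT[OF g(1) continuous_on_fst_real, of c A]) (use g d c in auto)
      have kG: "path_image k \<subseteq> G (d 0)" using k(2) g(2) by blast
      have "path (F \<circ> reversepath k)" using k c
        by (intro path_continuous_image continuous_on_F) fastforce+
      moreover have "fst ((F \<circ> reversepath k) 0) \<le> c'" using k M' by (simp add: reversepath_def F1)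
      moreover have "M' \<le> fst ((F \<circ> reversepath k) 1)"
      proof -
        have "k 0 \<in> G (d 0)" using kG by (auto simp: path_image_def)
        then have "snd (k 0) \<le> - 1" using d by (auto simp: G_def)
        then have "- snd (k 0) * M' \<ge> 1 * M'" using M' by (intro mult_right_mono) auto
        moreover have "(c - A) / (c - 1) = - M'" using c c2 by (simp add: field_simps)
        ultimately show ?thesis using k by (simp add: reversepath_def F1)
      qed
      moreover have "c' \<le> M'" using cM by simp
      ultimately obtain l where l: "path l" "path_image l \<subseteq> path_image (F \<circ> reversepath k)"
          "fst (l 0) = c'" "fst (l 1) = M'" "\<And>p. p \<in> path_image l \<Longrightarrow> c' \<le> fst p \<and> fst p \<le> M'"
        by (rule subpath_IVT[OF _ continuous_on_fst_real]) (rule that)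
      have lF: "path_image l \<subseteq> F ` path_image k" using l(2) by (simp add: path_image_compose)
      show "\<exists>z\<in>path_image g. \<forall>i\<le>Suc n. (F ^^ i) z \<in> G (d i)"
      proof (rule fin[OF l(1) _ _ _ _ g(2)])
        show "path_image l \<subseteq> G (d 1)"
        proof
          fix p assume p: "p \<in> path_image l"
          then obtain z where z: "z \<in> path_image k" "p = F z" using lF by blast
          have "1 < fst p" using l(5)[OF p] M' by linarith
          then have "fst z \<noteq> A" using z by (auto simp: F1)
          then have "snd p < - 1" using k(5)[OF z(1)] z(2) by (simp add: F1)
          then show "p \<in> G (d 1)" using d \<open>1 < fst p\<close> by (simp add: G_def)
        qed
      next
        show "path_image l \<subseteq> F ` path_image g" using lF k(2) by blast
        show "(if d 1 = 0 then fst else snd) (l 0) \<le> c'" "M' \<le> (if d 1 = 0 then fst else snd) (l 1)"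
          using l d by simp_all
      qed
    qed (use d c in auto)
  next
    assume d: "d 0 = 0 \<and> d 1 = 1"
    have c': "0 < c'" using cM d by auto
    \<comment> \<open>The ordinate of the image is \<open>x - (A + 1)\<close>, so the thresholds for
      the next rectangle are shifted by \<open>A + 1\<close>.\<close>
    show ?case
    proof (rule exI[of _ "A + 1"], rule exI[of _ "A + 1 + M'"], intro conjI allI impI)
      fix g assume g: "path g" "path_image g \<subseteq> G (d 0)" "(if d 0 = 0 then fst else snd) (g 0) \<le> A + 1"
        "A + 1 + M' \<le> (if d 0 = 0 then fst else snd) (g 1)"
      obtain k where k: "path k" "path_image k \<subseteq> path_image g" "fst (k 0) = A + 1 + c'" "fst (k 1) = A + 1 + M'"
         "\<And>p. p \<in> path_image k \<Longrightarrow> A + 1 + c' \<le> fst p \<and> fst p \<le> A + 1 + M'"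
        by (rule subpath_IVT[OF g(1) continuous_on_fst_real, of "A + 1 + c'" "A + 1 + M'"]) (use g d c' cM in auto)
      have kG: "path_image k \<subseteq> G (d 0)" using k(2) g(2) by blast
      have "path (F \<circ> k)" using k c' A by (intro path_continuous_image continuous_on_F) fastforce+
      show "\<exists>z\<in>path_image g. \<forall>i\<le>Suc n. (F ^^ i) z \<in> G (d i)"
      proof (rule fin[OF \<open>path (F \<circ> k)\<close> _ _ _ _ g(2)])
        show "path_image (F \<circ> k) \<subseteq> G (d 1)"
        proof
          fix p assume p: "p \<in> path_image (F \<circ> k)"
          then obtain z where z: "z \<in> path_image k" "p = F z" by (auto simp: path_image_compose)
          have "A + 1 < fst z" "snd z < 0" using k(5)[OF z(1)] c' z(1) kG d by (auto simp: G_def)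
          then show "p \<in> G (d 1)" using F_F(1,2)[of z] z d by (simp add: G_def)
        qed
      qed (use k d in \<open>auto simp: path_image_compose F1\<close>)
    qed (use d A cM c' in auto)
  next
    assume d: "d 0 = 1 \<and> d 1 = 0"
    have c': "1 < c'" using cM d by auto
    \<comment> \<open>The abscissa of the image is \<open>y\<close> times a factor between 1 and
      \<open>A\<close>; hence the lower threshold is divided by \<open>A\<close> and the upper one
      kept.\<close>
    show ?case
    proof (rule exI[of _ "c' / A"], rule exI[of _ M'], intro conjI allI impI)
      have "c' / A < c' / 1" using A c' by (intro divide_strict_left_mono) auto
      then show "c' / A < M'" using cM by simp
      show "(if d 0 = 0 then 1 else 0) < c' / A" using A c' d by simp
      fix g assume g: "path g" "path_image g \<subseteq> G (d 0)" "(if d 0 = 0 then fst else snd) (g 0) \<le> c' / A"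
        "M' \<le> (if d 0 = 0 then fst else snd) (g 1)"
      have gG: "fst z < 0" "0 < snd z" if "z \<in> path_image g" for z using that g(2) d by (auto simp: G_def)
      have gs: "1 \<le> (fst z - A) / (fst z - 1)" "(fst z - A) / (fst z - 1) \<le> A" if "z \<in> path_image g" for z
      proof -
        have "fst z * 1 \<ge> fst z * A" using gG(1)[OF that] A by (intro mult_left_mono_neg) auto
        then show "1 \<le> (fst z - A) / (fst z - 1)" "(fst z - A) / (fst z - 1) \<le> A"
          using gG(1)[OF that] A by (auto simp: divide_simps algebra_simps)
      qed
      have g01: "g 0 \<in> path_image g" "g 1 \<in> path_image g" by (auto simp: path_image_def)
      have "path (F \<circ> g)" using g gG by (intro path_continuous_image continuous_on_F) fastforce+
      moreover have "fst ((F \<circ> g) 0) \<le> c'"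
      proof -
        have "fst (F (g 0)) \<le> snd (g 0) * A" unfolding F1
          using gs[OF g01(1)] gG[OF g01(1)] by (intro mult_left_mono) auto
        also have "\<dots> \<le> c' / A * A" using g(3) d A by (intro mult_right_mono) auto
        finally show ?thesis using A by simp
      qed
      moreover have "M' \<le> fst ((F \<circ> g) 1)"
      proof -
        have "snd (g 1) * 1 \<le> fst (F (g 1))" unfolding F1
          using gs[OF g01(2)] gG[OF g01(2)] by (intro mult_left_mono) auto
        then show ?thesis using g(4) d by simp
      qed
      moreover have "c' \<le> M'" using cM by simp
      ultimately obtain l where l: "path l" "path_image l \<subseteq> path_image (F \<circ> g)"
          "fst (l 0) = c'" "fst (l 1) = M'" "\<And>p. p \<in> path_image l \<Longrightarrow> c' \<le> fst p \<and> fst p \<le> M'"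
        by (rule subpath_IVT[OF _ continuous_on_fst_real]) (rule that)
      have lF: "path_image l \<subseteq> F ` path_image g" using l(2) by (simp add: path_image_compose)
      show "\<exists>z\<in>path_image g. \<forall>i\<le>Suc n. (F ^^ i) z \<in> G (d i)"
      proof (rule fin[OF l(1) lF _ _ _ g(2)])
        show "path_image l \<subseteq> G (d 1)"
        proof
          fix p assume p: "p \<in> path_image l"
          then obtain z where z: "z \<in> path_image g" "p = F z" using lF by blast
          have "1 < fst p" using l(5)[OF p] c' by linarith
          moreover have "snd p < - 1" using gG[OF z(1)] z(2) A by (simp add: F1)
          ultimately show "p \<in> G (d 1)" using d by (simp add: G_def)
        qed
      qed (use l d in auto)
    qed
  qed
qed

lemma itinerary_exists:
  assumes "\<And>i. d i = 0 \<or> d i = 1" "\<And>i. \<not> (d i = 1 \<and> d (Suc i) = 1)"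
  obtains z where "\<And>i. i \<le> n \<Longrightarrow> (F ^^ i) z \<in> G (d i)"
proof -
  obtain c M where cM: "(if d 0 = 0 then 1 else 0) < c" "c < M"
    and H: "\<And>g. path g \<Longrightarrow> path_image g \<subseteq> G (d 0) \<Longrightarrow> (if d 0 = 0 then fst else snd) (g 0) \<le> c \<Longrightarrow>
       M \<le> (if d 0 = 0 then fst else snd) (g 1) \<Longrightarrow>
       (\<exists>z\<in>path_image g. \<forall>i\<le>n. (F ^^ i) z \<in> G (d i))"
    using itinerary_on_path[of d n] assms by auto
  define a b where "a = (if d 0 = 0 then (c, - 2) else (- 1, c))" and "b = (if d 0 = 0 then (M, - 2) else (- 1, M))"
  have "convex (G (d 0))"
  proof -
    have "G 0 = {1<..} \<times> {..< - 1}" "s \<noteq> 0 \<Longrightarrow> G s = {..<0} \<times> {0<..}" for s by (auto simp: G_def)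
    then show ?thesis by (cases "d 0 = 0") (auto intro: convex_Times)
  qed
  moreover have "a \<in> G (d 0)" "b \<in> G (d 0)" using cM by (auto simp: a_def b_def G_def)
  ultimately have "closed_segment a b \<subseteq> G (d 0)" by (simp add: closed_segment_subset)
  moreover have "linepath a b 0 = a" "linepath a b 1 = b" by (simp_all add: linepath_def)
  ultimately have "\<exists>z\<in>path_image (linepath a b). \<forall>i\<le>n. (F ^^ i) z \<in> G (d i)"
    by (intro H) (simp_all add: a_def b_def)
  then show ?thesis using that by blast
qed

section \<open>Recurrence of the finite points of \<open>Omega\<close>\<close>

lemma f_iter_emb:
  assumes "\<And>i. i < n \<Longrightarrow> fst ((F ^^ i) z) \<noteq> 1"
  shows "(f ^^ n) (emb z) = emb ((F ^^ n) z)"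
  using assms by (induction n) (auto simp: f_emb)

lemma G_fst: "z \<in> G s \<Longrightarrow> fst z \<noteq> 1"
  by (auto simp: G_def split: if_splits)

text \<open>The parts of the closed blocks outside \<open>U\<close> decrease to the empty set, so by
  compactness one of them is already empty.\<close>

lemma closure_SB_in_nhd:
  assumes c: "wrect c = {p}" and U: "openin torus U" "p \<in> U"
  obtains n where "torus closure_of SB c n n \<subseteq> U"
proof -
  have "\<exists>n. torus closure_of SB c n n - U = {}"
  proof (rule ccontr)
    assume no: "\<nexists>n. torus closure_of SB c n n - U = {}"
    have "(\<Inter>n. torus closure_of SB c n n - U) \<noteq> {}"
    proof (rule compact_space_imp_nest[OF compact_torus])
      show "closedin torus (torus closure_of SB c n n - U)" for n
        by (intro closedin_diff U) simp
      show "decseq (\<lambda>n. torus closure_of SB c n n - U)"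
        by (intro decseq_SucI Diff_mono closure_of_mono SB_antimono) auto
    qed (use no in auto)
    then obtain q where q: "q \<notin> U" "\<And>n. q \<in> torus closure_of SB c n n" by blast
    have "q \<in> torus closure_of SB c n m" for n m
      using q(2)[of "max n m"] closure_of_mono[OF SB_antimono[of n "max n m" m "max n m" c]] by auto
    then have "q \<in> wrect c" by (simp add: wrect_iff)
    then show False using c q(1) U by auto
  qed
  then show ?thesis using that by blast
qed

lemma SB_from_orbit:
  assumes G: "\<And>i. i \<le> n + m \<Longrightarrow> (f ^^ i) p \<in> emb ` G (c (int i - int n))"
  shows "(f ^^ n) p \<in> SB c n m"
  unfolding SB_def
proof (intro CollectI ballI)
  fix k assume k: "k \<in> {- int n..int m}"
  show "f_pow k ((f ^^ n) p) \<in> emb ` G (c k)"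
  proof (cases k rule: int_cases2)
    case (nonneg j)
    then show ?thesis using G[of "j + n"] k by (simp add: funpow_funpow)
  next
    case (nonpos j)
    then have j: "j \<le> n" using k by auto
    have "(f ^^ j) ((f ^^ (n - j)) p) \<in> emb ` G (c 0)" using G[of n] j by (simp add: funpow_funpow)
    then have "(fi ^^ j) ((f ^^ j) ((f ^^ (n - j)) p)) = (f ^^ (n - j)) p" by (rule fi_iter_f_iter_G)
    then have "(fi ^^ j) ((f ^^ n) p) = (f ^^ (n - j)) p" using j by (simp add: funpow_funpow)
    then show ?thesis using G[of "n - j"] nonpos j by (simp add: of_nat_diff)
  qed
qed

lemma Omega_finite_not_wandering:
  assumes c: "c \<in> golden_words" and z: "emb z \<in> wrect c"
  shows "\<not> wandering (- A) (emb z)"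
proof
  assume "wandering (- A) (emb z)"
  then obtain U where U: "openin torus U" "emb z \<in> U" "\<And>n. n \<noteq> 0 \<Longrightarrow> U \<inter> f_pow n ` (U - I n) = {}"
    unfolding wandering_def by blast
  have "wrect c = {emb z}"
    using wrect_emb_not_inf[OF c z] wrect_emb_unique[OF c z] z by blast
  then obtain n where n: "torus closure_of SB c n n \<subseteq> U" using closure_SB_in_nhd U by metis
  have SBU: "SB c n n \<subseteq> U" using n closure_of_subset[of "SB c n n" torus] by (auto simp: topspace_torus)
  \<comment> \<open>Two copies of the block of length \<open>2 n + 1\<close>, separated by one 0,
    which is admissible next to either symbol. The second copy starts at \<open>2 n + 2\<close>, and
    its centre is at \<open>3 n + 2\<close>.\<close>
  define d where "d i = (if i \<le> 2 * n then c (int i - int n) else if i = 2 * n + 1 then 0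
     else c (int i - int (3 * n + 2)))" for i
  have g: "c j = 0 \<or> c j = 1" "\<not> (c j = 1 \<and> c (j + 1) = 1)" for j
    using c unfolding golden_words_def by auto
  have d1: "d i = 0 \<or> d i = 1" for i using g(1) by (auto simp: d_def)
  have d2: "\<not> (d i = 1 \<and> d (Suc i) = 1)" for i
  proof (cases "i < 2 * n \<or> 2 * n + 1 < i")
    case True
    have e: "int (Suc i) - k = int i - k + 1" for k by simp
    from True show ?thesis
    proof
      assume "i < 2 * n"
      then have "d i = c (int i - int n)" "d (Suc i) = c (int i - int n + 1)" unfolding e[symmetric] by (auto simp: d_def)
      then show ?thesis using g(2) by metis
    next
      assume "2 * n + 1 < i"
      then have "d i = c (int i - int (3 * n + 2))" "d (Suc i) = c (int i - int (3 * n + 2) + 1)"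
        unfolding e[symmetric] by (auto simp: d_def)
      then show ?thesis using g(2) by metis
    qed
  next
    case False
    then have "i = 2 * n \<or> i = 2 * n + 1" by auto
    then show ?thesis by (auto simp: d_def)
  qed
  obtain w where w: "\<And>i. i \<le> 4 * n + 2 \<Longrightarrow> (F ^^ i) w \<in> G (d i)"
    using itinerary_exists[of d "4 * n + 2"] d1 d2 by metis
  have fw: "(f ^^ i) (emb w) \<in> emb ` G (d i)" if "i \<le> 4 * n + 2" for i
  proof -
    have "fst ((F ^^ j) w) \<noteq> 1" if "j < i" for j using w[of j] G_fst \<open>i \<le> 4 * n + 2\<close> that by auto
    then show ?thesis using f_iter_emb[of i w] w[OF that] by simp
  qed
  have "(f ^^ n) (emb w) \<in> SB c n n"
  proof (rule SB_from_orbit)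
    fix i assume "i \<le> n + n"
    then show "(f ^^ i) (emb w) \<in> emb ` G (c (int i - int n))" using fw[of i] by (simp add: d_def)
  qed
  moreover have "(f ^^ n) ((f ^^ (2 * n + 2)) (emb w)) \<in> SB c n n"
  proof (rule SB_from_orbit)
    fix i assume "i \<le> n + n"
    then show "(f ^^ i) ((f ^^ (2 * n + 2)) (emb w)) \<in> emb ` G (c (int i - int n))"
      using fw[of "i + (2 * n + 2)"] by (simp add: d_def funpow_funpow algebra_simps del: funpow.simps)
  qed
  moreover have "(f ^^ n) ((f ^^ (2 * n + 2)) (emb w)) = f_pow (int (2 * n + 2)) ((f ^^ n) (emb w))"
    unfolding f_pow_of_nat funpow_funpow by (simp only: add.commute)
  moreover have "(f ^^ n) (emb w) \<notin> I (int (2 * n + 2))"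
  proof -
    have "(f ^^ n) (emb w) \<in> emb ` G (d n)" using fw[of n] by simp
    then show ?thesis using G_not_Q1 I_Q1 by blast
  qed
  ultimately show False using U(3)[of "int (2 * n + 2)"] SBU by fastforce
qed

end

subsection \<open>The lines at infinity\<close>

lemma infinity_fst_nhds:
  assumes "openin torus U" "(None, Some y) \<in> U"
  obtains M e where "0 < e" "\<And>x. \<bar>x\<bar> > M \<Longrightarrow> emb (x, y) \<in> U" "\<And>y'. \<bar>y' - y\<bar> < e \<Longrightarrow> (None, Some y') \<in> U"
proof -
  obtain S T where ST: "openin circle S" "openin circle T" "None \<in> S" "Some y \<in> T" "S \<times> T \<subseteq> U"
    using assms unfolding torus_def openin_prod_topology_alt by metis
  obtain M where "\<And>x. \<bar>x\<bar> > M \<Longrightarrow> Some x \<in> S" using ST by (auto simp: openin_circle_iff)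
  moreover obtain e where "0 < e" "\<And>y'. \<bar>y' - y\<bar> < e \<Longrightarrow> Some y' \<in> T"
  proof -
    have "open {y. Some y \<in> T}" using ST(2) by (simp add: openin_circle_iff)
    then obtain e where "0 < e" "\<And>y'. dist y' y < e \<Longrightarrow> y' \<in> {y. Some y \<in> T}"
      using ST(4) unfolding open_dist by blast
    then show ?thesis using that by (simp add: dist_real_def)
  qed
  ultimately show ?thesis using ST by (intro that[of e M]) (auto simp: emb_def)
qed

lemma wandering_nhd:
  assumes "wandering a p"
  obtains U where "openin torus U" "p \<in> U" "\<And>q. q \<in> U \<Longrightarrow> wandering a q"
  using assms unfolding wandering_def by blast

context golden begin

lemma F_sw_F:
  assumes z: "fst z \<noteq> 1" "fst z \<noteq> A"
  shows "F (sw (F z)) = sw z"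
proof -
  obtain x y where xy: "z = (x, y)" by (cases z)
  have "- (x - (A + 1)) - A = - (x - 1)" "- (x - (A + 1)) - 1 = - (x - A)" by simp_all
  then have e: "(- (x - (A + 1)) - A) / (- (x - (A + 1)) - 1) = (x - 1) / (x - A)" by (simp only: minus_divide_divide)
  have "(x - A) / (x - 1) * ((x - 1) / (x - A)) = 1" using z xy by simp
  then have "- (y * ((x - A) / (x - 1))) * ((x - 1) / (x - A)) = - y"
    by (metis minus_mult_left mult.assoc mult.right_neutral)
  then show ?thesis unfolding xy F_def sw_def fst_conv snd_conv e by simp
qed

text \<open>Two steps lower the abscissa by at most \<open>A + 1\<close>, because the factor
  \<open>(v' - 1) / (v' - A)\<close> is at least 1. A far starting point therefore makes a long
  passage; the last claim allows running it backwards.\<close>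

lemma F_F_le:
  assumes "A + 1 < fst z" "snd z < 0"
  shows "fst z - (A + 1) \<le> fst (F (F z))" "snd (F (F z)) < - (A + 1)" "F (F (sw (F (F z)))) = sw z"
proof -
  define v' where "v' = A + 1 - snd z * ((fst z - A) / (fst z - 1))"
  have FF: "fst (F z) < 0" "F (F z) = ((fst z - (A + 1)) * ((v' - 1) / (v' - A)), - v')"
    using F_F[OF assms] by (simp_all add: v'_def)
  have v': "A + 1 < v'" using escape_step(1)[of "fst z" "- snd z"] assms by (simp add: v'_def)
  then show "snd (F (F z)) < - (A + 1)" using FF by simp
  have "1 \<le> (v' - 1) / (v' - A)" using v' A by simp
  then have "(fst z - (A + 1)) * 1 \<le> (fst z - (A + 1)) * ((v' - 1) / (v' - A))" using assms by (intro mult_left_mono) auto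
  then show "fst z - (A + 1) \<le> fst (F (F z))" using FF by simp
  have "F (sw (F (F z))) = sw (F z)" using FF A by (intro F_sw_F) auto
  moreover have "F (sw (F z)) = sw z" using assms A by (intro F_sw_F) auto
  ultimately show "F (F (sw (F (F z)))) = sw z" by simp
qed

text \<open>Let \<open>j\<close> be the first number of double steps at which some point of the ray
  has abscissa at most \<open>A + 1\<close>. All earlier stages are continuous on the whole ray. At
  stage \<open>j\<close> the abscissas cover the interval from \<open>A + 1\<close> to
  \<open>A + 1 + x0\<close>, and one more double step sends its ends to 0 and to at least
  \<open>x0\<close>.\<close>

lemma pass_infinity:
  assumes y: "y < 0" and x0: "0 < x0"
  obtains t j where "T \<le> t" "\<And>i. i \<le> j \<Longrightarrow> A + 1 < fst ((F ^^ (2 * i)) (t, y)) \<and> snd ((F ^^ (2 * i)) (t, y)) < 0"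
    "fst ((F ^^ (2 * Suc j)) (t, y)) = x0"
proof -
  define orb where "orb i t = (F ^^ (2 * i)) (t, y)" for i t
  have orb_Suc: "orb (Suc i) t = F (F (orb i t))" for i t by (simp add: orb_def)
  obtain J where "\<And>z. snd z < 0 \<and> fst z - snd z - 1 \<le> T - y - 1 \<Longrightarrow> (\<exists>i<J. fst ((F ^^ (2 * i)) z) \<le> A + 1)"
    using escape_F by blast
  from this[of "(T, y)"] have "\<exists>i. \<exists>t\<ge>T. fst (orb i t) \<le> A + 1" using y by (auto simp: orb_def)
  then obtain j where j: "\<exists>t\<ge>T. fst (orb j t) \<le> A + 1" and jmin: "\<And>i. i < j \<Longrightarrow> \<not> (\<exists>t\<ge>T. fst (orb i t) \<le> A + 1)"
    unfolding exists_least_iff[of "\<lambda>i. \<exists>t\<ge>T. fst (orb i t) \<le> A + 1"] by (elim exE conjE) blast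
  have gt: "A + 1 < fst (orb i t)" if "i < j" "T \<le> t" for i t using jmin[OF that(1)] that(2) by force
  have sn: "snd (orb i t) < 0 \<and> t - real i * (A + 1) \<le> fst (orb i t)" if "i \<le> j" "T \<le> t" for i t
    using that
  proof (induction i)
    case (Suc i)
    then show ?case using F_F_le[of "orb i t"] gt[of i t] A by (auto simp: orb_Suc algebra_simps)
  qed (use y in \<open>auto simp: orb_def\<close>)
  have cF: "continuous_on {z. A + 1 \<le> fst z \<and> snd z < 0} (\<lambda>z. F (F z))"
  proof (rule continuous_on_compose2[of "{z. fst z < 0}" F])
    show "F ` {z. A + 1 \<le> fst z \<and> snd z < 0} \<subseteq> {z. fst z < 0}"
      using A by (auto simp: F_def mult_less_0_iff zero_less_mult_iff divide_simps)
  qed (use A in \<open>auto intro!: continuous_on_F\<close>)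
  have co: "continuous_on {T..} (orb i)" if "i \<le> j" for i
    using that
  proof (induction i)
    case 0 show ?case unfolding orb_def by (auto intro!: continuous_intros)
  next
    case (Suc i)
    have "continuous_on {T..} (\<lambda>t. F (F (orb i t)))"
      by (rule continuous_on_compose2[OF cF]) (use Suc gt[of i] sn[of i] in \<open>auto intro: less_imp_le\<close>)
    then show ?case by (simp add: orb_Suc[abs_def])
  qed
  obtain t1 where t1: "T \<le> t1" "fst (orb j t1) \<le> A + 1" using j by blast
  \<comment> \<open>After \<open>j\<close> double steps at most \<open>j (A + 1)\<close> of the
    abscissa is lost.\<close>
  define t2 where "t2 = max t1 (A + 1 + x0 + real j * (A + 1))"
  have t12: "t1 \<le> t2" "A + 1 + x0 + real j * (A + 1) \<le> t2" by (simp_all add: t2_def)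
  then have t2: "t1 \<le> t2" "A + 1 + x0 \<le> fst (orb j t2)" using sn[of j t2] t1(1) by linarith+
  define l where "l s = t1 + s * (t2 - t1)" for s
  have l: "l 0 = t1" "l 1 = t2" by (simp_all add: l_def)
  have lT: "T \<le> l s" if "0 \<le> s" for s using that t1 t2 by (simp add: l_def add_increasing2)
  have cl: "continuous_on X l" for X unfolding l_def by (intro continuous_intros)
  have col: "continuous_on {0..1} (\<lambda>s. orb j (l s))"
    by (rule continuous_on_compose2[OF co[OF order_refl] cl]) (use lT in auto)
  then have "continuous_on {0..1} (\<lambda>s. fst (orb j (l s)))" by (intro continuous_intros)
  then obtain u v where uv: "0 \<le> u" "u \<le> v" "v \<le> 1" "fst (orb j (l u)) = A + 1" "fst (orb j (l v)) = A + 1 + x0"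
     "\<And>s. u \<le> s \<Longrightarrow> s \<le> v \<Longrightarrow> A + 1 \<le> fst (orb j (l s)) \<and> fst (orb j (l s)) \<le> A + 1 + x0"
    using t1 t2 l x0 by (elim subinterval_IVT[where c = "A + 1" and d = "A + 1 + x0"]) auto
  have "continuous_on {u..v} (\<lambda>s. F (F (orb j (l s))))"
    by (rule continuous_on_compose2[OF cF continuous_on_subset[OF col]])
      (use uv sn lT in \<open>auto\<close>)
  then have "continuous_on {u..v} (\<lambda>s. fst (orb (Suc j) (l s)))" unfolding orb_Suc by (intro continuous_intros)
  moreover have "fst (orb (Suc j) (l u)) \<le> x0" using uv x0 by (simp add: orb_Suc F_def)
  moreover have "x0 \<le> fst (orb (Suc j) (l v))"
    using F_F_le(1)[of "orb j (l v)"] sn[OF order_refl lT[of v]] uv x0 by (simp add: orb_Suc)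
  ultimately have "\<exists>s\<ge>u. s \<le> v \<and> fst (orb (Suc j) (l s)) = x0" using uv by (intro IVT') auto
  then obtain s where s: "u \<le> s" "s \<le> v" "fst (orb (Suc j) (l s)) = x0" by blast
  have Ts: "T \<le> l s" using s uv by (intro lT) auto
  have "fst (orb j (l s)) \<noteq> A + 1" using s x0 by (auto simp: orb_Suc F_def)
  then have "A + 1 < fst (orb j (l s))" using uv(6)[OF s(1,2)] by simp
  then have "A + 1 < fst (orb i (l s)) \<and> snd (orb i (l s)) < 0" if "i \<le> j" for i
    using that gt[of i "l s"] sn[of i "l s"] Ts by (cases "i = j") auto
  then show ?thesis using that[of "l s" j] Ts s unfolding orb_def by blast
qed

text \<open>A moderate final ordinate is impossible after a long passage: the orbit reversed by
  \<open>sw\<close> would start with bounded \<open>x - y - 1\<close>, but its abscissas would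
  exceed \<open>A + 1\<close> longer than \<open>escape_F\<close> permits.\<close>

lemma infinity_return:
  assumes y: "y < 0" and x0: "0 < x0"
  obtains t j where "T \<le> t" "\<And>i. i \<le> j \<Longrightarrow> A + 1 < fst ((F ^^ (2 * i)) (t, y)) \<and> snd ((F ^^ (2 * i)) (t, y)) < 0"
    "fst ((F ^^ (2 * Suc j)) (t, y)) = x0" "snd ((F ^^ (2 * Suc j)) (t, y)) \<le> - R"
proof -
  obtain J where J: "\<And>z. snd z < 0 \<and> fst z - snd z - 1 \<le> R + x0 \<Longrightarrow> (\<exists>i<J. fst ((F ^^ (2 * i)) z) \<le> A + 1)"
    using escape_F by blast
  \<comment> \<open>This lower bound on \<open>t\<close> forces at least \<open>J\<close> double
    steps before the abscissa can be \<open>x0\<close>.\<close>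
  obtain t j where tj: "max T (x0 + real J * (A + 1)) \<le> t"
     "\<And>i. i \<le> j \<Longrightarrow> A + 1 < fst ((F ^^ (2 * i)) (t, y)) \<and> snd ((F ^^ (2 * i)) (t, y)) < 0"
     "fst ((F ^^ (2 * Suc j)) (t, y)) = x0"
    using pass_infinity[OF y x0] by metis
  define orb where "orb i = (F ^^ (2 * i)) (t, y)" for i
  have orb_Suc: "orb (Suc i) = F (F (orb i))" for i by (simp add: orb_def)
  note t = tj[folded orb_def]
  have le: "t - real i * (A + 1) \<le> fst (orb i)" if "i \<le> Suc j" for i
    using that
  proof (induction i)
    case (Suc i)
    then show ?case using F_F_le(1)[of "orb i"] t(2)[of i] by (auto simp: orb_Suc algebra_simps)
  qed (simp add: orb_def)
  have "real J * (A + 1) \<le> real (Suc j) * (A + 1)" using le[of "Suc j"] t(1,3) by simp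
  then have Jj: "J \<le> Suc j" using A by (simp only: mult_le_cancel_right) auto
  have bk: "(F ^^ (2 * i)) (sw (orb (Suc j))) = sw (orb (Suc j - i))" if "i \<le> Suc j" for i
    using that
  proof (induction i)
    case (Suc i)
    then have "Suc j - i = Suc (j - i)" "Suc j - Suc i = j - i" "j - i \<le> j" by auto
    then show ?case using Suc F_F_le(3)[of "orb (j - i)"] t(2)[of "j - i"] by (simp add: orb_Suc)
  qed simp
  have "snd (orb (Suc j)) \<le> - R"
  proof (rule ccontr)
    assume "\<not> snd (orb (Suc j)) \<le> - R"
    then have "\<exists>i<J. fst ((F ^^ (2 * i)) (sw (orb (Suc j)))) \<le> A + 1" using t(3) x0 by (intro J) auto
    then obtain i where i: "i < J" "fst (sw (orb (Suc j - i))) \<le> A + 1" using bk Jj by (metis less_le_trans less_imp_le)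
    then have "Suc j - i = Suc (j - i)" "j - i \<le> j" using Jj by auto
    then show False using i(2) F_F_le(2)[of "orb (j - i)"] t(2)[of "j - i"] by (simp add: orb_Suc)
  qed
  then show ?thesis using that[of t j] tj(1,2) t(3) unfolding orb_def by auto
qed

lemma infinity_not_wandering_generic:
  assumes y: "- (A + 1) < y" "y < 0" "y \<noteq> - A" "y \<noteq> - 1"
  shows "\<not> wandering (- A) (None, Some y)"
proof
  assume "wandering (- A) (None, Some y)"
  then obtain U where U: "openin torus U" "(None, Some y) \<in> U" "\<And>n. n \<noteq> 0 \<Longrightarrow> U \<inter> f_pow n ` (U - I n) = {}"
    unfolding wandering_def by blast
  obtain M where M: "\<And>x. \<bar>x\<bar> > M \<Longrightarrow> emb (x, y) \<in> U" using infinity_fst_nhds[OF U(1,2)] by metis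
  \<comment> \<open>From abscissa \<open>x0\<close> the next ordinate is again \<open>y\<close>. The
    excluded values of \<open>y\<close> correspond to \<open>x0 = A\<close> and
    \<open>x0 = 1\<close>, where the factor \<open>g\<close> would vanish or be undefined.\<close>
  define x0 where "x0 = y + A + 1"
  define g where "g = \<bar>(x0 - A) / (x0 - 1)\<bar>"
  have x0: "0 < x0" "x0 \<noteq> 1" "x0 \<noteq> A" using y by (auto simp: x0_def)
  have g: "0 < g" using x0 by (simp add: g_def)
  obtain t j where t: "\<bar>M\<bar> + 1 \<le> t"
     "\<And>i. i \<le> j \<Longrightarrow> A + 1 < fst ((F ^^ (2 * i)) (t, y)) \<and> snd ((F ^^ (2 * i)) (t, y)) < 0"
     "fst ((F ^^ (2 * Suc j)) (t, y)) = x0" "snd ((F ^^ (2 * Suc j)) (t, y)) \<le> - ((\<bar>M\<bar> + 1) / g)"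
    using infinity_return[OF y(2) x0(1)] by metis
  let ?w = "(F ^^ (2 * Suc j)) (t, y)"
  define n where "n = Suc (2 * Suc j)"
  have ne1: "fst ((F ^^ i) (t, y)) \<noteq> 1" if "i < n" for i
  proof (cases "even i")
    case True
    then obtain k where k: "i = 2 * k" by blast
    show ?thesis
    proof (cases "k \<le> j")
      case True then show ?thesis using t(2)[of k] A k by auto
    next
      case False
      then have "k = Suc j" using that k by (auto simp: n_def)
      then show ?thesis using t(3) x0 k by simp
    qed
  next
    case False
    then obtain k where k: "i = 2 * k + 1" by (elim oddE)
    then have "k \<le> j" using that by (auto simp: n_def)
    then have "fst (F ((F ^^ (2 * k)) (t, y))) < 0" using F_F(1) t(2) by blast
    then show ?thesis using k by simp
  qed
  have "emb (F ?w) \<in> U"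
  proof -
    have Fw: "F ?w = (snd ?w * ((x0 - A) / (x0 - 1)), y)" using t(3) by (simp add: F_def x0_def del: funpow.simps)
    have "\<bar>M\<bar> + 1 = (\<bar>M\<bar> + 1) / g * g" using g by simp
    also have "\<dots> \<le> \<bar>snd ?w\<bar> * g" using t(4) g by (intro mult_right_mono) auto
    also have "\<dots> = \<bar>snd ?w * ((x0 - A) / (x0 - 1))\<bar>" by (simp add: g_def abs_mult)
    finally show ?thesis unfolding Fw by (intro M) linarith
  qed
  moreover have "(f ^^ n) (emb (t, y)) = emb ((F ^^ n) (t, y))" using ne1 by (rule f_iter_emb)
  moreover have "(F ^^ n) (t, y) = F ?w" by (simp add: n_def)
  ultimately have "f_pow (int n) (emb (t, y)) \<in> U" by (simp only: f_pow_of_nat)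
  moreover have "emb (t, y) \<in> U" using t(1) by (intro M) linarith
  moreover have "emb (t, y) \<notin> I (int n)" using I_finite[of "(t, y)" n] y by auto
  moreover have "int n \<noteq> 0" by (simp add: n_def)
  ultimately show False using U(3) by blast
qed

text \<open>Returns of \<open>z\<close> are carried by \<open>f\<close> to returns of
  \<open>f z\<close>. The exceptional sets of \<open>z\<close> and \<open>f z\<close> differ by one
  time step, and removing the points of \<open>Ind\<close> and the preimages of
  \<open>Ind_inv\<close> from the neighbourhood absorbs this difference.\<close>

lemma wandering_pullback:
  assumes p: "p \<notin> Ind" "f p \<notin> Ind_inv" and w: "wandering (- A) (f p)"
  shows "wandering (- A) p"
proof -
  obtain U where U: "openin torus U" "f p \<in> U" "\<And>n. n \<noteq> 0 \<Longrightarrow> U \<inter> f_pow n ` (U - I n) = {}"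
    using w unfolding wandering_def by blast
  define W where "W = {q. q \<notin> Ind \<and> f q \<in> U - Ind_inv}"
  have W: "openin torus W" "p \<in> W" unfolding W_def using openin_f[OF openin_minus_finite[OF U(1) finite_Ind(2)]] U(2) p by auto
  have fif: "fi (f q) = q" if "q \<in> W" for q using that by (intro fi_f) (auto simp: W_def)
  have "(f ^^ n) z \<notin> W" if n: "0 < n" and z: "z \<in> W" "z \<notin> I (int n)" for n z
  proof
    assume fz: "(f ^^ n) z \<in> W"
    have "f z \<notin> I (int n)"
    proof
      assume "f z \<in> I (int n)"
      then obtain j e where j: "j < n" "e \<in> Ind" "f z = (fi ^^ j) e" by (auto simp: I_of_nat)
      then have zj: "z = (fi ^^ Suc j) e" using fif[OF z(1)] by simp
      show False
      proof (cases "Suc j < n")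
        case True
        then show False using z(2) zj j(2) unfolding I_of_nat by blast
      next
        case False
        \<comment> \<open>In this boundary case the supposed return would land in
          \<open>Ind\<close>, which \<open>W\<close> avoids.\<close>
        then have "n = Suc j" using j by simp
        moreover have "f (fi ((fi ^^ i) e)) = (fi ^^ i) e" for i by (rule f_fi_Q1[OF fi_iter_Ind[OF j(2)]])
        then have "(f ^^ Suc j) ((fi ^^ Suc j) e) = e" using funpow_comm_inverse[of "Suc j" f fi e "Suc j"] by simp
        ultimately have "(f ^^ n) z = e" unfolding zj by simp
        then show False using fz j(2) by (simp add: W_def)
      qed
    qed
    moreover have "f z \<in> U" using z by (simp add: W_def)
    moreover have "f_pow (int n) (f z) \<in> U" using fz by (simp add: W_def funpow_Suc_comm)
    ultimately show False using U(3)[of "int n"] n by (force simp del: f_pow_of_nat)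
  qed
  moreover have "(fi ^^ n) z \<notin> W" if n: "0 < n" and z: "z \<in> W" "z \<notin> I (- int n)" for n z
  proof
    assume fz: "(fi ^^ n) z \<in> W"
    obtain m where m: "n = Suc m" using n by (cases n) auto
    have "f z \<notin> I (- int n)"
    proof
      assume "f z \<in> I (- int n)"
      then obtain j e where j: "j < n" "e \<in> Ind_inv" "f z = (f ^^ j) e" by (auto simp: I_minus_of_nat)
      have fz': "f z \<notin> Ind_inv" using z by (simp add: W_def)
      then obtain i where i: "j = Suc i" using j by (cases j) auto
      then have "f ((f ^^ i) e) = f z" using j by simp
      then have "(f ^^ i) e = z" using fz' fif[OF z(1)] fi_f[of "(f ^^ i) e"] by simp
      then show False using z(2) j i unfolding I_minus_of_nat by auto
    qed
    moreover have "f z \<in> U" using z by (simp add: W_def)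
    moreover have "(fi ^^ n) (f z) = f ((fi ^^ n) z)"
    proof -
      have "(fi ^^ n) (f z) = (fi ^^ m) z" using fif[OF z(1)] by (simp add: m funpow_Suc_comm[symmetric])
      also have "\<dots> = f (fi ((fi ^^ m) z))" using fz by (intro f_fi[symmetric]) (simp add: W_def m)
      finally show ?thesis by (simp add: m)
    qed
    then have "f_pow (- int n) (f z) \<in> U" using fz by (simp add: W_def)
    ultimately show False using U(3)[of "- int n"] n by (force simp del: f_pow_minus_of_nat)
  qed
  ultimately have *: "\<And>n z. 0 < n \<Longrightarrow> z \<in> W \<Longrightarrow> z \<notin> I (int n) \<Longrightarrow> (f ^^ n) z \<notin> W"
     "\<And>n z. 0 < n \<Longrightarrow> z \<in> W \<Longrightarrow> z \<notin> I (- int n) \<Longrightarrow> (fi ^^ n) z \<notin> W" by auto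
  have "W \<inter> f_pow n ` (W - I n) = {}" if "n \<noteq> 0" for n
  proof (cases n rule: int_cases2)
    case (nonneg k) then show ?thesis using *(1)[of k] that by auto
  next
    case (nonpos k) then show ?thesis using *(2)[of k] that by auto
  qed
  then show ?thesis unfolding wandering_def using W by blast
qed

text \<open>Wandering points form an open set, so the two exceptional ordinates and the end
  \<open>- (A + 1)\<close> follow from nearby generic ones. The interval from
  \<open>- (A + 1)\<close> to 0 is then a fundamental domain for the translation that two steps of
  \<open>f\<close> induce.\<close>

lemma infinity_fst_not_wandering_neg:
  assumes y: "y < 0"
  shows "\<not> wandering (- A) (None, Some y)"
proof -
  have base: "\<not> wandering (- A) (None, Some y)" if y: "- (A + 1) \<le> y" "y < 0" for y
  proof
    assume "wandering (- A) (None, Some y)"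
    then obtain U where U: "openin torus U" "(None, Some y) \<in> U" "\<And>q. q \<in> U \<Longrightarrow> wandering (- A) q"
      by (rule wandering_nhd) (rule that)
    obtain e where e: "0 < e" "\<And>y'. \<bar>y' - y\<bar> < e \<Longrightarrow> (None, Some y') \<in> U"
      using infinity_fst_nhds[OF U(1,2)] by metis
    have "infinite {y<..<min (y + e) 0}" using e y by (intro infinite_Ioo) auto
    then have "infinite ({y<..<min (y + e) 0} - {- A, - 1})" by simp
    then obtain y' where "y' \<in> {y<..<min (y + e) 0} - {- A, - 1}" using infinite_imp_nonempty by blast
    then show False using infinity_not_wandering_generic[of y'] U(3) e(2)[of y'] y by auto
  qed
  have step: "\<not> wandering (- A) (None, Some (y - (A + 1)))" if y: "y < 0" "\<not> wandering (- A) (None, Some y)" for y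
  proof -
    have "f (f (None, Some y)) = (None, Some (y - (A + 1)))" by (simp add: f_inf shift_def)
    moreover have "wandering (- A) (f (None, Some y))" if "wandering (- A) (f (f (None, Some y)))"
      using that y A by (intro wandering_pullback[OF _ _ that]) (auto simp: f_inf shift_def indet_def indet_inv_def)
    moreover have "wandering (- A) (None, Some y)" if "wandering (- A) (f (None, Some y))"
      using that y A by (intro wandering_pullback[OF _ _ that]) (auto simp: f_inf shift_def indet_def indet_inv_def)
    ultimately show ?thesis using y by auto
  qed
  have "\<not> wandering (- A) (None, Some (y - real k * (A + 1)))" if y: "- (A + 1) \<le> y" "y < 0" for k y
  proof (induction k)
    case (Suc k)
    have "0 \<le> real k * (A + 1)" using A by simp
    then have "y - real k * (A + 1) < 0" using y by linarith
    from step[OF this Suc] show ?case by (simp add: algebra_simps)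
  qed (use base y in simp)
  moreover define k where "k = nat \<lfloor>- y / (A + 1)\<rfloor>"
  have "0 \<le> - y / (A + 1)" using A y by (intro divide_nonneg_nonneg) auto
  then have "real k \<le> - y / (A + 1)" "- y / (A + 1) < real k + 1" by (auto simp: k_def)
  then have k: "real k * (A + 1) \<le> - y" "- y < (real k + 1) * (A + 1)" using A by (simp_all add: field_simps)
  have "- (A + 1) \<le> y + real k * (A + 1)" "y + real k * (A + 1) \<le> 0" using k by (simp_all add: algebra_simps)
  show ?thesis
  proof (cases "y + real k * (A + 1) = 0")
    case False
    then show ?thesis using calculation[of "y + real k * (A + 1)" k] k by (simp add: algebra_simps)
  next
    case True
    then obtain i where i: "k = Suc i" using y by (cases k) auto
    then have "- (A + 1) - real i * (A + 1) = y" using True by (simp add: algebra_simps)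
    then show ?thesis using calculation[of "- (A + 1)" i] A by simp
  qed
qed

lemma infinity_not_wandering: "p \<notin> range emb \<Longrightarrow> \<not> wandering (- A) p"
proof -
  have 1: "\<not> wandering (- A) (None, Some y)" if "y < 0" for y by (rule infinity_fst_not_wandering_neg[OF that])
  have 2: "\<not> wandering (- A) (Some y, None)" if "y < 0" for y
    using wandering_pullback[of "(None, Some y)"] 1[OF that] by (auto simp: f_inf indet_def indet_inv_def)
  have 3: "\<not> wandering (- A) (Some y, None)" if "0 < y" for y
    using wandering_flip[of "(None, Some (- y))"] 1[of "- y"] that by simp
  have 4: "\<not> wandering (- A) (None, Some y)" if "0 < y" for y
    using wandering_flip[of "(Some (- y), None)"] 2[of "- y"] that by simp
  have 5: "\<not> wandering (- A) (None, Some 0)"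
  proof
    assume "wandering (- A) (None, Some 0)"
    then obtain U where U: "openin torus U" "(None, Some 0) \<in> U" "\<And>q. q \<in> U \<Longrightarrow> wandering (- A) q"
      by (rule wandering_nhd) (rule that)
    obtain e where e: "0 < e" "\<And>y'. \<bar>y' - 0\<bar> < e \<Longrightarrow> (None, Some y') \<in> U"
      using infinity_fst_nhds[OF U(1,2)] by metis
    show False using e(1) e(2)[of "e / 2"] U(3) 4[of "e / 2"] by auto
  qed
  have 6: "\<not> wandering (- A) (Some 0, None)"
    using wandering_flip[of "(None, Some 0)"] 5 by simp
  have 7: "\<not> wandering (- A) (None, None)"
  proof
    assume "wandering (- A) (None, None)"
    then obtain U where U: "openin torus U" "(None, None) \<in> U" "\<And>q. q \<in> U \<Longrightarrow> wandering (- A) q"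
      by (rule wandering_nhd) (rule that)
    obtain M where "\<And>x. \<bar>x\<bar> > M \<Longrightarrow> (Some x, None) \<in> U" using infinity_nhds[OF U(1,2)] by metis
    then have "(Some (\<bar>M\<bar> + 1), None) \<in> U" by force
    moreover have "0 < \<bar>M\<bar> + 1" by linarith
    ultimately show False using U(3) 3 by blast
  qed
  assume "p \<notin> range emb"
  then show ?thesis
  proof (cases p rule: pt_cases)
    case (fst y) then show ?thesis using 1 4 5 7 by (cases y) (auto intro: linorder_cases[of "the y" 0])
  next
    case (snd x) then show ?thesis using 2 3 6 7 by (cases x) (auto intro: linorder_cases[of "the x" 0])
  qed auto
qed

end

subsection \<open>Points outside the basins\<close>

lemma open_dist_point: "open X \<Longrightarrow> q \<in> X \<Longrightarrow> \<exists>d>0. \<forall>w. dist w q < d \<longrightarrow> w \<in> X"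
  by (simp add: open_dist)

context golden begin

definition code :: "real \<times> real \<Rightarrow> nat" where
  "code z = (if 1 \<le> fst z then 0 else 1)"

text \<open>This is also the right word after the orbit has moved to the lines at infinity: there it alternates
  between \<open>(\<infinity>, y)\<close> and \<open>(y, \<infinity>)\<close> with \<open>y \<le> - 1\<close>, and only the former is in \<open>R\<^sub>0\<close>.\<close>

definition cw :: "real \<times> real \<Rightarrow> int \<Rightarrow> nat" where
  "cw z k = (if f_pow k (emb z) \<in> rect 0 then 0 else 1)"

lemma open_F: "open T \<Longrightarrow> open {z. fst z \<noteq> 1 \<and> F z \<in> T}"
proof -
  assume T: "open T"
  have "open {z :: real \<times> real. fst z \<noteq> 1}" by (intro open_Collect_neq continuous_intros)
  then have "open ({z. fst z \<noteq> 1} \<inter> F -` T)"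
    by (intro continuous_open_preimage continuous_on_F T) auto
  then show ?thesis by (simp add: vimage_def Int_def)
qed

lemma open_F_iter: "open T \<Longrightarrow> open {z. (\<forall>i<k. fst ((F ^^ i) z) \<noteq> 1) \<and> (F ^^ k) z \<in> T}"
proof (induction k)
  case (Suc k)
  have "{z. (\<forall>i<Suc k. fst ((F ^^ i) z) \<noteq> 1) \<and> (F ^^ Suc k) z \<in> T} =
    {z. fst z \<noteq> 1 \<and> F z \<in> {z. (\<forall>i<k. fst ((F ^^ i) z) \<noteq> 1) \<and> (F ^^ k) z \<in> T}}"
    by (auto simp: funpow_Suc_comm All_less_Suc2)
  then show ?case using open_F[OF Suc.IH[OF Suc.prems]] by simp
qed simp

lemma F_iter_nhd:
  assumes "\<And>i. i < M \<Longrightarrow> fst ((F ^^ i) q) \<noteq> 1" "\<And>i. i \<le> M \<Longrightarrow> open (T i) \<and> (F ^^ i) q \<in> T i"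
  obtains d where "0 < d"
    "\<And>w i. dist w q < d \<Longrightarrow> i \<le> M \<Longrightarrow> (F ^^ i) w \<in> T i"
    "\<And>w i. dist w q < d \<Longrightarrow> i < M \<Longrightarrow> fst ((F ^^ i) w) \<noteq> 1"
proof -
  have "open (\<Inter>k\<in>{..M}. {z. (\<forall>i<k. fst ((F ^^ i) z) \<noteq> 1) \<and> (F ^^ k) z \<in> T k})" (is "open ?X")
    using assms(2) by (intro open_INT ballI open_F_iter) auto
  moreover have "q \<in> ?X" using assms by auto
  ultimately have "\<exists>d>0. \<forall>w. dist w q < d \<longrightarrow> w \<in> ?X" by (rule open_dist_point)
  then obtain d where d: "0 < d" "\<And>w. dist w q < d \<Longrightarrow> w \<in> ?X" by (elim exE conjE) (rule that, auto simp del: INT_iff)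
  show ?thesis
  proof (rule that[OF d(1)])
    fix w i assume "dist w q < d" then have w: "w \<in> ?X" by (rule d(2))
    show "i \<le> M \<Longrightarrow> (F ^^ i) w \<in> T i" "i < M \<Longrightarrow> fst ((F ^^ i) w) \<noteq> 1" using w by auto
  qed
qed

lemma continuous_on_F_iter:
  assumes "\<And>z i. z \<in> X \<Longrightarrow> i < k \<Longrightarrow> fst ((F ^^ i) z) \<noteq> 1"
  shows "continuous_on X (F ^^ k)"
  using assms
proof (induction k)
  case (Suc k)
  have "continuous_on X (\<lambda>z. F ((F ^^ k) z))"
    by (rule continuous_on_compose2[OF continuous_on_F[of "{z. fst z \<noteq> 1}"]]) (use Suc in auto)
  then show ?case by (simp add: o_def)
qed (simp add: continuous_on_id id_def)

lemma open_SLN: "open S" "open L" "open N"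
  unfolding S_def L_def N_def by (intro open_Collect_conj open_Collect_less continuous_intros)+

text \<open>The gap \<open>A < x <= A + 1\<close> is excluded by looking one step ahead: the image
  has negative abscissa, so as a point of \<open>K\<close> it must have positive ordinate
  \<open>x - (A + 1)\<close>.\<close>

lemma K_SLN:
  assumes z: "z \<in> K" "fst z \<noteq> 1"
  shows "z \<in> S \<or> z \<in> L \<or> z \<in> N"
proof -
  note z' = K_imp[OF z(1)]
  show ?thesis
  proof (cases "A < fst z")
    case True
    then have "snd z < 0" using z' A by auto
    moreover have "0 < (fst z - A) / (fst z - 1)" using True A by simp
    ultimately have "fst (F z) < 0" unfolding F_def fst_conv by (intro mult_neg_pos)
    then have "0 < snd (F z)" using K_imp[OF K_F[OF z]] by auto
    then have "A + 1 < fst z" by (simp add: F_def)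
    then show ?thesis using \<open>snd z < 0\<close> by (simp add: L_def)
  next
    case False
    then have "fst z \<le> A" by simp
    with z' z(2) have "1 < fst z \<and> fst z < A \<and> snd z < 0 \<or> fst z < 0 \<and> 0 < snd z" by argo
    then show ?thesis unfolding S_def N_def by blast
  qed
qed

lemma K_snd_F: "z \<in> K \<Longrightarrow> snd (F z) \<noteq> - 1"
  using K_imp[of z] A by (auto simp: F_def)

lemma K_G:
  assumes "z \<in> K" "fst z \<noteq> 1" "snd z \<noteq> - 1"
  shows "z \<in> G (code z)"
  using K_imp[OF assms(1)] assms by (auto simp: G_def code_def)

lemma dist_le_abs: "dist (a, b) (c, d) \<le> \<bar>a - c\<bar> + \<bar>b - (d::real)\<bar>" for a c :: real
  by (simp add: dist_Pair_Pair dist_real_def sqrt_sum_squares_le_sum_abs)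

text \<open>If the orbit of \<open>q\<close> ends on the side \<open>x = 1\<close> of the rectangle, it has to be pushed inside.
  Moving \<open>q\<close> in the direction in which \<open>V\<close> is positive changes the final abscissa injectively,
  hence monotonically.\<close>

lemma perturb_unstable:
  assumes K: "\<And>i. i \<le> M \<Longrightarrow> (F ^^ i) q \<in> K" and ne: "\<And>i. i < M \<Longrightarrow> fst ((F ^^ i) q) \<noteq> 1"
    and last: "fst ((F ^^ M) q) = 1" and M: "0 < M" and d: "0 < d"
  shows "\<exists>w. dist w q < d \<and> 1 < fst ((F ^^ M) w) \<and> (code q = 0 \<longrightarrow> snd w = snd q)"
proof -
  \<comment> \<open>Staying in the same piece makes \<open>V\<close> monotone at every step. At the
    last time a positive abscissa suffices, so that \<open>V\<close> equals \<open>Q\<close>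
    there.\<close>
  define T where "T i = (if i = M then {z. 0 < fst z} else
    if (F ^^ i) q \<in> S then S else if (F ^^ i) q \<in> L then L else N)" for i
  have "open (T i) \<and> (F ^^ i) q \<in> T i" if "i \<le> M" for i
  proof (cases "i = M")
    case True
    then show ?thesis using last by (auto simp: T_def intro!: open_Collect_less continuous_intros)
  next
    case False
    then show ?thesis using K_SLN[OF K ne, of i] that by (auto simp: T_def open_SLN)
  qed
  from F_iter_nhd[of M q T, OF ne this] obtain e where e: "0 < e"
    "\<And>w i. dist w q < e \<Longrightarrow> i \<le> M \<Longrightarrow> (F ^^ i) w \<in> T i"
    "\<And>w i. dist w q < e \<Longrightarrow> i < M \<Longrightarrow> fst ((F ^^ i) w) \<noteq> 1" by metis
  \<comment> \<open>Only the abscissa varies for the symbol 0 and only the ordinate for the symbol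
    1, so in both cases \<open>V\<close> of two points is the modulus of one logarithmic difference
    and is positive.\<close>
  define p where "p s = (if code q = 0 then (fst q + s, snd q) else (fst q, snd q + s))" for s
  define r where "r = min e d / 2"
  have r: "0 < r" using e d by (simp add: r_def)
  have p0: "p 0 = q" by (simp add: p_def)
  have dp: "dist (p s) q \<le> \<bar>s\<bar>" for s
    using dist_le_abs[of "fst (p s)" "snd (p s)" "fst q" "snd q"] by (simp add: p_def split: if_splits)
  have pe: "dist (p s) q < e" "dist (p s) q < d" if "s \<in> {- r..r}" for s
    using dp[of s] that r e d by (auto simp: r_def)
  have V0: "0 < V (p s) (p t)" if st: "s \<noteq> t" "s \<in> {- r..r}" "t \<in> {- r..r}" for s t
  proof -
    have T0: "p s \<in> T 0" "p t \<in> T 0" using e(2)[OF pe(1), of _ 0] st by auto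
    show ?thesis
    proof (cases "code q = 0")
      case True
      then have "1 \<le> fst q" by (simp add: code_def split: if_splits)
      then have "q \<notin> N" by (auto simp: N_def)
      then have "0 < fst (p s) \<and> 0 < fst (p t)" using T0 M A K_SLN[of q] K[of 0] ne[of 0]
        by (auto simp: T_def S_def L_def split: if_splits)
      then show ?thesis using True st by (auto simp: V_def Q_def p_def)
    next
      case False
      then have q: "fst q < 1" by (simp add: code_def split: if_splits)
      then have "q \<notin> S \<and> q \<notin> L" using A by (auto simp: S_def L_def)
      then have "fst (p s) < 0 \<and> 0 < snd (p s) \<and> 0 < snd (p t)" using T0 M
        by (auto simp: T_def N_def)
      then show ?thesis using False st by (auto simp: V_def Q_def p_def)
    qed
  qed
  have Vi: "0 < V ((F ^^ i) (p s)) ((F ^^ i) (p t))"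
    if "i \<le> M" "s \<noteq> t" "s \<in> {- r..r}" "t \<in> {- r..r}" for i s t
    using that(1)
  proof (induction i)
    case 0 then show ?case using V0 that by simp
  next
    case (Suc i)
    have "(F ^^ i) (p s) \<in> T i" "(F ^^ i) (p t) \<in> T i" using e(2)[OF pe(1)] that Suc by auto
    then have "V ((F ^^ i) (p s)) ((F ^^ i) (p t)) \<le> V (F ((F ^^ i) (p s))) (F ((F ^^ i) (p t)))"
      using Suc.prems by (intro V_step(1)) (auto simp: T_def split: if_splits)
    then show ?case using Suc by simp
  qed
  define h where "h s = fst ((F ^^ M) (p s))" for s
  \<comment> \<open>Equal final abscissas would leave \<open>V\<close> with only its negative
    term.\<close>
  have inj: "inj_on h {- r..r}"
  proof (rule inj_onI, rule ccontr)
    fix s t assume st: "s \<in> {- r..r}" "t \<in> {- r..r}" "h s = h t" "s \<noteq> t"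
    have "0 < fst ((F ^^ M) (p s))" using e(2)[OF pe(1)[OF st(1)], of M] by (simp add: T_def)
    then have "V ((F ^^ M) (p s)) ((F ^^ M) (p t)) \<le> 0" using st(3) by (simp add: V_def Q_def h_def)
    then show False using Vi[of M s t] st by auto
  qed
  have cp: "continuous_on {- r..r} p" unfolding p_def by (cases "code q = 0") (auto intro!: continuous_intros)
  have "fst ((F ^^ i) z) \<noteq> 1" if "z \<in> p ` {- r..r}" "i < M" for z i
    using that e(3)[OF pe(1)] by blast
  then have "continuous_on {- r..r} (\<lambda>s. (F ^^ M) (p s))"
    by (intro continuous_on_compose2[OF continuous_on_F_iter[of "p ` {- r..r}"] cp]) auto
  then have "continuous_on {- r..r} h" unfolding h_def by (intro continuous_intros)
  then have "h (- r) < h 0 \<and> h 0 < h r \<or> h r < h 0 \<and> h 0 < h (- r)"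
    using continuous_inj_imp_mono[of "- r" 0 r h] r inj by auto
  moreover have "h 0 = 1" using last by (simp add: h_def p0)
  ultimately have "1 < h (- r) \<or> 1 < h r" by auto
  then have "\<exists>s\<in>{- r..r}. 1 < h s" using r by (auto intro: bexI[of _ r] bexI[of _ "- r"])
  then obtain s where s: "s \<in> {- r..r}" "1 < h s" by blast
  show ?thesis
    using s pe by (intro exI[of _ "p s"]) (auto simp: h_def p_def)
qed

text \<open>Only two sides can be touched: \<open>y = - 1\<close> at the first time, by
  \<open>K_snd_F\<close>, and \<open>x = 1\<close> at the last. The end is corrected first, without
  changing the initial ordinate if the first symbol is 0; the start is then lowered by so little
  that the correction persists.\<close>

lemma perturb_interior:
  assumes K: "\<And>i. i \<le> M \<Longrightarrow> (F ^^ i) q \<in> K" and ne: "\<And>i. i < M \<Longrightarrow> fst ((F ^^ i) q) \<noteq> 1" and d: "0 < d"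
  obtains w where "dist w q < d" "\<And>i. i \<le> M \<Longrightarrow> (F ^^ i) w \<in> G (code ((F ^^ i) q))"
proof (cases "M = 0")
  case True
  define w where "w = (if code q = 0 then (fst q + d / 3, snd q - d / 3) else q)"
  have "dist w q < d" using dist_le_abs[of "fst w" "snd w" "fst q" "snd q"] d by (auto simp: w_def)
  moreover have "w \<in> G (code q)" using K_imp[OF K[of 0]] d by (auto simp: w_def G_def code_def)
  ultimately show ?thesis using that[of w] True by simp
next
  case False
  define T where "T i = (if i = 0 then {z. code q = 0 \<longrightarrow> 1 < fst z} \<inter> {z. code q = 1 \<longrightarrow> z \<in> G 1}
     else if i < M then G (code ((F ^^ i) q))
     else {z. code ((F ^^ i) q) = 0 \<longrightarrow> snd z < - 1} \<inter> {z. 1 < fst ((F ^^ i) q) \<longrightarrow> 1 < fst z} \<inter>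
          {z. code ((F ^^ i) q) = 1 \<longrightarrow> z \<in> G 1})" for i
  have oimp: "open {z :: real \<times> real. P \<longrightarrow> z \<in> X}" if "open X" for P X using that by (cases P) auto
  have o1: "open {z :: real \<times> real. P \<longrightarrow> 1 < fst z}" "open {z :: real \<times> real. P \<longrightarrow> snd z < - 1}" for P
    by (cases P; auto intro!: open_Collect_less continuous_intros)+
  have T: "open (T i) \<and> (F ^^ i) q \<in> T i" if "i \<le> M" for i
  proof
    show "open (T i)" unfolding T_def by (auto intro!: open_Int oimp o1 open_G)
    have Ki: "(F ^^ i) q \<in> K" using K that by blast
    have sn: "snd ((F ^^ i) q) \<noteq> - 1" if "0 < i" using K_snd_F[OF K[of "i - 1"]] \<open>i \<le> M\<close> that by (cases i) auto
    show "(F ^^ i) q \<in> T i"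
      using K_imp[OF Ki] sn ne[of i] K_G[OF Ki] that False by (auto simp: T_def code_def G_def)
  qed
  from F_iter_nhd[of M q T, OF ne this] obtain e where e: "0 < e"
    "\<And>w i. dist w q < e \<Longrightarrow> i \<le> M \<Longrightarrow> (F ^^ i) w \<in> T i"
    "\<And>w i. dist w q < e \<Longrightarrow> i < M \<Longrightarrow> fst ((F ^^ i) w) \<noteq> 1" by metis
  have "\<exists>w. dist w q < min d e \<and> (code ((F ^^ M) q) = 0 \<longrightarrow> 1 < fst ((F ^^ M) w)) \<and> (code q = 0 \<longrightarrow> snd w = snd q)"
  proof (cases "fst ((F ^^ M) q) = 1")
    case True
    have de: "0 < min d e" and M: "0 < M" using d e False by simp_all
    have "\<exists>w. dist w q < min d e \<and> 1 < fst ((F ^^ M) w) \<and> (code q = 0 \<longrightarrow> snd w = snd q)"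
      using perturb_unstable[of M q "min d e", OF K ne True M de] .
    then obtain w where "dist w q < min d e" "1 < fst ((F ^^ M) w)" "code q = 0 \<longrightarrow> snd w = snd q"
      by (elim exE conjE) (rule that)
    then show ?thesis by (intro exI[of _ w]) simp
  next
    case ne1: False
    have "code ((F ^^ M) q) = 0 \<longrightarrow> 1 < fst ((F ^^ M) q)" using ne1 by (auto simp: code_def)
    then show ?thesis using d e by (intro exI[of _ q]) auto
  qed
  then obtain w where w: "dist w q < min d e" "code ((F ^^ M) q) = 0 \<longrightarrow> 1 < fst ((F ^^ M) w)"
    "code q = 0 \<longrightarrow> snd w = snd q" by (elim exE conjE) (rule that)
  define T' :: "nat \<Rightarrow> (real \<times> real) set" where "T' i = (if i = M then {z. code ((F ^^ M) q) = 0 \<longrightarrow> 1 < fst z} else UNIV)" for i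
  have "open (T' i) \<and> (F ^^ i) w \<in> T' i" if "i \<le> M" for i using w(2) o1 by (auto simp: T'_def)
  moreover have new: "fst ((F ^^ i) w) \<noteq> 1" if "i < M" for i using e(3) w(1) that by simp
  ultimately obtain e' where e': "0 < e'" "\<And>u i. dist u w < e' \<Longrightarrow> i \<le> M \<Longrightarrow> (F ^^ i) u \<in> T' i"
    using F_iter_nhd[of M w T'] by metis
  define r where "r = min e' (min d e - dist w q) / 2"
  have r: "0 < r" using e' w by (simp add: r_def)
  define u where "u = (if code q = 0 then (fst w, snd w - r) else w)"
  have duw: "dist u w \<le> r" using dist_le_abs[of "fst u" "snd u" "fst w" "snd w"] r by (auto simp: u_def)
  then have "dist u w < e'" "dist u w < min d e - dist w q" using r e' by (auto simp: r_def)
  then have u1: "dist u w < e'" and u2: "dist u q < d" "dist u q < e"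
    using dist_triangle[of u q w] by auto
  have "(F ^^ i) u \<in> G (code ((F ^^ i) q))" if i: "i \<le> M" for i
  proof -
    have Ti: "(F ^^ i) u \<in> T i" using e(2)[OF u2(2) i] .
    have c01: "code z = 0 \<or> code z = 1" for z by (simp add: code_def)
    consider "i = 0" | "0 < i" "i < M" | "i = M" using i by linarith
    then show ?thesis
    proof cases
      case 1
      have "code q = 0 \<Longrightarrow> snd u < - 1" using w(3) r K_imp[OF K[of 0]] by (auto simp: u_def code_def split: if_splits)
      then show ?thesis using Ti 1 c01[of q] by (auto simp: T_def G_def)
    next
      case 2
      then show ?thesis using Ti by (simp add: T_def)
    next
      case 3
      then show ?thesis using Ti e'(2)[OF u1, of M] c01[of "(F ^^ M) q"] False by (auto simp: T_def T'_def G_def)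
    qed
  qed
  then show ?thesis using that u2(1) by blast
qed

text \<open>Points just inside the side \<open>x = 1\<close> shadow the orbit of the collapsed side:
  they are thrown close to the line at infinity and then read 0101... for a prescribed time.\<close>

lemma forward_pattern:
  obtains d where "0 < d" "\<And>w k. 1 < fst w \<Longrightarrow> fst w < 1 + d \<Longrightarrow> snd w < - 1 \<Longrightarrow> 1 \<le> k \<Longrightarrow> k \<le> m \<Longrightarrow>
     (F ^^ k) w \<in> G (if odd k then 0 else 1)"
proof -
  \<comment> \<open>From abscissa \<open>R\<close>, losing at most \<open>A + 1\<close> per double
    step, the orbit stays beyond \<open>A + 1\<close> for \<open>m\<close> double steps. The choice
    of \<open>d\<close> ensures \<open>(A - x) / (x - 1) >= R\<close>.\<close>
  define R where "R = 2 + (A + 1) * (real m + 1)"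
  have "0 \<le> (A + 1) * (real m + 1)" using A by simp
  then have R: "2 \<le> R" by (simp add: R_def)
  define d where "d = (A - 1) / (2 * R)"
  have d: "0 < d" "d * R = (A - 1) / 2" using A R by (simp_all add: d_def)
  have "d * 2 \<le> d * R" using d R by (intro mult_left_mono) auto
  then have dA: "d \<le> (A - 1) / 4" using d by simp
  show ?thesis
  proof (rule that[OF d(1)])
    fix w :: "real \<times> real" and k assume w: "1 < fst w" "fst w < 1 + d" "snd w < - 1" and k: "1 \<le> k" "k \<le> m"
    define u where "u = F w"
    have "R * (fst w - 1) \<le> R * d" using w R by (intro mult_left_mono) auto
    also have "\<dots> = (A - 1) / 2" using d by (simp add: mult.commute)
    also have "\<dots> \<le> A - fst w" using w dA by simp
    finally have "R \<le> (A - fst w) / (fst w - 1)" using w by (simp add: pos_le_divide_eq)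
    then have "1 * R \<le> - snd w * ((A - fst w) / (fst w - 1))" using w R by (intro mult_mono) auto
    also have "\<dots> = fst u"
    proof -
      have "(fst w - A) / (fst w - 1) = - ((A - fst w) / (fst w - 1))" by (simp add: minus_divide_left)
      then show ?thesis unfolding u_def F_def by simp
    qed
    finally have fu: "R \<le> fst u" by simp
    have su: "snd u < - 1" using w dA A by (simp add: u_def F_def)
    have main: "(A + 1) * (real m + 1 - real i) + 1 < fst ((F ^^ (2 * i)) u) \<and> snd ((F ^^ (2 * i)) u) < - 1" if "i \<le> m" for i
      using that
    proof (induction i)
      case 0 then show ?case using fu su by (simp add: R_def)
    next
      case (Suc i)
      have "(A + 1) * 1 \<le> (A + 1) * (real m + 1 - real i)" using Suc.prems A by (intro mult_left_mono) auto
      then have "A + 1 < fst ((F ^^ (2 * i)) u)" "snd ((F ^^ (2 * i)) u) < 0" using Suc by auto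
      from F_F_le(1,2)[OF this] show ?case using Suc A by (auto simp: algebra_simps)
    qed
    have big: "A + 1 < fst ((F ^^ (2 * i)) u) \<and> snd ((F ^^ (2 * i)) u) < - 1" if "i \<le> m" for i
    proof -
      have "(A + 1) * 1 \<le> (A + 1) * (real m + 1 - real i)" using that A by (intro mult_left_mono) auto
      then show ?thesis using main[OF that] by auto
    qed
    obtain j where j: "k = Suc j" using k by (cases k) auto
    then have Fk: "(F ^^ k) w = (F ^^ j) u" by (simp add: u_def F_Suc del: funpow.simps)
    show "(F ^^ k) w \<in> G (if odd k then 0 else 1)"
    proof (cases "even j")
      case True
      then obtain i where i: "j = 2 * i" by blast
      then show ?thesis using big[of i] j k A unfolding Fk by (auto simp: G_def)
    next
      case False
      then obtain i where i: "j = 2 * i + 1" by (elim oddE)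
      then have "(F ^^ j) u = F ((F ^^ (2 * i)) u)" by simp
      moreover have "fst (F ((F ^^ (2 * i)) u)) < 0" "0 < snd (F ((F ^^ (2 * i)) u))"
        using F_F(1,2)[of "(F ^^ (2 * i)) u"] big[of i] i j k by auto
      ultimately show ?thesis using i j unfolding Fk by (auto simp: G_def)
    qed
  qed
qed

section \<open>The word of a point outside the basins\<close>

lemma forward_segment:
  assumes "z \<in> K"
  obtains l where "l \<le> m" "\<And>i. i \<le> l \<Longrightarrow> (F ^^ i) z \<in> K" "\<And>i. i < l \<Longrightarrow> fst ((F ^^ i) z) \<noteq> 1"
    "l = m \<or> fst ((F ^^ l) z) = 1"
proof -
  have "\<exists>l\<le>m. (\<forall>i\<le>l. (F ^^ i) z \<in> K) \<and> (\<forall>i<l. fst ((F ^^ i) z) \<noteq> 1) \<and> (l = m \<or> fst ((F ^^ l) z) = 1)"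
  proof (induction m)
    case 0 then show ?case using assms by simp
  next
    case (Suc m)
    then obtain l where l: "l \<le> m" "\<forall>i\<le>l. (F ^^ i) z \<in> K" "\<forall>i<l. fst ((F ^^ i) z) \<noteq> 1" "l = m \<or> fst ((F ^^ l) z) = 1"
      by blast
    show ?case
    proof (cases "fst ((F ^^ l) z) = 1")
      case True then show ?thesis using l by (intro exI[of _ l]) auto
    next
      case False
      then have "F ((F ^^ l) z) \<in> K" using l K_F by blast
      then show ?thesis using l False by (intro exI[of _ "Suc l"]) (auto simp: le_Suc_eq less_Suc_eq)
    qed
  qed
  then show ?thesis using that by blast
qed

lemma cw_fin:
  assumes "(F ^^ k) z \<in> K" "\<And>i. i < k \<Longrightarrow> fst ((F ^^ i) z) \<noteq> 1"
  shows "cw z (int k) = code ((F ^^ k) z)"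
  using f_iter_emb[OF assms(2)] K_imp[OF assms(1)] by (auto simp: cw_def code_def emb_rect)

text \<open>One step after the exit the orbit is at \<open>(\<infinity>, - A)\<close>. For odd
  \<open>k\<close> it is of the form \<open>(\<infinity>, y)\<close> with \<open>y <= - 1\<close>,
  for even \<open>k\<close> of the form \<open>(y, \<infinity>)\<close>.\<close>

lemma cw_inf:
  assumes "\<And>i. i < l \<Longrightarrow> fst ((F ^^ i) z) \<noteq> 1" "fst ((F ^^ l) z) = 1" "0 < k"
  shows "cw z (int (l + k)) = (if odd k then 0 else 1)"
proof -
  have e: "(f ^^ l) (emb z) = emb ((F ^^ l) z)" using assms(1) by (rule f_iter_emb)
  have it: "(f ^^ (2 * i)) (None, Some (- A)) = (None, Some (- A - real i * (A + 1)))" for i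
    by (induction i) (simp_all add: f_inf shift_def algebra_simps)
  obtain j where j: "k = Suc j" using assms(3) by (cases k) auto
  have "(f ^^ (l + k)) (emb z) = (f ^^ j) (f ((f ^^ l) (emb z)))"
    by (simp add: j funpow_funpow[symmetric] funpow_Suc_comm add.commute)
  also have "f ((f ^^ l) (emb z)) = (None, Some (- A))"
    unfolding e using f_emb1[of "snd ((F ^^ l) z)"] assms(2) by (metis prod.collapse)
  finally have fk: "(f ^^ (l + k)) (emb z) = (f ^^ j) (None, Some (- A))" .
  have neg: "- A - real i * (A + 1) \<le> - 1" for i
  proof -
    have "0 \<le> real i * (A + 1)" using A by simp
    then show ?thesis using A by linarith
  qed
  show ?thesis
  proof (cases "even j")
    case True
    then obtain i where "j = 2 * i" by blast
    then have "(f ^^ (l + k)) (emb z) = (None, Some (- A - real i * (A + 1)))" using fk it by simp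
    then have "f_pow (int (l + k)) (emb z) \<in> rect 0" unfolding f_pow_of_nat using neg
      by (simp add: rect_def arc_above_def arc_below_def)
    then show ?thesis using True j unfolding cw_def by simp
  next
    case False
    then obtain i where "j = 2 * i + 1" by (elim oddE)
    then have "(f ^^ (l + k)) (emb z) = (Some (- A - real i * (A + 1)), None)" using fk it[of i] by (simp add: f_inf)
    then have "f_pow (int (l + k)) (emb z) \<notin> rect 0" unfolding f_pow_of_nat using neg[of i]
      by (auto simp: rect_def arc_above_def arc_below_def)
    then show ?thesis using False j unfolding cw_def by simp
  qed
qed

lemma flip_rect0: "flip p \<in> rect 0 \<longleftrightarrow> p \<in> rect 0"
proof -
  have "p \<in> rect 0 \<Longrightarrow> flip p \<in> rect 0" for p
    by (auto simp: rect_def arc_above_def arc_below_def)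
  then show ?thesis by (metis flip_flip)
qed

lemma cw_sw: "cw (sw z) k = cw z (- k)"
  by (simp add: cw_def flip_emb[symmetric] f_pow_flip flip_rect0)

lemma cw_golden:
  assumes "z \<in> K"
  shows "cw z \<in> golden_words"
proof -
  have pos: "\<not> (cw z (int k) = 1 \<and> cw z (int k + 1) = 1)" if z: "z \<in> K" for z k
  proof -
    obtain l where l: "l \<le> Suc k" "\<And>i. i \<le> l \<Longrightarrow> (F ^^ i) z \<in> K" "\<And>i. i < l \<Longrightarrow> fst ((F ^^ i) z) \<noteq> 1"
      "l = Suc k \<or> fst ((F ^^ l) z) = 1" using forward_segment[OF z] by metis
    show ?thesis
    proof (cases "l = Suc k")
      case True
      let ?w = "(F ^^ k) z"
      have K: "?w \<in> K" "F ?w \<in> K" using l(2)[of k] l(2)[of "Suc k"] True by auto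
      have c: "cw z (int k) = code ?w" "cw z (int k + 1) = code (F ?w)"
        using cw_fin[of k z] cw_fin[of "Suc k" z] l(3) K True by (auto simp: add.commute)
      show ?thesis
      proof (cases "1 \<le> fst ?w")
        case False
        then have w: "fst ?w < 0" "0 < snd ?w" using K_imp[OF K(1)] by auto
        then have "0 < (fst ?w - A) / (fst ?w - 1)" using A by (intro divide_neg_neg) auto
        then have "0 < snd ?w * ((fst ?w - A) / (fst ?w - 1))" using w by (intro mult_pos_pos)
        then have "0 < fst (F ?w)" by (simp only: F_def[of ?w] fst_conv)
        then have "1 \<le> fst (F ?w)" using K_imp[OF K(2)] by auto
        then show ?thesis using c by (simp add: code_def)
      qed (use c in \<open>simp add: code_def\<close>)
    next
      case False
      then have l1: "fst ((F ^^ l) z) = 1" "l \<le> k" using l by auto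
      show ?thesis
      proof (cases "l = k")
        case True
        then have "cw z (int k) = code ((F ^^ k) z)" using cw_fin[of k z] l by auto
        then show ?thesis using l1 True by (simp add: code_def)
      next
        case False
        then obtain j where j: "k = l + j" "0 < j" using l1(2) by (metis le_neq_implies_less less_imp_add_positive)
        have "cw z (int k) = (if odd j then 0 else 1)" "cw z (int k + 1) = (if odd (Suc j) then 0 else 1)"
          using cw_inf[OF l(3) l1(1), of j] cw_inf[OF l(3) l1(1), of "Suc j"] j by (auto simp: algebra_simps)
        then show ?thesis by auto
      qed
    qed
  qed
  have "\<not> (cw z k = 1 \<and> cw z (k + 1) = 1)" for k
  proof (cases "0 \<le> k")
    case True
    then show ?thesis using pos[OF assms, of "nat k"] by simp
  next
    case False
    then have k: "k = - int (nat (- k - 1)) - 1" by simp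
    define j where "j = nat (- k - 1)"
    have "cw (sw z) (int j) = cw z (k + 1)" "cw (sw z) (int j + 1) = cw z k"
      unfolding cw_sw by (rule arg_cong[of _ _ "cw z"], use k in \<open>simp add: j_def\<close>)+
    then show ?thesis using pos[of "sw z" j] assms K_sw by auto
  qed
  then show ?thesis by (auto simp: golden_words_def cw_def)
qed

lemma F_iter_sw:
  assumes "\<And>i. i < n \<Longrightarrow> fst ((F ^^ i) z) \<noteq> 1 \<and> fst ((F ^^ i) z) \<noteq> A" "j \<le> n"
  shows "(F ^^ j) (sw ((F ^^ n) z)) = sw ((F ^^ (n - j)) z)"
  using assms(2)
proof (induction j)
  case (Suc j)
  then have "n - j = Suc (n - Suc j)" by simp
  then show ?case using Suc F_sw_F[of "(F ^^ (n - Suc j)) z"] assms(1)[of "n - Suc j"] by simp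
qed simp

lemma G_sw: "sw z \<in> G s \<longleftrightarrow> z \<in> G s"
  by (auto simp: G_def)

text \<open>Up to the exit time \<open>l\<close> the two orbits share their symbols by assumption.
  After it, leaving within \<open>d\<close> of the side \<open>x = 1\<close> reproduces the
  alternating tail of the word.\<close>

lemma orbit_in_G:
  assumes fin: "\<And>i. i \<le> l \<Longrightarrow> (F ^^ i) z \<in> K" "\<And>i. i < l \<Longrightarrow> fst ((F ^^ i) z) \<noteq> 1" "l \<le> m"
     "l = m \<or> fst ((F ^^ l) z) = 1"
    and w: "\<And>i. i \<le> l \<Longrightarrow> (F ^^ i) w \<in> G (code ((F ^^ i) z))"
    and d: "\<And>w k. 1 < fst w \<Longrightarrow> fst w < 1 + d \<Longrightarrow> snd w < - 1 \<Longrightarrow> 1 \<le> k \<Longrightarrow> k \<le> m \<Longrightarrow>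
     (F ^^ k) w \<in> G (if odd k then 0 else 1)"
    and wd: "fst ((F ^^ l) z) = 1 \<Longrightarrow> fst ((F ^^ l) w) < 1 + d"
    and k: "k \<le> m"
  shows "(f ^^ k) (emb w) \<in> emb ` G (cw z (int k))"
proof -
  have G: "(F ^^ k) w \<in> G (cw z (int k))" if "k \<le> m" for k
  proof (cases "k \<le> l")
    case True
    then show ?thesis using w[OF True] cw_fin[of k z] fin by auto
  next
    case False
    then have l1: "fst ((F ^^ l) z) = 1" using fin(3,4) that by auto
    obtain j where j: "k = l + j" "0 < j" using False by (metis less_imp_add_positive not_le)
    have c: "cw z (int k) = (if odd j then 0 else 1)" using cw_inf[OF fin(2) l1 j(2)] j by simp
    have "(F ^^ l) w \<in> G 0" using w[of l] l1 by (simp add: code_def)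
    then have "(F ^^ j) ((F ^^ l) w) \<in> G (if odd j then 0 else 1)"
      using wd[OF l1] j that by (intro d) (auto simp: G_def)
    then show ?thesis unfolding c by (simp add: j funpow_funpow add.commute)
  qed
  have "(f ^^ k) (emb w) = emb ((F ^^ k) w)"
  proof (rule f_iter_emb)
    fix i assume "i < k"
    then show "fst ((F ^^ i) w) \<noteq> 1" using G_fst[OF G[of i]] k by simp
  qed
  then show ?thesis using G[OF k] by simp
qed

text \<open>The finite orbit segment of \<open>z\<close>, extended in each direction until it exits
  or the block ends, is started at its earliest point \<open>q\<close>. Perturbing \<open>q\<close>
  into the interiors gives an orbit with the same symbols, and the parts of the word beyond the
  exits come from \<open>forward_pattern\<close> applied in both time directions.\<close>

lemma K_subset_wrect:
  assumes z: "z \<in> K"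
  shows "emb z \<in> wrect (cw z)"
  unfolding wrect_iff in_closure_of topspace_torus
proof (intro allI conjI impI UNIV_I)
  fix n m V assume V: "emb z \<in> V \<and> openin torus V"
  obtain d where d: "0 < d" "\<And>w k. 1 < fst w \<Longrightarrow> fst w < 1 + d \<Longrightarrow> snd w < - 1 \<Longrightarrow> 1 \<le> k \<Longrightarrow> k \<le> max n m \<Longrightarrow>
     (F ^^ k) w \<in> G (if odd k then 0 else 1)" using forward_pattern by metis
  obtain l where l: "l \<le> m" "\<And>i. i \<le> l \<Longrightarrow> (F ^^ i) z \<in> K" "\<And>i. i < l \<Longrightarrow> fst ((F ^^ i) z) \<noteq> 1"
    "l = m \<or> fst ((F ^^ l) z) = 1" using forward_segment[OF z] by metis
  have sz: "sw z \<in> K" using z K_sw by simp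
  obtain l' where l': "l' \<le> n" "\<And>i. i \<le> l' \<Longrightarrow> (F ^^ i) (sw z) \<in> K" "\<And>i. i < l' \<Longrightarrow> fst ((F ^^ i) (sw z)) \<noteq> 1"
    "l' = n \<or> fst ((F ^^ l') (sw z)) = 1" using forward_segment[OF sz] by metis
  define q where "q = sw ((F ^^ l') (sw z))"
  have neA: "fst u \<noteq> A" if "u \<in> K" for u using K_imp[OF that] A by auto
  have Fq: "(F ^^ i) q = sw ((F ^^ (l' - i)) (sw z))" if "i \<le> l'" for i
    unfolding q_def using l' neA that by (intro F_iter_sw) auto
  have Fqz: "(F ^^ l') q = z" using Fq[of l'] by simp
  define M where "M = l' + l"
  have FqM: "(F ^^ (l' + i)) q = (F ^^ i) z" for i by (simp add: Fqz funpow_funpow[symmetric] add.commute)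
  have KM: "(F ^^ i) q \<in> K" if "i \<le> M" for i
  proof (cases "i \<le> l'")
    case True then show ?thesis using Fq[OF True] l'(2)[of "l' - i"] K_sw by simp
  next
    case False
    then obtain j where "i = l' + j" by (metis le_add_diff_inverse nat_le_linear)
    then show ?thesis using FqM[of j] l(2)[of j] that by (simp add: M_def)
  qed
  have neM: "fst ((F ^^ i) q) \<noteq> 1" if "i < M" for i
  proof (cases "i < l'")
    case True
    then obtain j where j: "l' - i = Suc j" by (metis Suc_diff_Suc)
    have "fst ((F ^^ i) q) = A + 1 - fst ((F ^^ j) (sw z))" using Fq[of i] True j by (simp add: F_def)
    moreover have "j \<le> l'" using j by linarith
    ultimately show ?thesis using neA[OF l'(2)[of j]] by auto
  next
    case False
    then obtain j where "i = l' + j" by (metis le_add_diff_inverse not_le)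
    then show ?thesis using FqM[of j] l(3)[of j] that by (simp add: M_def)
  qed
  \<comment> \<open>The perturbed orbit has to pass through \<open>V\<close> at time
    \<open>l'\<close>, when the original one is at \<open>z\<close>, and to leave within
    \<open>d\<close> of the sides \<open>x = 1\<close> at the end and \<open>y = - 1\<close> at the
    start.\<close>
  define T where "T i = (if i = l' then {w. emb w \<in> V} else UNIV) \<inter>
     (if i = M then {w. fst ((F ^^ M) q) = 1 \<longrightarrow> fst w < 1 + d} else UNIV) \<inter>
     (if i = 0 then {w. snd q = - 1 \<longrightarrow> - 1 - d < snd w} else UNIV)" for i
  have o1: "open {z :: real \<times> real. P \<longrightarrow> fst z < 1 + d}" "open {z :: real \<times> real. P \<longrightarrow> - 1 - d < snd z}" for P
    by (cases P; auto intro!: open_Collect_less continuous_intros)+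
  have "open (T i) \<and> (F ^^ i) q \<in> T i" for i
    using V d(1) Fqz by (auto simp: T_def intro!: open_Int o1 open_emb_vimage)
  from F_iter_nhd[of M q T, OF neM this] obtain e where e: "0 < e"
    "\<And>w i. dist w q < e \<Longrightarrow> i \<le> M \<Longrightarrow> (F ^^ i) w \<in> T i" by metis
  obtain w where w: "dist w q < e" "\<And>i. i \<le> M \<Longrightarrow> (F ^^ i) w \<in> G (code ((F ^^ i) q))"
    using perturb_interior[OF KM neM e(1)] by metis
  define v where "v = (F ^^ l') w"
  have "emb v \<in> V" using e(2)[OF w(1), of l'] by (simp add: T_def M_def v_def)
  moreover have "emb v \<in> SB (cw z) n m"
    unfolding SB_def
  proof (intro CollectI ballI)
    have vG: "(F ^^ i) v \<in> G (code ((F ^^ i) z))" if "i \<le> l" for i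
      using w(2)[of "l' + i"] FqM[of i] that by (simp add: v_def funpow_funpow M_def add.commute)
    have vd: "fst ((F ^^ l) z) = 1 \<Longrightarrow> fst ((F ^^ l) v) < 1 + d"
      using e(2)[OF w(1), of M] FqM[of l] by (simp add: T_def M_def v_def funpow_funpow add.commute split: if_splits)
    have wne: "fst ((F ^^ i) w) \<noteq> 1 \<and> fst ((F ^^ i) w) \<noteq> A" if "i < l'" for i
    proof -
      have G1: "(F ^^ i) w \<in> G (code ((F ^^ i) q))" and G2: "F ((F ^^ i) w) \<in> G (code ((F ^^ Suc i) q))"
        using w(2)[of i] w(2)[of "Suc i"] that by (auto simp: M_def)
      have "fst (F ((F ^^ i) w)) \<noteq> 0" using G2 by (auto simp: G_def split: if_splits)
      then have "fst ((F ^^ i) w) \<noteq> A" by (auto simp: F_def)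
      then show ?thesis using G_fst[OF G1] by simp
    qed
    have Fv: "(F ^^ i) (sw v) = sw ((F ^^ (l' - i)) w)" if "i \<le> l'" for i
      unfolding v_def using wne that by (intro F_iter_sw) auto
    have code_sw: "code (sw u) = code u" if "u \<in> K" for u
      using K_imp[OF that] by (auto simp: code_def)
    have svG: "(F ^^ i) (sw v) \<in> G (code ((F ^^ i) (sw z)))" if i: "i \<le> l'" for i
    proof -
      have "code ((F ^^ i) (sw z)) = code ((F ^^ (l' - i)) q)"
        using Fq[of "l' - i"] i code_sw[OF l'(2)[OF i]] by simp
      then show ?thesis unfolding Fv[OF i] G_sw using w(2)[of "l' - i"] by (simp add: M_def)
    qed
    have svd: "fst ((F ^^ l') (sw z)) = 1 \<Longrightarrow> fst ((F ^^ l') (sw v)) < 1 + d"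
      using e(2)[OF w(1), of 0] Fv[of l'] by (auto simp: T_def q_def split: if_splits)
    fix k assume k: "k \<in> {- int n..int m}"
    show "f_pow k (emb v) \<in> emb ` G (cw z k)"
    proof (cases k rule: int_cases2)
      case (nonneg j)
      have "(f ^^ j) (emb v) \<in> emb ` G (cw z (int j))"
        by (rule orbit_in_G[OF l(2,3,1,4) vG _ vd]) (use d(2) k nonneg in auto)
      then show ?thesis using nonneg by simp
    next
      case (nonpos j)
      have "(f ^^ j) (emb (sw v)) \<in> emb ` G (cw (sw z) (int j))"
        by (rule orbit_in_G[OF l'(2,3,1,4) svG _ svd]) (use d(2) k nonpos in auto)
      then have "flip ((fi ^^ j) (emb v)) \<in> emb ` G (cw z (- int j))"
        by (simp add: flip_emb[symmetric] funpow_f_flip cw_sw)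
      then show ?thesis using nonpos by (simp add: flip_G_iff)
    qed
  qed
  ultimately show "\<exists>y. y \<in> SB (cw z) n m \<and> y \<in> V" by blast
qed

lemma nonwandering_set_eq:
  "nonwandering_set (- A) = {(x, y). x = None} \<union> {(x, y). y = None} \<union> Omega (- A)
   \<and> {(x, y). x = None} \<union> {(x, y). y = None} \<union> Omega (- A)
       = topspace torus - (basin_plus (- A) \<union> basin_minus (- A))"
proof -
  let ?L = "{(x, y). x = None} \<union> {(x, y). y = None} :: pt set"
  let ?B = "basin_plus (- A) \<union> basin_minus (- A)"
  have L: "p \<in> ?L \<longleftrightarrow> p \<notin> range emb" for p by (cases p rule: pt_cases) (auto simp: emb_def)
  have 1: "?L \<union> Omega (- A) \<subseteq> nonwandering_set (- A)"
  proof
    fix p assume p: "p \<in> ?L \<union> Omega (- A)"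
    have "\<not> wandering (- A) p"
    proof (cases "p \<in> range emb")
      case True
      then obtain z c where "p = emb z" "c \<in> golden_words" "emb z \<in> wrect c" using p L by (auto simp: Omega_def)
      then show ?thesis using Omega_finite_not_wandering by blast
    qed (rule infinity_not_wandering)
    then show "p \<in> nonwandering_set (- A)" by (simp add: nonwandering_set_def topspace_torus)
  qed
  moreover have 2: "nonwandering_set (- A) \<subseteq> topspace torus - ?B"
    using basin_wandering by (auto simp: nonwandering_set_def)
  moreover have 3: "topspace torus - ?B \<subseteq> ?L \<union> Omega (- A)"
  proof
    fix p assume p: "p \<in> topspace torus - ?B"
    show "p \<in> ?L \<union> Omega (- A)"
    proof (cases "p \<in> range emb")
      case True
      then obtain z where z: "p = emb z" "z \<in> K" using p by (auto simp: K_def)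
      then have "p \<in> Omega (- A)"
        using K_subset_wrect[OF z(2)] cw_golden[OF z(2)] unfolding Omega_def z(1) by blast
      then show ?thesis by blast
    qed (use L in blast)
  qed
  ultimately show ?thesis by blast
qed

end

theorem theorem9p6:
  fixes a :: real
  assumes "a < -1"
  shows "nonwandering_set a = {(x, y). x = None} \<union> {(x, y). y = None} \<union> Omega a
       \<and> {(x, y). x = None} \<union> {(x, y). y = None} \<union> Omega a
           = topspace torus - (basin_plus a \<union> basin_minus a)"
proof -
  interpret golden "- a" using assms by unfold_locales simp
  show ?thesis using nonwandering_set_eq by simp
qed

end
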